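(* Let $e\geq 2$, let $N=\langle\sigma\rangle$ be cyclic of order $2^e$, and let $G$ be a transitive subgroup of $\mathrm{Hol}(N)$. Let $H$ be any subgroup of $G$ of index $2^e$ and $C=\mathrm{Core}_G(H)$. Then the following are equivalent: (1) $G/C$ is not isomorphic to any transitive subgroup $T$ of $\mathrm{Hol}(N)$ under an isomorphism that takes $H/C$ to $\mathrm{Stab}_T(1_N)$; (2) one of the following holds: (i) $|H\cap N|\geq 4$; (ii) $|H\cap N|=2$ and $G$ has no element of order $2^e$; (iii) $|H\cap N|=2$ and $H$ is not normal in $G$; (iv) $|H\cap N|=1$, $H=\langle[\sigma^u,\varphi_{-1}]\rangle$ for some odd integer $u$, $|G|=2^{e+1}$, $\mathrm{Stab}_G(1_N)=\langle\varphi_{1+2^{e-1}}\rangle$, and either $|G\cap N|\geq 8$ or $|G\cap N|=|[G,G]|=4$.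
   Context: For an odd integer $a$, $\varphi_a\in\mathrm{Aut}(N)$ denotes $\sigma\mapsto\sigma^a$. $\mathrm{Hol}(N)=N\rtimes\mathrm{Aut}(N)$; its elements are written $[\sigma^u,\varphi_a]$ with multiplication $[\sigma^u,\varphi_a][\sigma^v,\varphi_b]=[\sigma^{u+va},\varphi_{ab}]$, and $N$ and $\mathrm{Aut}(N)$ are identified with the subgroups of elements $[\sigma^u,\varphi_1]$ and $[1,\varphi_a]$ respectively. $\mathrm{Hol}(N)$ acts on $N$ by $[\sigma^u,\varphi_a]\cdot\sigma^v=\sigma^{u+av}$. A subgroup is transitive if this action restricted to it is transitive; $\mathrm{Stab}_T(1_N)=T\cap\mathrm{Aut}(N)$ is the stabiliser of the identity. $\mathrm{Core}_G(H)$ is the largest normal subgroup of $G$ contained in $H$; $[G,G]$ is the commutator subgroup. *)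

theory Defs
  imports "HOL-Algebra.Coset" "HOL-Algebra.Generated_Groups" "HOL-Algebra.Multiplicative_Group"
begin

text \<open>N = cyclic group of order 2^e, sigma^u represented by the residue u in {0..<2^e}.
  Aut(N) = {phi_a | a odd}, phi_a represented by the residue a mod 2^e.
  Hol(N) element [sigma^u, phi_a] is the pair (u, a).\<close>

definition hol :: "nat \<Rightarrow> (int \<times> int) monoid" where
  "hol e = \<lparr> carrier = {x :: int \<times> int. 0 \<le> fst x \<and> fst x < 2^e \<and> 0 \<le> snd x \<and> snd x < 2^e \<and> odd (snd x)},
             mult = (\<lambda>x y. ((fst x + fst y * snd x) mod 2^e, (snd x * snd y) mod 2^e)),
             one = (0, 1) \<rparr>"

definition holN :: "nat \<Rightarrow> (int \<times> int) set" where
  "holN e = {(u, a) \<in> carrier (hol e). a = 1}"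

definition holAut :: "nat \<Rightarrow> (int \<times> int) set" where
  "holAut e = {(u, a) \<in> carrier (hol e). u = 0}"

definition hol_act :: "nat \<Rightarrow> int \<times> int \<Rightarrow> int \<Rightarrow> int" where
  "hol_act e g v = (fst g + snd g * v) mod 2^e"

definition transitive_sub :: "nat \<Rightarrow> (int \<times> int) set \<Rightarrow> bool" where
  "transitive_sub e T \<longleftrightarrow> subgroup T (hol e) \<and>
     (\<forall>v w. 0 \<le> v \<and> v < 2^e \<and> 0 \<le> w \<and> w < 2^e \<longrightarrow> (\<exists>g\<in>T. hol_act e g v = w))"

text \<open>Stabiliser of the identity 1_N (= residue 0).\<close>
definition stab1 :: "nat \<Rightarrow> (int \<times> int) set \<Rightarrow> (int \<times> int) set" where
  "stab1 e T = T \<inter> holAut e"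

definition core :: "('a, 'b) monoid_scheme \<Rightarrow> 'a set \<Rightarrow> 'a set" where
  "core K H = (\<Inter>g\<in>carrier K. {g \<otimes>\<^bsub>K\<^esub> h \<otimes>\<^bsub>K\<^esub> inv\<^bsub>K\<^esub> g | h. h \<in> H})"

end

theory Submission
  imports Defs "HOL-Number_Theory.Cong"
begin

text \<open>An isomorphism from \<open>G/C\<close> onto a transitive subgroup of the holomorph carrying \<open>H/C\<close> to the
  point stabiliser amounts to a homomorphism \<open>x \<mapsto> (v \<mapsto> c x + \<alpha> x v)\<close> from \<open>G\<close> to the affine maps of
  \<open>\<int>/2\<^sup>e\<close> whose stabiliser of 0 is \<open>H\<close>; its kernel is then automatically the core. So two affine
  representations of one abstract group are compared: the given faithful one, \<open>(X, A)\<close>, and the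
  wanted one, \<open>(c, \<alpha>)\<close>.

  Orders of elements obstruct \<open>(c, \<alpha>)\<close>: transitivity forces an \<open>x\<close> with \<open>c x \<equiv> 2\<close> and
  \<open>\<alpha> x \<equiv> 1\<close> mod 4, whose power \<open>2 ^ (e - 2)\<close> lies outside \<open>H\<close>. If \<open>|H \<inter> N| \<ge> 4\<close> there is no such
  \<open>x\<close>; if \<open>|H \<inter> N| = 2\<close> and \<open>e \<ge> 3\<close>, then \<open>x\<close> has order \<open>2\<^sup>e\<close> in \<open>G\<close>, and comparing commutators with \<open>x\<close>
  shows that \<open>\<alpha>\<close> is trivial on \<open>H\<close>, so that \<open>H\<close> is normal. Conversely, if \<open>|H \<inter> N| = 2\<close>, \<open>H\<close> is normal
  and \<open>G\<close> has an element of order \<open>2\<^sup>e\<close>, then \<open>G/H\<close> has a cyclic subgroup of index 2 and embeds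
  regularly. If \<open>H \<inter> N\<close> is trivial, the elements of \<open>H\<close> with \<open>A \<equiv> 1\<close> mod 4 have a common fixed point,
  which may be moved to 0; a representation is then obtained by twisting \<open>(X, A)\<close> explicitly,
  except in case (iv).\<close>

section \<open>Geometric sums modulo powers of two\<close>

text \<open>Call \<open>A x\<close> the slope of \<open>x\<close>, and call \<open>x\<close> regular
  if \<open>X x\<close> is odd and its slope is 1 modulo 4. The slope modulo 4 decides everything
  about powers, because the \<open>n\<close>-th power of \<open>v \<mapsto> c + a * v\<close> has
  translation part \<open>c * geo a n\<close>. For \<open>a \<equiv> 1\<close> mod 4 this sum has
  the same 2-adic valuation as \<open>n\<close>: powers behave like those of a translation, and a
  regular element is a single cycle of length \<open>2 ^ e\<close>. For \<open>a \<equiv> 3\<close>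
  one squaring gains two factors 2, which shortens the order. The obstacle is that
  \<open>A x\<close> and \<open>\<alpha> x\<close> come from the same abstract element but cannot be
  compared directly. Only membership in \<open>H\<close> can be, for powers and for commutators.
  Commutators have slope 1 in both representations, and this is how knowledge about the translations
  in \<open>H\<close> reaches \<open>\<alpha>\<close>. The regular embedding of a quotient needs an
  explicit pair of affine maps for each type of group of order \<open>2 ^ e\<close> with a cyclic
  subgroup of index 2; there the slopes are found by solving the defining relations.\<close>

definition geo :: "int \<Rightarrow> nat \<Rightarrow> int" where
  "geo a n = (\<Sum>i<n. a ^ i)"

lemma geo_0 [simp]: "geo a 0 = 0"
  and geo_Suc: "geo a (Suc n) = geo a n + a ^ n"
  by (simp_all add: geo_def)

lemma geo_1 [simp]: "geo a (Suc 0) = 1"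
  by (simp add: geo_def)

lemma geo_add: "geo a (m + n) = geo a m + a ^ m * geo a n"
  by (induction n) (simp_all add: geo_Suc power_add algebra_simps)

lemma geo_mult: "geo a (m * n) = geo a m * geo (a ^ m) n"
proof (induction n)
  case (Suc n)
  have "geo a (m * Suc n) = geo a (m * n + m)" by (simp add: add.commute)
  also have "\<dots> = geo a m * geo (a ^ m) (Suc n)"
    unfolding geo_add Suc.IH by (simp add: geo_Suc power_mult algebra_simps)
  finally show ?case .
qed simp

lemma geo_diff: "(a - 1) * geo a n = a ^ n - 1"
  by (induction n) (simp_all add: geo_Suc algebra_simps)

lemma even_geo_iff: "odd a \<Longrightarrow> even (geo a n) \<longleftrightarrow> even n"
  by (induction n) (auto simp: geo_Suc)

lemma mod4_power: "a mod 4 = 1 \<Longrightarrow> a ^ n mod 4 = (1::int)"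
  using power_mod[of a 4 n] by simp

lemma odd_mod4: "odd (a::int) \<Longrightarrow> a mod 4 = 1 \<or> a mod 4 = 3"
  by presburger

lemma mod4_eq_1_odd: "a mod 4 = (1::int) \<Longrightarrow> odd a"
  by presburger

lemma mod4_eq_1_dvd: "a mod 4 = (1::int) \<Longrightarrow> 2 ^ 2 dvd a - 1"
  by simp presburger

text \<open>Doubling: \<open>geo a (2 * m) = geo a m * (1 + a ^ m)\<close>, and the new factor is 2
  modulo 4. For \<open>a \<equiv> 3\<close> mod 4 this already fails at \<open>m = 1\<close>, where
  4 divides \<open>1 + a\<close>.\<close>

lemma geo_pow2:
  assumes "a mod 4 = 1"
  shows "\<exists>t. odd t \<and> geo a (2 ^ n) = 2 ^ n * t"
proof (induction n)
  case 0
  then show ?case by (auto intro: exI[of _ 1])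
next
  case (Suc n)
  then obtain t where t: "odd t" "geo a (2 ^ n) = 2 ^ n * t" by blast
  have "a ^ (2 ^ n) mod 4 = 1" using assms by (rule mod4_power)
  then obtain k where k: "a ^ (2 ^ n) = 4 * k + 1" by (metis mult_div_mod_eq add.commute)
  have "geo a (2 ^ n * 2) = 2 ^ n * t * (1 + (4 * k + 1))"
    unfolding geo_mult t(2) k by (simp add: geo_def numeral_2_eq_2)
  also have "\<dots> = 2 ^ Suc n * (t * (2 * k + 1))"
    by (simp add: algebra_simps)
  finally show ?case using t(1) by (auto simp: mult.commute)
qed

lemma two_adic_nat:
  assumes "n \<noteq> (0::nat)"
  obtains r t where "n = 2 ^ r * t" "odd t"
  using assms
proof (induction n arbitrary: thesis rule: less_induct)
  case (less n)
  show ?case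
  proof (cases "odd n")
    case True
    then show ?thesis using less.prems(1)[of 0 n] by simp
  next
    case False
    then obtain m where m: "n = 2 * m" by blast
    show ?thesis
    proof (rule less.IH[of m])
      show "m < n" "m \<noteq> 0" using m less.prems(2) by auto
      fix r t assume "m = 2 ^ r * t" "odd t"
      then show thesis using less.prems(1)[of "Suc r" t] m by simp
    qed
  qed
qed

lemma two_adic_int:
  assumes "w \<noteq> (0::int)"
  obtains r t where "w = 2 ^ r * t" "odd t"
proof -
  obtain r t where rt: "nat \<bar>w\<bar> = 2 ^ r * t" "odd t"
    using two_adic_nat[of "nat \<bar>w\<bar>"] assms by auto
  have "\<bar>w\<bar> = 2 ^ r * int t"
    using arg_cong[OF rt(1), of int] by simp
  then have "sgn w * \<bar>w\<bar> = 2 ^ r * (sgn w * int t)" by simp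
  then have "w = 2 ^ r * (sgn w * int t)" by (simp add: sgn_mult_abs)
  moreover have "odd (sgn w * int t)" using rt(2) assms by (auto simp: sgn_if)
  ultimately show thesis by (rule that)
qed

lemma pow2_dvd_mult_odd: "odd (t::int) \<Longrightarrow> 2 ^ k dvd w * t \<longleftrightarrow> 2 ^ k dvd w"
  by (meson coprime_dvd_mult_left_iff coprime_power_left_iff coprime_left_2_iff_odd)

text \<open>The 2-part of \<open>n\<close> is handled by \<open>geo_pow2\<close>, and the odd part
  contributes an odd sum. So \<open>geo a n\<close> and \<open>n\<close> differ by a 2-adic unit,
  written as a fraction \<open>s / t\<close> to stay inside the integers.\<close>

lemma geo_odd_multiple:
  assumes "a mod 4 = 1"
  obtains s t where "odd s" "odd t" "geo a n * t = int n * s"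
proof (cases "n = 0")
  case True
  then show thesis using that[of 1 1] by simp
next
  case False
  then obtain r t where n: "n = 2 ^ r * t" "odd t" by (rule two_adic_nat)
  obtain s where s: "odd s" "geo a (2 ^ r) = 2 ^ r * s" using geo_pow2[OF assms] by blast
  have "odd (geo (a ^ 2 ^ r) t)"
    using n even_geo_iff[of "a ^ 2 ^ r"] mod4_eq_1_odd[OF assms] by simp
  then show thesis
    using that[of "s * geo (a ^ 2 ^ r) t" "int t"] n s by (simp add: geo_mult)
qed

lemma pow2_dvd_mult_geo_iff:
  assumes "a mod 4 = 1"
  shows "2 ^ k dvd w * geo a n \<longleftrightarrow> 2 ^ k dvd w * int n"
proof -
  obtain s t where st: "odd s" "odd t" "geo a n * t = int n * s"
    using assms by (rule geo_odd_multiple)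
  have "2 ^ k dvd w * geo a n \<longleftrightarrow> 2 ^ k dvd (w * geo a n) * t"
    by (simp only: pow2_dvd_mult_odd[OF st(2)])
  also have "(w * geo a n) * t = (w * int n) * s" using st(3) by simp
  also have "2 ^ k dvd (w * int n) * s \<longleftrightarrow> 2 ^ k dvd w * int n"
    by (simp only: pow2_dvd_mult_odd[OF st(1)])
  finally show ?thesis .
qed

lemma pow2_dvd_geo_iff: "a mod 4 = 1 \<Longrightarrow> 2 ^ k dvd geo a n \<longleftrightarrow> 2 ^ k dvd int n"
  using pow2_dvd_mult_geo_iff[of a k 1 n] by simp

lemma pow_mod_pow2_eq_1:
  assumes "a mod 4 = (1::int)" "2 ^ s dvd a - 1"
  shows "2 ^ (s + n) dvd a ^ (2 ^ n) - 1"
proof -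
  have "2 ^ n dvd geo a (2 ^ n)" by (simp add: pow2_dvd_geo_iff[OF assms(1)])
  then have "2 ^ s * 2 ^ n dvd (a - 1) * geo a (2 ^ n)" using assms(2) by (rule mult_dvd_mono[rotated])
  then show ?thesis by (simp add: geo_diff power_add)
qed

lemma geo_cong_iff:
  assumes "a mod 4 = 1"
  shows "[geo a i = geo a j] (mod 2 ^ k) \<longleftrightarrow> [int i = int j] (mod 2 ^ k)"
proof -
  have *: "2 ^ k dvd geo a j - geo a i \<longleftrightarrow> 2 ^ k dvd int j - int i" if "i \<le> j" for i j
  proof -
    have "geo a j - geo a i = geo a (j - i) * a ^ i"
      using geo_add[of a i "j - i"] that by simp
    moreover have "odd (a ^ i)" using mod4_eq_1_odd[OF assms] by simp
    ultimately have "2 ^ k dvd geo a j - geo a i \<longleftrightarrow> 2 ^ k dvd geo a (j - i)"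
      by (simp add: pow2_dvd_mult_odd)
    then show ?thesis using that by (simp add: pow2_dvd_geo_iff[OF assms] of_nat_diff)
  qed
  show ?thesis
    using *[of i j] *[of j i] by (cases "i \<le> j") (simp_all add: cong_iff_dvd_diff dvd_diff_commute)
qed

text \<open>By \<open>geo_cong_iff\<close> the first \<open>2 ^ k\<close> sums are distinct modulo
  \<open>2 ^ k\<close>, so they exhaust the residues: \<open>v \<mapsto> 1 + a * v\<close> is a
  single cycle.\<close>

lemma geo_surj:
  assumes "a mod 4 = 1"
  shows "\<exists>n. [geo a n = w] (mod 2 ^ k)"
proof -
  let ?f = "\<lambda>i. geo a i mod 2 ^ k"
  have inj: "inj_on ?f {..<2 ^ k}"
  proof (rule inj_onI)
    fix i j assume ij: "i \<in> {..<2 ^ k}" "j \<in> {..<2 ^ k}" "geo a i mod 2 ^ k = geo a j mod 2 ^ k"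
    then have "[int i = int j] (mod 2 ^ k)"
      using geo_cong_iff[OF assms] by (simp add: cong_def)
    then have "[int i = int j] (mod int (2 ^ k))" by simp
    then have "[i = j] (mod 2 ^ k)" by (simp only: cong_int_iff)
    then show "i = j" using ij(1,2) by (simp add: cong_def)
  qed
  have "?f ` {..<2 ^ k} = {0..<2 ^ k}"
  proof (rule card_subset_eq)
    show "card (?f ` {..<2 ^ k}) = card {0..<(2::int) ^ k}"
      by (simp add: card_image[OF inj] nat_power_eq)
  qed auto
  then have "w mod 2 ^ k \<in> ?f ` {..<2 ^ k}" by (simp only: atLeastLessThan_iff) simp
  then obtain n where "w mod 2 ^ k = geo a n mod 2 ^ k" by (rule imageE)
  then show ?thesis by (auto simp: cong_def)
qed

text \<open>The Groebner basis method rejects powers with a symbolic exponent, so the proofs that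
  use it first fold them into this opaque constant.\<close>

definition two_pow :: "nat \<Rightarrow> int" where
  "two_pow k = 2 ^ k"

lemmas fold_cong = cong_iff_dvd_diff two_pow_def[symmetric]

lemma cong_power2_even:
  assumes "[x = y] (mod 2 ^ k)" "1 \<le> k"
  shows "even (x::int) \<longleftrightarrow> even y"
proof -
  have "(2::int) dvd 2 ^ k" using le_imp_power_dvd[OF assms(2), of "2::int"] by simp
  then show ?thesis using assms(1) cong_dvd_modulus cong_dvd_iff by blast
qed

lemma cong_power2_mod4:
  assumes "[x = y] (mod 2 ^ k)" "2 \<le> k"
  shows "x mod 4 = y mod (4::int)"
proof -
  have "(4::int) dvd 2 ^ k" using le_imp_power_dvd[OF assms(2), of "2::int"] by simp
  then show ?thesis using cong_dvd_modulus[OF assms(1)] by (simp add: cong_def)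
qed


lemma pow2_dvd_mult_half_iff:
  assumes "1 \<le> k"
  shows "(2::int) ^ k dvd w * 2 ^ (k - 1) \<longleftrightarrow> even w"
proof -
  have "(2::int) ^ k = 2 * 2 ^ (k - 1)" using assms by (cases k) auto
  then show ?thesis by simp
qed

text \<open>In \<open>(b - 1) * (b + 1)\<close> the second factor is 2 modulo 4 and absorbs exactly
  one factor 2. So the only candidates for square roots of 1 that are 1 modulo 4 are 1 and
  \<open>1 + 2 ^ (k - 1)\<close>.\<close>

lemma pow2_dvd_pred_of_square:
  assumes "b mod 4 = (1::int)" "2 ^ k dvd b * b - 1"
  shows "2 ^ (k - 1) dvd b - 1"
proof -
  define j where "j = b div 4"
  have b: "b = 4 * j + 1" using mult_div_mod_eq[of 4 b] assms(1) by (simp add: j_def)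
  have "b * b - 1 = 2 * ((b - 1) * (2 * j + 1))" by (simp add: b algebra_simps)
  then have "2 * 2 ^ (k - 1) dvd 2 * ((b - 1) * (2 * j + 1))" if "1 \<le> k"
    using assms(2) that by (cases k) simp_all
  then have "2 ^ (k - 1) dvd (b - 1) * (2 * j + 1)" by (cases k) auto
  then show ?thesis by (subst (asm) pow2_dvd_mult_odd) simp_all
qed


lemma pow2_not_dvd_less: "\<not> 2 ^ k dvd 2 ^ s * (t::int) \<Longrightarrow> s < k"
  by (meson dvd_mult2 le_imp_power_dvd not_less)


lemma four_dvd_pow2:
  assumes "2 ^ 2 dvd (2::int) ^ r"
  shows "2 \<le> r"
proof (rule ccontr)
  assume "\<not> 2 \<le> r"
  then have "r \<in> {0, 1}" by auto
  then have "(2::int) ^ r \<in> {1, 2}" by auto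
  then show False using assms by auto
qed

section \<open>Affine representations\<close>

lemma (in subgroup) nat_pow_in_subgroup: "x \<in> H \<Longrightarrow> x [^] (n::nat) \<in> H"
  by (induction n) auto

text \<open>\<open>x\<close> acts as \<open>v \<mapsto> X x + A x * v\<close>; thus \<open>A\<close>
  is a character and \<open>X\<close> a crossed homomorphism. Values are arbitrary integers read
  modulo \<open>2 ^ e\<close>, so that further representations can be given by plain formulas
  without reduction.\<close>

locale affine_rep = group G for G (structure) +
  fixes e :: nat and X A :: "'a \<Rightarrow> int"
  assumes e_ge_2: "2 \<le> e"
    and X_mult: "\<lbrakk>x \<in> carrier G; y \<in> carrier G\<rbrakk> \<Longrightarrow> [X (x \<otimes> y) = X x + A x * X y] (mod 2 ^ e)"
    and A_mult: "\<lbrakk>x \<in> carrier G; y \<in> carrier G\<rbrakk> \<Longrightarrow> [A (x \<otimes> y) = A x * A y] (mod 2 ^ e)"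
    and A_odd: "x \<in> carrier G \<Longrightarrow> odd (A x)"
begin

lemma e_split: obtains "(2::int) ^ e = 2 * 2 ^ (e - 1)" "(2::int) ^ (e - 1) = 2 * 2 ^ (e - 2)"
    "(2::int) ^ e = 4 * 2 ^ (e - 2)"
proof -
  obtain d where "e = Suc (Suc d)" using e_ge_2 by (metis add_2_eq_Suc le_Suc_ex)
  then show thesis using that by simp
qed

lemma A_one: "[A \<one> = 1] (mod 2 ^ e)"
proof -
  have "2 ^ e dvd (A \<one> - 1) * A \<one>"
    using A_mult[of \<one> \<one>] unfolding cong_iff_dvd_diff by (simp add: algebra_simps dvd_diff_commute)
  then show ?thesis by (simp add: pow2_dvd_mult_odd A_odd cong_iff_dvd_diff)
qed

lemma X_one: "[X \<one> = 0] (mod 2 ^ e)"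
proof -
  have "2 ^ e dvd X \<one> * A \<one>"
    using X_mult[of \<one> \<one>] unfolding cong_iff_dvd_diff by (simp add: mult.commute)
  then show ?thesis by (simp add: pow2_dvd_mult_odd A_odd cong_iff_dvd_diff)
qed

lemma A_pow: "x \<in> carrier G \<Longrightarrow> [A (x [^] (n::nat)) = A x ^ n] (mod 2 ^ e)"
proof (induction n)
  case (Suc n)
  then have "[A (x [^] n) * A x = A x ^ n * A x] (mod 2 ^ e)" by (intro cong_mult cong_refl) simp
  then show ?case using A_mult[of "x [^] n" x] Suc.prems by (simp add: cong_def mult.commute)
qed (simp add: A_one)

lemma X_pow: "x \<in> carrier G \<Longrightarrow> [X (x [^] (n::nat)) = X x * geo (A x) n] (mod 2 ^ e)"
proof (induction n)
  case (Suc n)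
  then have "[X (x [^] n) + A (x [^] n) * X x = X x * geo (A x) n + A x ^ n * X x] (mod 2 ^ e)"
    using A_pow[of x n] by (intro cong_add cong_mult cong_refl) simp_all
  then show ?case using X_mult[of "x [^] n" x] Suc.prems
    by (simp add: cong_def geo_Suc distrib_left mult.commute)
qed (simp add: X_one)

lemma A_inv: "x \<in> carrier G \<Longrightarrow> [A (inv x) * A x = 1] (mod 2 ^ e)"
  using A_mult[of "inv x" x] A_one by (simp add: cong_def)

lemma X_inv: "x \<in> carrier G \<Longrightarrow> [X (inv x) + A (inv x) * X x = 0] (mod 2 ^ e)"
  using X_mult[of "inv x" x] X_one by (simp add: cong_def)

lemma X_inv_mult:
  assumes "x \<in> carrier G" "y \<in> carrier G"
  shows "[X (inv x \<otimes> y) = A (inv x) * (X y - X x)] (mod 2 ^ e)"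
  using X_mult[of "inv x" y] X_inv[of x] assms unfolding fold_cong
  by simp Groebner_Basis.algebra

text \<open>\<open>X x\<close> is the image of 0 under \<open>x\<close>, and the unit
  \<open>A (inv x)\<close> in \<open>X_inv_mult\<close> cancels.\<close>

lemma X_inv_mult_0_iff:
  assumes "x \<in> carrier G" "y \<in> carrier G"
  shows "[X (inv x \<otimes> y) = 0] (mod 2 ^ e) \<longleftrightarrow> [X x = X y] (mod 2 ^ e)"
proof -
  have "[X (inv x \<otimes> y) = 0] (mod 2 ^ e) \<longleftrightarrow> 2 ^ e dvd (X y - X x) * A (inv x)"
    using X_inv_mult[OF assms] by (simp add: cong_def mod_eq_0_iff_dvd[symmetric] mult.commute)
  then show ?thesis using assms A_odd[of "inv x"]
    by (simp add: pow2_dvd_mult_odd cong_iff_dvd_diff dvd_diff_commute)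
qed

lemma A_inv_mult_1:
  assumes "x \<in> carrier G" "y \<in> carrier G" "[A x = A y] (mod 2 ^ e)"
  shows "[A (inv x \<otimes> y) = 1] (mod 2 ^ e)"
  using A_mult[of "inv x" y] A_inv[of x] assms unfolding fold_cong
  by simp Groebner_Basis.algebra

lemma A_mult_mod4:
  assumes "x \<in> carrier G" "y \<in> carrier G"
  shows "A (x \<otimes> y) mod 4 = A x * A y mod 4"
  using cong_power2_mod4[OF A_mult[OF assms] e_ge_2] .

lemma X_mult_mod4:
  assumes "x \<in> carrier G" "y \<in> carrier G"
  shows "X (x \<otimes> y) mod 4 = (X x + A x * X y) mod 4"
  using cong_power2_mod4[OF X_mult[OF assms] e_ge_2] .

lemma X_mult_even:
  assumes "x \<in> carrier G" "y \<in> carrier G"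
  shows "even (X (x \<otimes> y)) \<longleftrightarrow> even (X x + X y)"
  using cong_power2_even[OF X_mult[OF assms]] e_ge_2 A_odd[OF assms(1)] by simp

lemma A_mod4: "x \<in> carrier G \<Longrightarrow> A x mod 4 = 1 \<or> A x mod 4 = 3"
  using A_odd odd_mod4 by blast

lemma A_mult_mod4_eq_1:
  assumes "x \<in> carrier G" "y \<in> carrier G"
  shows "A (x \<otimes> y) mod 4 = 1 \<longleftrightarrow> (A x mod 4 = 1 \<longleftrightarrow> A y mod 4 = 1)"
proof -
  have *: "A x * A y mod 4 = ((A x mod 4) * (A y mod 4)) mod 4" by (simp add: mod_mult_eq)
  show ?thesis unfolding A_mult_mod4[OF assms] *
    using A_mod4[OF assms(1)] A_mod4[OF assms(2)] by auto
qed

lemma A_inv_mod4: "x \<in> carrier G \<Longrightarrow> A (inv x) mod 4 = 1 \<longleftrightarrow> A x mod 4 = 1"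
  using A_mult_mod4_eq_1[of "inv x" x] cong_power2_mod4[OF A_one e_ge_2] by simp

lemma X_pow_dvd_iff:
  assumes "x \<in> carrier G" "A x mod 4 = 1" "k \<le> e"
  shows "2 ^ k dvd X (x [^] (n::nat)) \<longleftrightarrow> 2 ^ k dvd X x * int n"
proof -
  have "[X (x [^] n) = X x * geo (A x) n] (mod 2 ^ k)"
    using X_pow[OF assms(1), of n] assms(3) cong_dvd_modulus le_imp_power_dvd by blast
  then show ?thesis by (simp add: cong_dvd_iff pow2_dvd_mult_geo_iff[OF assms(2)])
qed

lemma A_pow_pow2:
  assumes "x \<in> carrier G" "A x mod 4 = 1" "2 ^ s dvd A x - 1" "e \<le> s + n"
  shows "[A (x [^] (2 ^ n :: nat)) = 1] (mod 2 ^ e)"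
proof -
  have "2 ^ e dvd A x ^ (2 ^ n) - 1"
    using pow_mod_pow2_eq_1[OF assms(2,3), of n] le_imp_power_dvd[OF assms(4)] dvd_trans by blast
  then show ?thesis
    using A_pow[OF assms(1), of "2 ^ n"] cong_trans cong_iff_dvd_diff by blast
qed

end

section \<open>Powers of elements and the slope modulo 4\<close>

context affine_rep
begin

text \<open>Amounts to solving \<open>2 ^ r * t * geo (A x) n = 2 ^ r * y\<close>: \<open>t\<close>
  is invertible, and \<open>geo_surj\<close> provides \<open>n\<close>.\<close>

lemma ex_pow_X_dvd:
  assumes "x \<in> carrier G" "A x mod 4 = 1" "X x = 2 ^ r * t" "odd t" "2 ^ r dvd w"
  shows "\<exists>n::nat. [X (x [^] n) = w] (mod 2 ^ e)"
proof -
  have "coprime t (2 ^ e)" using assms(4) by simp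
  then obtain v where v: "[t * v = 1] (mod 2 ^ e)" using cong_solve_coprime_int by blast
  obtain y where y: "w = 2 ^ r * y" using assms(5) by blast
  obtain n where n: "[geo (A x) n = v * y] (mod 2 ^ e)" using geo_surj[OF assms(2)] by blast
  have "[X (x [^] n) = X x * (v * y)] (mod 2 ^ e)"
    using X_pow[OF assms(1), of n] cong_mult[OF cong_refl n] cong_trans by blast
  also have "X x * (v * y) = (t * v) * w" by (simp add: assms(3) y mult_ac)
  also have "[(t * v) * w = 1 * w] (mod 2 ^ e)" using v by (rule cong_mult[OF _ cong_refl])
  finally show ?thesis by auto
qed

lemma ex_pow_X:
  assumes "x \<in> carrier G" "odd (X x)" "A x mod 4 = 1"
  shows "\<exists>n::nat. [X (x [^] n) = w] (mod 2 ^ e)"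
  using ex_pow_X_dvd[OF assms(1,3), of 0 "X x"] assms(2) by simp

text \<open>If \<open>A x = 4 * k + 3\<close>, then 4 divides \<open>1 + A x\<close> and
  \<open>A x * A x\<close> is 1 modulo 8. The two factors 2 gained by one squaring make the
  \<open>2 ^ (e - 1)\<close>-th power act trivially.\<close>

lemma square_of_3_mod_4:
  assumes "x \<in> carrier G" "A x mod 4 = 3"
  shows "A (x \<otimes> x) mod 4 = 1" "2 ^ 2 dvd X (x \<otimes> x)" "3 \<le> e \<Longrightarrow> 2 ^ 3 dvd A (x \<otimes> x) - 1"
proof -
  show "A (x \<otimes> x) mod 4 = 1" using A_mult_mod4_eq_1[OF assms(1,1)] by simp
  obtain k where k: "A x = 4 * k + 3" using assms(2) by (metis mult_div_mod_eq add.commute)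
  have "X (x \<otimes> x) mod 4 = (X x + A x * X x) mod 4" using X_mult_mod4[OF assms(1,1)] .
  also have "X x + A x * X x = 4 * (X x * (k + 1))" by (simp add: k algebra_simps)
  finally show "2 ^ 2 dvd X (x \<otimes> x)" by (simp add: dvd_eq_mod_eq_0)
  assume "3 \<le> e"
  then have "(2::int) ^ 3 dvd 2 ^ e" by (rule le_imp_power_dvd)
  then have "[A (x \<otimes> x) = A x * A x] (mod 2 ^ 3)" using A_mult[OF assms(1,1)] cong_dvd_modulus by blast
  moreover have "[A x * A x = 1] (mod 2 ^ 3)"
  proof -
    have "A x * A x - 1 = 2 ^ 3 * (2 * k * k + 3 * k + 1)" by (simp add: k algebra_simps)
    then show ?thesis by (simp only: cong_iff_dvd_diff dvd_triv_left)
  qed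
  ultimately show "2 ^ 3 dvd A (x \<otimes> x) - 1" using cong_trans cong_iff_dvd_diff by blast
qed

lemma pow_2_pow_Suc: "x \<in> carrier G \<Longrightarrow> x [^] (2 ^ Suc n :: nat) = (x \<otimes> x) [^] (2 ^ n :: nat)"
  using nat_pow_pow[of x 2 "2 ^ n"] by (simp add: numeral_2_eq_2)

text \<open>For slope 1 modulo 4 the valuations add up by \<open>X_pow_dvd_iff\<close>; for slope 3
  modulo 4 the square is taken first, with the exponent \<open>2 ^ (e - 2)\<close> remaining. The
  three facts share this case split. Only a regular element can have a nontrivial power
  here.\<close>

lemma
  assumes x: "x \<in> carrier G"
  shows A_pow_half: "[A (x [^] (2 ^ (e - 1) :: nat)) = 1] (mod 2 ^ e)"
    and X_pow_half: "2 ^ (e - 1) dvd X (x [^] (2 ^ (e - 1) :: nat))"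
    and X_pow_half_0: "\<not> (odd (X x) \<and> A x mod 4 = 1) \<Longrightarrow> [X (x [^] (2 ^ (e - 1) :: nat)) = 0] (mod 2 ^ e)"
proof -
  have "[A (x [^] (2 ^ (e - 1) :: nat)) = 1] (mod 2 ^ e) \<and> 2 ^ (e - 1) dvd X (x [^] (2 ^ (e - 1) :: nat))
    \<and> (odd (X x) \<and> A x mod 4 = 1 \<or> [X (x [^] (2 ^ (e - 1) :: nat)) = 0] (mod 2 ^ e))"
  proof (cases "A x mod 4 = 1")
    case True
    have "[A (x [^] (2 ^ (e - 1) :: nat)) = 1] (mod 2 ^ e)"
    proof (rule A_pow_pow2[OF x True, of 2])
      show "2 ^ 2 dvd A x - 1" using True by (rule mod4_eq_1_dvd)
    qed (use e_ge_2 in simp)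
    moreover have "2 ^ (e - 1) dvd X (x [^] (2 ^ (e - 1) :: nat))"
      using X_pow_dvd_iff[OF x True, of "e - 1" "2 ^ (e - 1)"] by simp
    moreover have "[X (x [^] (2 ^ (e - 1) :: nat)) = 0] (mod 2 ^ e)" if "even (X x)"
    proof -
      have "2 * 2 ^ (e - 1) dvd X x * int (2 ^ (e - 1))"
        using that by (intro mult_dvd_mono) auto
      then have "2 ^ e dvd X x * int (2 ^ (e - 1))" using e_split by metis
      then show ?thesis using X_pow_dvd_iff[OF x True, of e "2 ^ (e - 1)"] by (simp add: cong_0_iff)
    qed
    ultimately show ?thesis using True by blast
  next
    case False
    then have 3: "A x mod 4 = 3" using A_mod4[OF x] by simp
    have y: "x \<otimes> x \<in> carrier G" using x by simp
    note sq = square_of_3_mod_4[OF x 3]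
    have e1: "e - 1 = Suc (e - 2)" using e_ge_2 by simp
    have pw: "x [^] (2 ^ (e - 1) :: nat) = (x \<otimes> x) [^] (2 ^ (e - 2) :: nat)"
      unfolding e1 using x by (rule pow_2_pow_Suc)
    have "[A ((x \<otimes> x) [^] (2 ^ (e - 2) :: nat)) = 1] (mod 2 ^ e)"
    proof (rule A_pow_pow2[OF y sq(1), of 2])
      show "2 ^ 2 dvd A (x \<otimes> x) - 1" using sq(1) by (rule mod4_eq_1_dvd)
    qed (use e_ge_2 in simp)
    moreover have "2 ^ e dvd X ((x \<otimes> x) [^] (2 ^ (e - 2) :: nat))"
    proof -
      have eq: "(2::int) ^ e = 2 ^ 2 * 2 ^ (e - 2)"
        using e_ge_2 by (simp only: power_add[symmetric] le_add_diff_inverse)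
      have "2 ^ e dvd X (x \<otimes> x) * int (2 ^ (e - 2))"
        unfolding eq by (rule mult_dvd_mono[OF sq(2)]) simp
      then show ?thesis using X_pow_dvd_iff[OF y sq(1), of e "2 ^ (e - 2)"] by simp
    qed
    moreover have "(2::int) ^ (e - 1) dvd 2 ^ e" by (simp add: le_imp_power_dvd)
    ultimately show ?thesis unfolding pw cong_0_iff by (meson dvd_trans)
  qed
  then show "[A (x [^] (2 ^ (e - 1) :: nat)) = 1] (mod 2 ^ e)"
    "2 ^ (e - 1) dvd X (x [^] (2 ^ (e - 1) :: nat))"
    "\<not> (odd (X x) \<and> A x mod 4 = 1) \<Longrightarrow> [X (x [^] (2 ^ (e - 1) :: nat)) = 0] (mod 2 ^ e)"
    by blast+
qed

text \<open>One power of 2 earlier than \<open>X_pow_half_0\<close>. For slope 3 modulo 4,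
  \<open>3 \<le> e\<close> leaves room for one squaring; with \<open>e = 2\<close> the exponent is
  1, and \<open>x\<close> itself is not a translation.\<close>

lemma pow_quarter:
  assumes x: "x \<in> carrier G" and e3: "3 \<le> e" and nonreg: "\<not> (odd (X x) \<and> A x mod 4 = 1)"
  shows "[A (x [^] (2 ^ (e - 2) :: nat)) = 1] (mod 2 ^ e) \<and> 2 ^ (e - 1) dvd X (x [^] (2 ^ (e - 2) :: nat))"
proof (cases "A x mod 4 = 1")
  case True
  have "[A (x [^] (2 ^ (e - 2) :: nat)) = 1] (mod 2 ^ e)"
  proof (rule A_pow_pow2[OF x True, of 2])
    show "2 ^ 2 dvd A x - 1" using True by (rule mod4_eq_1_dvd)
  qed (use e_ge_2 in simp)
  moreover have "2 * 2 ^ (e - 2) dvd X x * int (2 ^ (e - 2))"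
    using nonreg True by (intro mult_dvd_mono) auto
  then have "2 ^ (e - 1) dvd X x * int (2 ^ (e - 2))" using e_split by metis
  then have "2 ^ (e - 1) dvd X (x [^] (2 ^ (e - 2) :: nat))"
    using X_pow_dvd_iff[OF x True, of "e - 1" "2 ^ (e - 2)"] by simp
  ultimately show ?thesis by blast
next
  case False
  then have 3: "A x mod 4 = 3" using A_mod4[OF x] by simp
  have y: "x \<otimes> x \<in> carrier G" using x by simp
  note sq = square_of_3_mod_4[OF x 3]
  have e1: "e - 2 = Suc (e - 3)" using e3 by simp
  have pw: "x [^] (2 ^ (e - 2) :: nat) = (x \<otimes> x) [^] (2 ^ (e - 3) :: nat)"
    unfolding e1 using x by (rule pow_2_pow_Suc)
  have "[A ((x \<otimes> x) [^] (2 ^ (e - 3) :: nat)) = 1] (mod 2 ^ e)"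
    by (rule A_pow_pow2[OF y sq(1) sq(3)]) (use e3 in simp_all)
  moreover have "2 ^ (e - 1) dvd X ((x \<otimes> x) [^] (2 ^ (e - 3) :: nat))"
  proof -
    have "2 ^ 2 * 2 ^ (e - 3) dvd X (x \<otimes> x) * int (2 ^ (e - 3))"
      by (rule mult_dvd_mono[OF sq(2)]) simp
    moreover have "e - 1 = 2 + (e - 3)" using e3 by simp
    ultimately have "2 ^ (e - 1) dvd X (x \<otimes> x) * int (2 ^ (e - 3))" by (simp only: power_add)
    then show ?thesis using X_pow_dvd_iff[OF y sq(1), of "e - 1" "2 ^ (e - 3)"] by simp
  qed
  ultimately show ?thesis unfolding pw by blast
qed

lemma subgroup_A_mod4_eq_1:
  assumes "subgroup H G"
  shows "subgroup {h \<in> H. A h mod 4 = 1} G"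
proof -
  interpret H: subgroup H G by fact
  show ?thesis
    by unfold_locales
      (auto simp: A_mult_mod4_eq_1 A_inv_mod4 H.mem_carrier cong_power2_mod4[OF A_one e_ge_2])
qed

text \<open>Left multiplication by \<open>h\<close> exchanges the two classes of slopes.\<close>

lemma card_subgroup_A_mod4:
  assumes "subgroup H G" "finite H" "h \<in> H" "A h mod 4 = 3"
  shows "card H = 2 * card {h \<in> H. A h mod 4 = 1}"
proof -
  interpret H: subgroup H G by fact
  let ?H1 = "{h \<in> H. A h mod 4 = 1}"
  have "(\<lambda>x. h \<otimes> x) ` ?H1 = {h \<in> H. A h mod 4 = 3}"
  proof (intro equalityI subsetI)
    fix y assume "y \<in> (\<lambda>x. h \<otimes> x) ` ?H1"
    then obtain x where x: "x \<in> ?H1" "y = h \<otimes> x" by blast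
    then have "A y mod 4 \<noteq> 1" using assms(3,4) by (simp add: A_mult_mod4_eq_1)
    then show "y \<in> {h \<in> H. A h mod 4 = 3}" using x assms(3) A_mod4[of y] by auto
  next
    fix y assume y: "y \<in> {h \<in> H. A h mod 4 = 3}"
    then have "inv h \<otimes> y \<in> ?H1"
      using assms(3,4) by (simp add: A_mult_mod4_eq_1 A_inv_mod4)
    moreover have "y = h \<otimes> (inv h \<otimes> y)" using y assms(3) by (simp add: m_assoc[symmetric])
    ultimately show "y \<in> (\<lambda>x. h \<otimes> x) ` ?H1" by blast
  qed
  moreover have "inj_on (\<lambda>x. h \<otimes> x) ?H1" using assms(3) by (auto intro!: inj_onI)
  ultimately have "card {h \<in> H. A h mod 4 = 3} = card ?H1" using card_image by fastforce
  moreover have "H = ?H1 \<union> {h \<in> H. A h mod 4 = 3}" using A_mod4 H.mem_carrier by blast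
  moreover have "?H1 \<inter> {h \<in> H. A h mod 4 = 3} = {}" by auto
  ultimately show ?thesis using card_Un_disjoint[of ?H1 "{h \<in> H. A h mod 4 = 3}"] assms(2) by simp
qed

definition stab :: "'a set" where
  "stab = {x \<in> carrier G. [X x = 0] (mod 2 ^ e)}"

lemma subgroup_stab: "subgroup stab G"
proof
  show "stab \<subseteq> carrier G" by (auto simp: stab_def)
  show "\<one> \<in> stab" by (simp add: stab_def X_one)
  fix x assume x: "x \<in> stab"
  then show "inv x \<in> stab"
    using X_inv_mult_0_iff[of x \<one>] X_one by (simp add: stab_def cong_def)
  fix y assume y: "y \<in> stab"
  have "[X x + A x * X y = 0 + A x * 0] (mod 2 ^ e)"
    using x y by (intro cong_add cong_mult cong_refl) (simp_all add: stab_def)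
  then show "x \<otimes> y \<in> stab" using x y X_mult[of x y] by (auto simp: stab_def intro: cong_trans)
qed

text \<open>The powers of \<open>y\<close> reach every point and have slope 1 modulo 4. Dividing
  \<open>h\<close> by the power that sends 0 to the same point leaves the class of its slope
  unchanged.\<close>

lemma ex_stab_A_mod4_eq_3:
  assumes y: "y \<in> carrier G" "odd (X y)" "A y mod 4 = 1" and h: "h \<in> carrier G" "A h mod 4 = 3"
  shows "\<exists>s\<in>stab. A s mod 4 = 3"
proof -
  obtain n :: nat where n: "[X (y [^] n) = X h] (mod 2 ^ e)" using ex_pow_X[OF y] by blast
  have s: "inv (y [^] n) \<otimes> h \<in> carrier G" using y h by simp
  have "inv (y [^] n) \<otimes> h \<in> stab"
    using X_inv_mult_0_iff[of "y [^] n" h] n y h by (simp add: stab_def)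
  moreover have "A (y [^] n) mod 4 = 1"
    using cong_power2_mod4[OF A_pow[OF y(1)] e_ge_2, of n] mod4_power[OF y(3)] by simp
  then have "A (inv (y [^] n) \<otimes> h) mod 4 \<noteq> 1" using y h by (simp add: A_mult_mod4_eq_1 A_inv_mod4)
  ultimately show ?thesis using A_mod4[OF s] by blast
qed

end

section \<open>Transitive representations\<close>

locale transitive_affine_rep = affine_rep +
  assumes X_surj: "\<exists>x\<in>carrier G. [X x = w] (mod 2 ^ e)"
begin

text \<open>Right multiplication by \<open>s\<close> switches the class of the slope and preserves
  the parity of \<open>X\<close>.\<close>

lemma ex_odd_1:
  assumes "s \<in> carrier G" "even (X s)" "A s mod 4 = 3"
  shows "\<exists>y\<in>carrier G. odd (X y) \<and> A y mod 4 = 1"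
proof -
  obtain y where y: "y \<in> carrier G" "[X y = 1] (mod 2 ^ e)" using X_surj by blast
  have o: "odd (X y)" using cong_power2_even[OF y(2)] e_ge_2 by simp
  show ?thesis
  proof (cases "A y mod 4 = 1")
    case False
    then have "odd (X (y \<otimes> s))" "A (y \<otimes> s) mod 4 = 1"
      using y o assms by (simp_all add: X_mult_even A_mult_mod4_eq_1)
    then show ?thesis using y assms by blast
  qed (use y o in blast)
qed

text \<open>If the element found over the point 2 has the wrong slope, \<open>ex_odd_1\<close> turns
  it into a source of regular elements, and the square of a regular element will do.\<close>

lemma ex_2_1: "\<exists>x\<in>carrier G. X x mod 4 = 2 \<and> A x mod 4 = 1"
proof -
  have sq: "X (y \<otimes> y) mod 4 = 2 \<and> A (y \<otimes> y) mod 4 = 1"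
    if "y \<in> carrier G" "odd (X y)" "A y mod 4 = 1" for y
  proof -
    define k l where "k = A y div 4" and "l = X y div 2"
    have "A y = 4 * k + 1" "X y = 2 * l + 1"
      using that mult_div_mod_eq[of 4 "A y"] by (simp_all add: k_def l_def)
    then have "X y + A y * X y = 2 + 4 * (k * (2 * l + 1) + l)" by (simp add: algebra_simps)
    then have "(X y + A y * X y) mod 4 = 2" by (simp only: mod_mult_self2) simp
    then show ?thesis using X_mult_mod4[OF that(1,1)] A_mult_mod4_eq_1[OF that(1,1)] by simp
  qed
  obtain x where x: "x \<in> carrier G" "[X x = 2] (mod 2 ^ e)" using X_surj by blast
  have x2: "X x mod 4 = 2" using cong_power2_mod4[OF x(2)] e_ge_2 by simp
  show ?thesis
  proof (cases "A x mod 4 = 1")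
    case False
    moreover have "even (X x)" using x2 by presburger
    ultimately have "\<exists>y\<in>carrier G. odd (X y) \<and> A y mod 4 = 1"
      using ex_odd_1[OF x(1)] A_mod4[OF x(1)] by blast
    then show ?thesis using sq by blast
  qed (use x x2 in blast)
qed

text \<open>Odd \<open>X\<close> with slope 1 modulo 4 is excluded by hypothesis, even
  \<open>X\<close> with slope 3 modulo 4 by \<open>ex_odd_1\<close>.\<close>

lemma odd_X_iff:
  assumes "\<not> (\<exists>y\<in>carrier G. odd (X y) \<and> A y mod 4 = 1)" "x \<in> carrier G"
  shows "odd (X x) \<longleftrightarrow> A x mod 4 = 3"
  using assms ex_odd_1[of x] A_mod4[of x] by auto

lemma card_carrier:
  assumes "finite (carrier G)"
  shows "card (carrier G) = 2 ^ e * card stab"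
proof -
  have "\<forall>w. \<exists>x. x \<in> carrier G \<and> [X x = w] (mod 2 ^ e)" using X_surj by blast
  then have "\<exists>g. \<forall>w. g w \<in> carrier G \<and> [X (g w) = w] (mod 2 ^ e)" by (rule choice)
  then obtain g where "\<forall>w. g w \<in> carrier G \<and> [X (g w) = w] (mod 2 ^ e)" ..
  then have g: "g w \<in> carrier G" "[X (g w) = w] (mod 2 ^ e)" for w by blast+
  have stab_carrier: "s \<in> carrier G" if "s \<in> stab" for s using that by (simp add: stab_def)
  have X_g: "[X (g w \<otimes> s) = w] (mod 2 ^ e)" if "s \<in> stab" for w s
  proof -
    have "[X (g w) + A (g w) * X s = w + A (g w) * 0] (mod 2 ^ e)"
      using g that by (intro cong_add cong_mult cong_refl) (simp_all add: stab_def)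
    then show ?thesis using X_mult[OF g(1), of s w] that by (auto simp: stab_def intro: cong_trans)
  qed
  have "bij_betw (\<lambda>(w, s). g w \<otimes> s) ({0..<2 ^ e} \<times> stab) (carrier G)"
    unfolding bij_betw_def
  proof
    show "inj_on (\<lambda>(w, s). g w \<otimes> s) ({0..<2 ^ e} \<times> stab)"
    proof (rule inj_onI, clarify)
      fix w s w' s' assume *: "w \<in> {0..<2 ^ e}" "s \<in> stab" "w' \<in> {0..<2 ^ e}" "s' \<in> stab"
        "g w \<otimes> s = g w' \<otimes> s'"
      have "[w = w'] (mod 2 ^ e)" using X_g[OF *(2), of w] X_g[OF *(4), of w'] *(5) by (simp add: cong_def)
      then have "w = w'" using *(1,3) by (simp add: cong_def)
      then show "w = w' \<and> s = s'" using * g(1) stab_carrier by simp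
    qed
    show "(\<lambda>(w, s). g w \<otimes> s) ` ({0..<2 ^ e} \<times> stab) = carrier G"
    proof (intro equalityI subsetI)
      fix x assume x: "x \<in> carrier G"
      define w where "w = X x mod 2 ^ e"
      have "[X (g w) = X x] (mod 2 ^ e)" using g(2)[of w] by (simp add: w_def cong_def)
      then have "inv (g w) \<otimes> x \<in> stab" using X_inv_mult_0_iff[OF g(1) x] x g(1) by (simp add: stab_def)
      moreover have "x = g w \<otimes> (inv (g w) \<otimes> x)" using x g(1) by (simp add: m_assoc[symmetric])
      moreover have "w \<in> {0..<2 ^ e}" by (simp add: w_def)
      ultimately show "x \<in> (\<lambda>(w, s). g w \<otimes> s) ` ({0..<2 ^ e} \<times> stab)" by force
    qed (use g(1) stab_carrier in auto)
  qed
  then show ?thesis by (simp add: bij_betw_same_card[symmetric] card_cartesian_product nat_power_eq)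
qed

end

section \<open>Two representations of one group\<close>

context affine_rep
begin

text \<open>\<open>x \<otimes> y\<close> and \<open>y \<otimes> x\<close> have the same slope, so
  their quotient is a translation. Its length is the expression on the right up to the unit
  \<open>A (inv (y \<otimes> x))\<close>, which divisibility by powers of 2 does not see.\<close>

lemma
  assumes "x \<in> carrier G" "y \<in> carrier G"
  shows A_commutator: "[A (inv (y \<otimes> x) \<otimes> (x \<otimes> y)) = 1] (mod 2 ^ e)"
    and X_commutator_dvd_iff: "j \<le> e \<Longrightarrow> 2 ^ j dvd X (inv (y \<otimes> x) \<otimes> (x \<otimes> y)) \<longleftrightarrow>
      2 ^ j dvd (A x - 1) * X y - (A y - 1) * X x"
proof -
  have "[A (y \<otimes> x) = A (x \<otimes> y)] (mod 2 ^ e)"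
    using A_mult[OF assms] A_mult[OF assms(2,1)] by (simp add: cong_def mult.commute)
  then show "[A (inv (y \<otimes> x) \<otimes> (x \<otimes> y)) = 1] (mod 2 ^ e)"
    using assms by (simp add: A_inv_mult_1)
  assume j: "j \<le> e"
  have "[X (inv (y \<otimes> x) \<otimes> (x \<otimes> y)) = ((A x - 1) * X y - (A y - 1) * X x) * A (inv (y \<otimes> x))] (mod 2 ^ e)"
    using X_inv_mult[of "y \<otimes> x" "x \<otimes> y"] X_mult[OF assms] X_mult[OF assms(2,1)] assms
    unfolding fold_cong by simp Groebner_Basis.algebra
  then have "[X (inv (y \<otimes> x) \<otimes> (x \<otimes> y)) = ((A x - 1) * X y - (A y - 1) * X x) * A (inv (y \<otimes> x))] (mod 2 ^ j)"
    using j cong_dvd_modulus le_imp_power_dvd by blast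
  then show "2 ^ j dvd X (inv (y \<otimes> x) \<otimes> (x \<otimes> y)) \<longleftrightarrow>
      2 ^ j dvd (A x - 1) * X y - (A y - 1) * X x"
    using assms A_odd[of "inv (y \<otimes> x)"] by (simp add: cong_dvd_iff pow2_dvd_mult_odd)
qed

lemma square_kernel:
  assumes "x \<in> carrier G" "[A x = 1] (mod 2 ^ e)"
  shows "[A (x \<otimes> x) = 1] (mod 2 ^ e)" "[X (x \<otimes> x) = 2 * X x] (mod 2 ^ e)"
  using A_mult[OF assms(1,1)] X_mult[OF assms(1,1)] assms(2) unfolding fold_cong
  by - (Groebner_Basis.algebra, Groebner_Basis.algebra)

lemma A_mod4_of_kernel: "[A x = 1] (mod 2 ^ e) \<Longrightarrow> A x mod 4 = 1"
  using cong_power2_mod4[OF _ e_ge_2, of "A x" 1] by simp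

end

locale faithful_affine_rep = transitive_affine_rep +
  assumes faithful: "\<lbrakk>x \<in> carrier G; [X x = 0] (mod 2 ^ e); [A x = 1] (mod 2 ^ e)\<rbrakk> \<Longrightarrow> x = \<one>"
    and finite_carrier: "finite (carrier G)"
begin

lemma eqI:
  assumes "x \<in> carrier G" "y \<in> carrier G" "[X x = X y] (mod 2 ^ e)" "[A x = A y] (mod 2 ^ e)"
  shows "x = y"
proof -
  have "inv x \<otimes> y = \<one>"
    using faithful[of "inv x \<otimes> y"] X_inv_mult_0_iff[OF assms(1,2)] A_inv_mult_1[OF assms(1,2,4)] assms
    by simp
  then show ?thesis using assms(1,2) by (metis inv_equality inv_inv inv_closed)
qed

end

locale two_affine_reps = faithful_affine_rep G e X A + R: transitive_affine_rep G e c \<alpha>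
  for G (structure) and e X A c \<alpha> +
  fixes H
  assumes H_eq: "H = R.stab"
begin

lemma H_carrier: "x \<in> H \<Longrightarrow> x \<in> carrier G"
  by (simp add: H_eq R.stab_def)

lemma H_iff: "x \<in> carrier G \<Longrightarrow> x \<in> H \<longleftrightarrow> 2 ^ e dvd c x"
  by (simp add: H_eq R.stab_def cong_0_iff)

lemma subgroup_H: "subgroup H G"
  unfolding H_eq by (rule R.subgroup_stab)

lemma pow_H: "x \<in> H \<Longrightarrow> x [^] (n::nat) \<in> H"
  by (rule subgroup.nat_pow_in_subgroup[OF subgroup_H])

text \<open>\<open>c x\<close> has valuation 1, so the power has valuation \<open>e - 1\<close>, one
  short of fixing 0.\<close>

lemma ex_pow_not_in_H: "\<exists>x\<in>carrier G. c x mod 4 = 2 \<and> \<alpha> x mod 4 = 1 \<and> x [^] (2 ^ (e - 2) :: nat) \<notin> H"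
proof -
  obtain x where x: "x \<in> carrier G" "c x mod 4 = 2" "\<alpha> x mod 4 = 1" using R.ex_2_1 by blast
  have "\<not> 4 * 2 ^ (e - 2) dvd c x * 2 ^ (e - 2)" using x(2) by auto
  then have "\<not> 2 ^ e dvd c x * int (2 ^ (e - 2))" using e_split by (metis of_nat_numeral of_nat_power)
  then show ?thesis using x R.X_pow_dvd_iff[OF x(1,3), of e "2 ^ (e - 2)"] by (auto simp: H_iff)
qed

text \<open>Every \<open>2 ^ (e - 2)\<close>-th power is a translation by a multiple of
  \<open>2 ^ (e - 2)\<close>: by valuations for a regular element, by \<open>pow_quarter\<close>
  otherwise. The hypothesis would put all of them into \<open>H\<close>, against
  \<open>ex_pow_not_in_H\<close>.\<close>

lemma H_not_contains_order_4:
  assumes "3 \<le> e" "\<And>x. \<lbrakk>x \<in> carrier G; [A x = 1] (mod 2 ^ e); 2 ^ (e - 2) dvd X x\<rbrakk> \<Longrightarrow> x \<in> H"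
  shows False
proof -
  obtain x where x: "x \<in> carrier G" "x [^] (2 ^ (e - 2) :: nat) \<notin> H" using ex_pow_not_in_H by blast
  have "[A (x [^] (2 ^ (e - 2) :: nat)) = 1] (mod 2 ^ e) \<and> 2 ^ (e - 2) dvd X (x [^] (2 ^ (e - 2) :: nat))"
  proof (cases "odd (X x) \<and> A x mod 4 = 1")
    case True
    have "[A (x [^] (2 ^ (e - 2) :: nat)) = 1] (mod 2 ^ e)"
      by (rule A_pow_pow2[OF x(1) _ mod4_eq_1_dvd]) (use True e_ge_2 in simp_all)
    moreover have "2 ^ (e - 2) dvd X (x [^] (2 ^ (e - 2) :: nat))"
      using X_pow_dvd_iff[OF x(1), of "e - 2" "2 ^ (e - 2)"] True by simp
    ultimately show ?thesis by blast
  next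
    case False
    have "(2::int) ^ (e - 2) dvd 2 ^ (e - 1)" by (rule le_imp_power_dvd) simp
    then show ?thesis using pow_quarter[OF x(1) assms(1) False] dvd_trans by blast
  qed
  then show False using x assms(2)[of "x [^] (2 ^ (e - 2) :: nat)"] by simp
qed

text \<open>The element of \<open>ex_pow_not_in_H\<close> must be regular for \<open>(X, A)\<close>:
  otherwise \<open>pow_quarter\<close> makes its power a translation that already lies in
  \<open>H\<close>.\<close>

lemma ex_regular:
  assumes "3 \<le> e" "\<And>x. \<lbrakk>x \<in> carrier G; [A x = 1] (mod 2 ^ e); 2 ^ (e - 1) dvd X x\<rbrakk> \<Longrightarrow> x \<in> H"
  obtains x where "x \<in> carrier G" "odd (X x)" "A x mod 4 = 1" "c x mod 4 = 2" "\<alpha> x mod 4 = 1"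
proof -
  obtain x where x: "x \<in> carrier G" "c x mod 4 = 2" "\<alpha> x mod 4 = 1" "x [^] (2 ^ (e - 2) :: nat) \<notin> H"
    using ex_pow_not_in_H by blast
  then have "odd (X x) \<and> A x mod 4 = 1"
    using pow_quarter[OF x(1) assms(1)] assms(2)[of "x [^] (2 ^ (e - 2) :: nat)"] by auto
  then show thesis using that x by blast
qed

lemma pow_half_not_in_H:
  assumes "y \<in> carrier G" "odd (c y)" "\<alpha> y mod 4 = 1"
  shows "y [^] (2 ^ (e - 1) :: nat) \<notin> H"
  using R.X_pow_dvd_iff[OF assms(1,3), of e "2 ^ (e - 1)"] assms pow2_dvd_mult_half_iff[of e "c y"] e_ge_2
  by (simp add: H_iff)

lemma commutator_in_H:
  assumes "x \<in> carrier G" "y \<in> carrier G"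
  shows "inv (y \<otimes> x) \<otimes> (x \<otimes> y) \<in> H \<longleftrightarrow> 2 ^ e dvd (\<alpha> x - 1) * c y - (\<alpha> y - 1) * c x"
  using R.X_commutator_dvd_iff[OF assms, of e] assms by (simp add: H_iff)

text \<open>\<open>zin\<close> and \<open>zout\<close> say that the translations in \<open>H\<close>
  are exactly those of \<open>G\<close> by multiples of \<open>2 ^ (e - 1)\<close>. If
  \<open>\<alpha>\<close> were nontrivial on \<open>H\<close>, some \<open>p\<close> in
  \<open>H\<close> would have \<open>\<alpha> p = 1 + 2 ^ (e - 1)\<close>, and its commutator with
  \<open>y\<close> would lie in \<open>H\<close> only for even \<open>c y\<close>. Computed in
  \<open>(X, A)\<close>, however, such commutators are always translations that lie in
  \<open>H\<close>.\<close>

lemma \<alpha>_trivial_on_H: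
  assumes e3: "3 \<le> e"
    and zin: "\<And>x. \<lbrakk>x \<in> carrier G; [A x = 1] (mod 2 ^ e); 2 ^ (e - 1) dvd X x\<rbrakk> \<Longrightarrow> x \<in> H"
    and zout: "\<And>x. \<lbrakk>x \<in> H; [A x = 1] (mod 2 ^ e)\<rbrakk> \<Longrightarrow> 2 ^ (e - 1) dvd X x"
    and h: "h \<in> H"
  shows "[\<alpha> h = 1] (mod 2 ^ e)"
proof (rule ccontr)
  assume h1: "\<not> [\<alpha> h = 1] (mod 2 ^ e)"
  \<comment> \<open>If \<open>y\<close> is regular for \<open>(c, \<alpha>)\<close>, its
    \<open>2 ^ (e - 1)\<close>-th power lies outside \<open>H\<close>; but in \<open>(X, A)\<close>
    every such power is a translation covered by \<open>zin\<close>.\<close>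
  have no_reg: "\<not> (\<exists>y\<in>carrier G. odd (c y) \<and> \<alpha> y mod 4 = 1)"
    using pow_half_not_in_H zin[OF _ A_pow_half X_pow_half] by blast
  obtain g where g: "g \<in> carrier G" "odd (X g)" "A g mod 4 = 1" "c g mod 4 = 2" "\<alpha> g mod 4 = 1"
    using ex_regular[OF e3 zin] by blast
  have "even (c h)" using h H_iff[of h] e_ge_2 H_carrier[OF h]
    by (meson dvd_power dvd_trans zero_less_numeral le_trans less_le_trans)
  then have h4: "\<alpha> h mod 4 = 1" using R.odd_X_iff[OF no_reg H_carrier[OF h]] R.A_mod4[OF H_carrier[OF h]] by auto
  have "\<alpha> h - 1 \<noteq> 0" using h1 by auto
  then obtain s t where s: "\<alpha> h - 1 = 2 ^ s * t" "odd t" by (rule two_adic_int)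
  have "s < e" using h1 pow2_not_dvd_less[of e s t] s(1) by (simp add: cong_iff_dvd_diff)
  \<comment> \<open>The exponent raises the valuation of the slope minus 1 from \<open>s\<close> to
    \<open>e - 1\<close>.\<close>
  define p where "p = h [^] (2 ^ (e - 1 - s) :: nat)"
  have p: "p \<in> H" "p \<in> carrier G" using pow_H[OF h] H_carrier by (simp_all add: p_def)
  have \<alpha>p: "[\<alpha> p = 1 + 2 ^ (e - 1)] (mod 2 ^ e)"
  proof -
    obtain t' where t': "odd t'" "geo (\<alpha> h) (2 ^ (e - 1 - s)) = 2 ^ (e - 1 - s) * t'"
      using geo_pow2[OF h4] by blast
    have "\<alpha> h ^ (2 ^ (e - 1 - s)) - 1 = (2 ^ s * 2 ^ (e - 1 - s)) * (t * t')"
      unfolding geo_diff[symmetric] s(1) t'(2) by simp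
    also have "(2::int) ^ s * 2 ^ (e - 1 - s) = 2 ^ (e - 1)"
      using \<open>s < e\<close> by (simp add: power_add[symmetric])
    finally have "\<alpha> h ^ (2 ^ (e - 1 - s)) - (1 + 2 ^ (e - 1)) = (t * t' - 1) * 2 ^ (e - 1)"
      by (simp add: algebra_simps)
    moreover have "even (t * t' - 1)" using s t' by simp
    ultimately have "[\<alpha> h ^ (2 ^ (e - 1 - s)) = 1 + 2 ^ (e - 1)] (mod 2 ^ e)"
      using pow2_dvd_mult_half_iff[of e "t * t' - 1"] e_ge_2 by (simp add: cong_iff_dvd_diff)
    then show ?thesis unfolding p_def using R.A_pow[OF H_carrier[OF h]] cong_trans by blast
  qed
  have cp: "2 ^ e dvd c p" using p H_iff by blast
  have "2 ^ e dvd (\<alpha> p - 1) * c y - (\<alpha> y - 1) * c p \<longleftrightarrow> even (c y)" for y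
  proof -
    have "[(\<alpha> p - 1) * c y - (\<alpha> y - 1) * c p = (1 + 2 ^ (e - 1) - 1) * c y - (\<alpha> y - 1) * 0] (mod 2 ^ e)"
      using \<alpha>p cp by (intro cong_diff cong_mult cong_refl) (simp_all add: cong_0_iff)
    then show ?thesis using pow2_dvd_mult_half_iff[of e "c y"] e_ge_2 by (simp add: cong_dvd_iff mult.commute)
  qed
  then have comm: "inv (y \<otimes> p) \<otimes> (p \<otimes> y) \<in> H \<longleftrightarrow> even (c y)" if "y \<in> carrier G" for y
    using commutator_in_H[OF p(2) that] by simp
  define b v a u where defs: "b = A p" "v = X p" "a = A g" "u = X g"
  \<comment> \<open>\<open>c g\<close> is even, so this commutator is a translation in
    \<open>H\<close> and \<open>zout\<close> bounds it from below in valuation.\<close>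
  have "inv (g \<otimes> p) \<otimes> (p \<otimes> g) \<in> H" using comm[OF g(1)] g(4) by presburger
  then have "2 ^ (e - 1) dvd X (inv (g \<otimes> p) \<otimes> (p \<otimes> g))"
    using zout A_commutator[OF p(2) g(1)] by blast
  then have bu: "2 ^ (e - 1) dvd (b - 1) * u - (a - 1) * v"
    using X_commutator_dvd_iff[OF p(2) g(1), of "e - 1"] by (simp add: defs)
  have odd_u: "odd u" and a4: "4 dvd a - 1"
    using g mod4_eq_1_dvd by (auto simp: defs)
  \<comment> \<open>With \<open>u\<close> odd and \<open>4 dvd a - 1\<close>, the congruence
    \<open>bu\<close> ties \<open>b - 1\<close> so closely to \<open>v\<close> that modulo
    \<open>2 ^ e\<close> only \<open>b = 1\<close> and \<open>b = 1 + 2 ^ (e - 1)\<close>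
    survive.\<close>
  have small: "2 ^ (e - 1) dvd b - 1 \<and> 2 ^ (e - 2) dvd v"
  proof (cases "2 ^ e dvd b - 1")
    case True
    then have "2 ^ (e - 1) dvd v" using zout[OF p(1)] by (simp add: defs cong_iff_dvd_diff)
    moreover have "(2::int) ^ (e - 2) dvd 2 ^ (e - 1)" "(2::int) ^ (e - 1) dvd 2 ^ e"
      by (simp_all add: le_imp_power_dvd)
    ultimately show ?thesis using True dvd_trans by blast
  next
    case False
    have b4: "b mod 4 = 1"
    proof -
      have "(2::int) ^ 2 dvd 2 ^ (e - 1)" using e3 by (intro le_imp_power_dvd) simp
      then have "4 dvd (b - 1) * u - (a - 1) * v" using bu dvd_trans by (simp add: dvd_trans)
      moreover have "4 dvd (a - 1) * v" using a4 by simp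
      ultimately have "4 dvd (b - 1) * u" by (simp add: dvd_diff_right_iff dvd_diff_left_iff)
      then have "2 ^ 2 dvd b - 1" using pow2_dvd_mult_odd[OF odd_u, of 2 "b - 1"] by simp
      then show ?thesis by simp presburger
    qed
    have "b - 1 \<noteq> 0" using False by auto
    then obtain r t where r: "b - 1 = 2 ^ r * t" "odd t" by (rule two_adic_int)
    have "r < e" using False pow2_not_dvd_less[of e r t] r(1) by simp
    have "2 ^ 2 dvd 2 ^ r * t" using mod4_eq_1_dvd[OF b4] r(1) by simp
    then have "(2::int) ^ 2 dvd 2 ^ r" by (simp only: pow2_dvd_mult_odd[OF r(2)])
    then have "2 \<le> r" by (rule four_dvd_pow2)
    \<comment> \<open>The smallest power of this kind sure to be a translation: it lies in
      \<open>H\<close>, and \<open>zout\<close> turns this into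
      \<open>2 ^ (r - 1) dvd v\<close>.\<close>
    define p' where "p' = p [^] (2 ^ (e - r) :: nat)"
    have "[A p' = 1] (mod 2 ^ e)" unfolding p'_def
      by (rule A_pow_pow2[OF p(2), of r]) (use b4 r \<open>r < e\<close> in \<open>simp_all add: defs\<close>)
    then have "2 ^ (e - 1) dvd X p'" using zout pow_H[OF p(1)] by (simp add: p'_def)
    then have "2 ^ (e - 1) dvd v * int (2 ^ (e - r))"
      using X_pow_dvd_iff[OF p(2), of "e - 1" "2 ^ (e - r)"] b4 by (simp add: p'_def defs)
    moreover have "(2::int) ^ (e - 1) = 2 ^ (r - 1) * 2 ^ (e - r)"
      using \<open>r < e\<close> \<open>2 \<le> r\<close> by (simp add: power_add[symmetric])
    ultimately have v: "2 ^ (r - 1) dvd v" by simp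
    have r1: "(2::int) ^ Suc r = 4 * 2 ^ (r - 1)" using \<open>2 \<le> r\<close> by (cases r) simp_all
    have av: "2 ^ Suc r dvd (a - 1) * v" unfolding r1 using a4 v by (rule mult_dvd_mono)
    \<comment> \<open>Otherwise \<open>(a - 1) * v\<close> vanishes modulo \<open>2 ^ Suc r\<close>,
      while \<open>(b - 1) * u\<close> has valuation exactly \<open>r\<close>.\<close>
    have "\<not> Suc r \<le> e - 1"
    proof
      assume "Suc r \<le> e - 1"
      then have "2 ^ Suc r dvd (b - 1) * u - (a - 1) * v" using bu le_imp_power_dvd dvd_trans by blast
      then have "2 ^ Suc r dvd (b - 1) * u" using av by (simp add: dvd_diff_right_iff dvd_diff_left_iff)
      then have "2 ^ Suc r dvd 2 ^ r * t" using pow2_dvd_mult_odd[OF odd_u, of "Suc r" "b - 1"] r(1) by simp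
      then show False using r(2) by simp
    qed
    then have "r = e - 1" using \<open>r < e\<close> by simp
    then show ?thesis using v r(1) by (simp add: numeral_2_eq_2)
  qed
  \<comment> \<open>By \<open>small\<close>, the commutator of \<open>p\<close> with any element is
    covered by \<open>zin\<close>; an odd \<open>c y\<close> contradicts
    \<open>comm\<close>.\<close>
  obtain y where y: "y \<in> carrier G" "[c y = 1] (mod 2 ^ e)" using R.X_surj by blast
  have "odd (c y)" using cong_power2_even[OF y(2)] e_ge_2 by simp
  have "2 ^ (e - 1) dvd (b - 1) * X y - (A y - 1) * v"
  proof (rule dvd_diff)
    show "2 ^ (e - 1) dvd (b - 1) * X y" using small by simp
    have "2 * 2 ^ (e - 2) dvd (A y - 1) * v" using small A_odd[OF y(1)] by (intro mult_dvd_mono) auto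
    then show "2 ^ (e - 1) dvd (A y - 1) * v" using e_split by metis
  qed
  then have "2 ^ (e - 1) dvd X (inv (y \<otimes> p) \<otimes> (p \<otimes> y))"
    using X_commutator_dvd_iff[OF p(2) y(1), of "e - 1"] by (simp add: defs)
  then have "inv (y \<otimes> p) \<otimes> (p \<otimes> y) \<in> H" using zin A_commutator[OF p(2) y(1)] p y by simp
  then show False using comm[OF y(1)] \<open>odd (c y)\<close> by blast
qed

text \<open>An element of \<open>H\<close> fixes 0 and has slope 1, so it acts trivially in
  \<open>(c, \<alpha>)\<close>; hence \<open>H\<close> is the kernel of that action.\<close>

lemma normal_H:
  assumes "\<And>h. h \<in> H \<Longrightarrow> [\<alpha> h = 1] (mod 2 ^ e)"
  shows "H \<lhd> G"
  unfolding normal_inv_iff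
proof (intro conjI ballI)
  show "subgroup H G" by (rule subgroup_H)
  fix x h assume x: "x \<in> carrier G" and h: "h \<in> H"
  have hc: "h \<in> carrier G" using h by (rule H_carrier)
  have "2 ^ e dvd c h" using h H_iff hc by blast
  then have "2 ^ e dvd c (x \<otimes> h \<otimes> inv x)"
    using R.X_mult[of "x \<otimes> h" "inv x"] R.X_mult[OF x hc] R.A_mult[OF x hc] assms[OF h]
      R.X_mult[of x "inv x"] R.X_one x hc unfolding fold_cong
    by simp Groebner_Basis.algebra
  then show "x \<otimes> h \<otimes> inv x \<in> H" using x hc by (simp add: H_iff)
qed

text \<open>Conjugation by \<open>h\<close> inverts translations. In \<open>(c, \<alpha>)\<close>
  this relation forces the square or the fourth power of each translation into \<open>H\<close>, and
  \<open>disj\<close> supplies one for which that power is the translation by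
  \<open>2 ^ (e - 1)\<close>, which is not in \<open>H\<close>.\<close>

lemma no_rep_involution:
  assumes e3: "3 \<le> e"
    and H: "H = {\<one>, h}" and h: "odd (X h)" "[A h = -1] (mod 2 ^ e)"
    and stab: "\<And>s. s \<in> stab \<Longrightarrow> A s mod 4 = 1"
    and m: "m \<in> carrier G" "[A m = 1] (mod 2 ^ e)" "[X m = 2 ^ (e - 2)] (mod 2 ^ e)"
    and disj: "\<alpha> m mod 4 = 1 \<or> (\<exists>x\<in>carrier G. [A x = 1] (mod 2 ^ e) \<and> [X x = 2 ^ (e - 3)] (mod 2 ^ e))"
  shows False
proof -
  have hH: "h \<in> H" and hc: "h \<in> carrier G" using H H_carrier by auto
  have ch: "2 ^ e dvd c h" using hH H_iff hc by blast
  have h4: "A h mod 4 = 3" using cong_power2_mod4[OF h(2) e_ge_2] by simp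
  have HN: "x = \<one>" if "x \<in> H" "[A x = 1] (mod 2 ^ e)" for x
    using that H h4 A_mod4_of_kernel by auto
  have not_zero: "\<not> [X x = 0] (mod 2 ^ e)" if "[X x = 2 ^ (e - 1)] (mod 2 ^ e)" for x
    using that pow2_dvd_mult_half_iff[of e 1] e_ge_2 by (auto simp: cong_0_iff cong_dvd_iff)
  have not_H: "x \<notin> H" if "[X x = 2 ^ (e - 1)] (mod 2 ^ e)" "[A x = 1] (mod 2 ^ e)" for x
    using HN[OF _ that(2)] not_zero[OF that(1)] X_one by auto
  have \<alpha>h1: "\<not> [\<alpha> h = 1] (mod 2 ^ e)"
  proof
    assume "[\<alpha> h = 1] (mod 2 ^ e)"
    then have "2 ^ e dvd (\<alpha> h - 1) * c m - (\<alpha> m - 1) * c h" using ch by (simp add: cong_iff_dvd_diff)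
    then have "inv (m \<otimes> h) \<otimes> (h \<otimes> m) \<in> H" using commutator_in_H[OF hc m(1)] by simp
    then have "inv (m \<otimes> h) \<otimes> (h \<otimes> m) = \<one>" using HN A_commutator[OF hc m(1)] by blast
    then have "2 ^ e dvd X (inv (m \<otimes> h) \<otimes> (h \<otimes> m))" using X_one by (simp add: cong_0_iff)
    then have "2 ^ e dvd (A h - 1) * X m - (A m - 1) * X h"
      using X_commutator_dvd_iff[OF hc m(1), of e] by simp
    moreover have "[(A h - 1) * X m - (A m - 1) * X h = (-1 - 1) * 2 ^ (e - 2) - (1 - 1) * X h] (mod 2 ^ e)"
      using h(2) m(2,3) by (intro cong_diff cong_mult cong_refl)
    ultimately have "2 ^ e dvd (-1 - 1) * (2::int) ^ (e - 2)" by (simp add: cong_dvd_iff)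
    then have "4 * 2 ^ (e - 2) dvd 2 * (2::int) ^ (e - 2)" using e_split by (metis add_uminus_conv_diff dvd_minus_iff minus_mult_left mult_2 one_add_one minus_add_distrib)
    then show False by simp
  qed
  have "h \<otimes> h = \<one>"
    by (rule eqI) (use hc in simp, simp,
      use X_mult[OF hc hc] X_one h(2) in \<open>unfold fold_cong, Groebner_Basis.algebra\<close>,
      use A_mult[OF hc hc] A_one h(2) in \<open>unfold fold_cong, Groebner_Basis.algebra\<close>)
  then have \<alpha>hh: "2 ^ e dvd \<alpha> h * \<alpha> h - 1"
    using R.A_mult[OF hc hc] R.A_one by (metis cong_iff_dvd_diff cong_sym cong_trans)
  show False
  proof (cases "\<alpha> h mod 4 = 1")
    \<comment> \<open>Then \<open>(c, \<alpha>)\<close> has a regular element \<open>y\<close>. Its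
      \<open>2 ^ (e - 1)\<close>-th power is nontrivial, so \<open>y\<close> is regular for
      \<open>(X, A)\<close> too, where it yields a stabiliser element of slope 3 modulo 4.\<close>
    case False
    have "even (c h)" using ch e_ge_2 by (meson dvd_power dvd_trans zero_less_numeral le_trans less_le_trans)
    then obtain y where y: "y \<in> carrier G" "odd (c y)" "\<alpha> y mod 4 = 1"
      using R.ex_odd_1[OF hc] False R.A_mod4[OF hc] by blast
    let ?p = "y [^] (2 ^ (e - 1) :: nat)"
    have "?p \<noteq> \<one>" using pow_half_not_in_H[OF y] H by auto
    then have reg: "odd (X y)" "A y mod 4 = 1"
      using faithful[of ?p] A_pow_half[OF y(1)] X_pow_half_0[OF y(1)] y(1) by auto
    show False using ex_stab_A_mod4_eq_3[OF y(1) reg hc h4] stab by force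
  next
    case True
    have kernel: "x \<otimes> x \<in> H \<or> \<alpha> x mod 4 = 3 \<and> (x \<otimes> x) \<otimes> (x \<otimes> x) \<in> H"
      if x: "x \<in> carrier G" "[A x = 1] (mod 2 ^ e)" for x
    proof -
      \<comment> \<open>The inversion of \<open>x\<close> by \<open>h\<close>, in a form free of
        inverses.\<close>
      have "x \<otimes> (h \<otimes> x) = h"
        by (rule eqI) (use hc x in simp, use hc in simp,
          use X_mult[of x "h \<otimes> x"] X_mult[OF hc x(1)] x h(2) hc in \<open>unfold fold_cong, simp, Groebner_Basis.algebra\<close>,
          use A_mult[of x "h \<otimes> x"] A_mult[OF hc x(1)] x h(2) hc in \<open>unfold fold_cong, simp, Groebner_Basis.algebra\<close>)
      then have 1: "[c h = c x + \<alpha> x * c (h \<otimes> x)] (mod 2 ^ e)" "[\<alpha> h = \<alpha> x * \<alpha> (h \<otimes> x)] (mod 2 ^ e)"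
        using R.X_mult[of x "h \<otimes> x"] R.A_mult[of x "h \<otimes> x"] hc x by simp_all
      note 2 = R.X_mult[OF hc x(1)] R.A_mult[OF hc x(1)] R.X_mult[OF x(1) x(1)]
      have xx: "2 ^ e dvd \<alpha> x * \<alpha> x - 1"
      proof -
        have "2 ^ e dvd (\<alpha> x * \<alpha> x - 1) * \<alpha> h"
          using 1 2 unfolding fold_cong by Groebner_Basis.algebra
        then show ?thesis using R.A_odd[OF hc] by (simp add: pow2_dvd_mult_odd)
      qed
      have c0: "2 ^ e dvd c x * (1 + \<alpha> x * \<alpha> h)"
        using 1 2 ch unfolding fold_cong by Groebner_Basis.algebra
      show ?thesis
      proof (cases "\<alpha> x mod 4 = 1")
        case x4: True
        have "\<alpha> x * \<alpha> h mod 4 = 1"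
          using mod_mult_eq[of "\<alpha> x" 4 "\<alpha> h"] x4 True by simp
        then have "(1 + \<alpha> x * \<alpha> h) mod 4 = 2" by presburger
        then obtain t where "1 + \<alpha> x * \<alpha> h = 4 * t + 2" by (metis mult_div_mod_eq)
        then have eq: "1 + \<alpha> x * \<alpha> h = 2 * (2 * t + 1)" by simp
        have "2 ^ e dvd (2 * c x) * (2 * t + 1)" using c0 unfolding eq by (simp only: ac_simps)
        then have "2 ^ e dvd 2 * c x" by (simp add: pow2_dvd_mult_odd)
        moreover obtain k where "\<alpha> x = 4 * k + 1" using x4 by (metis mult_div_mod_eq)
        then have "c x + \<alpha> x * c x = 2 * c x * (2 * k + 1)" by (simp add: algebra_simps)
        ultimately have "2 ^ e dvd c x + \<alpha> x * c x" by simp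
        then show ?thesis using 2(3) x by (simp add: H_iff cong_dvd_iff)
      next
        case False
        have "2 ^ e dvd c ((x \<otimes> x) \<otimes> (x \<otimes> x))"
        proof -
          have x2: "x \<otimes> x \<in> carrier G" using x(1) by simp
          \<comment> \<open>\<open>- \<alpha> x\<close> is a square root of 1 that is 1 modulo 4, so
            \<open>2 ^ (e - 1)\<close> divides \<open>1 + \<alpha> x\<close> and with it
            \<open>c (x \<otimes> x)\<close>. A second squaring sends this to 0.\<close>
          have "(-\<alpha> x) mod 4 = 1" using False R.A_mod4[OF x(1)] by presburger
          then have "2 ^ (e - 1) dvd - \<alpha> x - 1" using xx pow2_dvd_pred_of_square[of "-\<alpha> x" e] by simp
          then have "2 ^ (e - 1) * 2 dvd (- \<alpha> x - 1) * 2" by (rule mult_dvd_mono) simp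
          then have "2 ^ e dvd (- \<alpha> x - 1) * 2" using e_split by (metis mult.commute)
          then have "2 ^ e dvd - c x * ((- \<alpha> x - 1) * 2)" by (rule dvd_mult)
          moreover have "[c ((x \<otimes> x) \<otimes> (x \<otimes> x)) = - c x * ((- \<alpha> x - 1) * 2)] (mod 2 ^ e)"
            using R.X_mult[OF x2 x2] R.X_mult[OF x(1) x(1)] R.A_mult[OF x(1) x(1)] xx
            unfolding fold_cong by Groebner_Basis.algebra
          ultimately show ?thesis by (simp add: cong_dvd_iff)
        qed
        then show ?thesis using False R.A_mod4[OF x(1)] x by (simp add: H_iff)
      qed
    qed
    from disj show False
    proof
      assume "\<alpha> m mod 4 = 1"
      then have "m \<otimes> m \<in> H" using kernel[OF m(1,2)] by auto
      moreover have "[X (m \<otimes> m) = 2 ^ (e - 1)] (mod 2 ^ e)"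
        using square_kernel(2)[OF m(1,2)] cong_mult[OF cong_refl[of 2] m(3)] e_split by (metis cong_trans)
      ultimately show False using not_H square_kernel(1)[OF m(1,2)] by blast
    next
      assume "\<exists>x\<in>carrier G. [A x = 1] (mod 2 ^ e) \<and> [X x = 2 ^ (e - 3)] (mod 2 ^ e)"
      then obtain x where x: "x \<in> carrier G" "[A x = 1] (mod 2 ^ e)" "[X x = 2 ^ (e - 3)] (mod 2 ^ e)" by blast
      have xx: "x \<otimes> x \<in> carrier G" using x(1) by simp
      have 1: "[A (x \<otimes> x) = 1] (mod 2 ^ e)" by (rule square_kernel(1)[OF x(1,2)])
      have "[X (x \<otimes> x \<otimes> (x \<otimes> x)) = 2 * X (x \<otimes> x)] (mod 2 ^ e)"
        by (rule square_kernel(2)[OF xx 1])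
      also have "[2 * X (x \<otimes> x) = 2 * (2 * X x)] (mod 2 ^ e)"
        by (rule cong_mult[OF cong_refl square_kernel(2)[OF x(1,2)]])
      also have "[2 * (2 * X x) = 2 * (2 * 2 ^ (e - 3))] (mod 2 ^ e)"
        using x(3) by (intro cong_mult cong_refl)
      also have "2 * (2 * (2::int) ^ (e - 3)) = 2 ^ (e - 1)"
      proof -
        have "e - 1 = Suc (Suc (e - 3))" using e3 by simp
        then show ?thesis by simp
      qed
      finally have 2: "[X (x \<otimes> x \<otimes> (x \<otimes> x)) = 2 ^ (e - 1)] (mod 2 ^ e)" .
      then have "x \<otimes> x \<otimes> (x \<otimes> x) \<notin> H" using not_H square_kernel(1)[OF xx 1] by blast
      moreover have "x \<otimes> x \<otimes> (x \<otimes> x) \<in> H"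
        using kernel[OF x(1,2)] subgroup.m_closed[OF subgroup_H] by blast
      ultimately show False by blast
    qed
  qed
qed

end

section \<open>Groups of order \<open>2 ^ e\<close> with a cyclic subgroup of index 2\<close>

text \<open>The gain of one factor 2 comes from the even number \<open>a - 1\<close> in
  \<open>geo_diff\<close>.\<close>

lemma power_cong:
  assumes "a mod 4 = (1::int)" "[int i = int j] (mod 2 ^ k)"
  shows "[a ^ i = a ^ j] (mod 2 ^ Suc k)"
proof -
  have "2 ^ k * 2 dvd (geo a i - geo a j) * (a - 1)"
    using iffD2[OF geo_cong_iff[OF assms(1)] assms(2)] mod4_eq_1_odd[OF assms(1)]
    by (intro mult_dvd_mono) (auto simp: cong_iff_dvd_diff)
  moreover have "(geo a i - geo a j) * (a - 1) = a ^ i - a ^ j"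
    using geo_diff[of a i] geo_diff[of a j] by (simp add: algebra_simps)
  ultimately show ?thesis by (simp add: cong_iff_dvd_diff mult.commute)
qed

text \<open>The affine maps of slope \<open>a\<close> and \<open>b\<close> sending 0 to 2 and 1, respectively, satisfy the
  relations \<open>r t = t\<^sup>j r\<close> and \<open>r\<^sup>2 = t\<^sup>k\<close> modulo \<open>2 ^ e\<close>.\<close>

definition affine_relations :: "nat \<Rightarrow> nat \<Rightarrow> nat \<Rightarrow> int \<Rightarrow> int \<Rightarrow> bool" where
  "affine_relations e j k a b \<longleftrightarrow> a mod 4 = 1 \<and> odd b
    \<and> [2 * geo a j + a ^ j = 1 + 2 * b] (mod 2 ^ e) \<and> [a ^ j = a] (mod 2 ^ e)
    \<and> [2 * geo a k = 1 + b] (mod 2 ^ e) \<and> [a ^ k = b * b] (mod 2 ^ e)"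

text \<open>The order of the map of slope \<open>a\<close> sending 0 to 2 divides
  \<open>2 ^ (e - 1)\<close>, so only residues of the exponents count.\<close>

lemma affine_relations_cong:
  assumes "affine_relations e j k a b" "1 \<le> e"
    and "[int j = int j'] (mod 2 ^ (e - 1))" "[int k = int k'] (mod 2 ^ (e - 1))"
  shows "affine_relations e j' k' a b"
proof -
  have a: "a mod 4 = 1" using assms(1) by (simp add: affine_relations_def)
  have e: "e = Suc (e - 1)" using assms(2) by simp
  have *: "[a ^ i = a ^ i'] (mod 2 ^ e)" "[2 * geo a i = 2 * geo a i'] (mod 2 ^ e)"
    if "[int i = int i'] (mod 2 ^ (e - 1))" for i i'
  proof -
    show "[a ^ i = a ^ i'] (mod 2 ^ e)" using power_cong[OF a that] e by simp
    have "2 * 2 ^ (e - 1) dvd 2 * (geo a i - geo a i')"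
      using iffD2[OF geo_cong_iff[OF a] that] unfolding cong_iff_dvd_diff by (intro mult_dvd_mono dvd_refl)
    then have "2 ^ e dvd 2 * (geo a i - geo a i')" using e by (metis power_Suc)
    then show "[2 * geo a i = 2 * geo a i'] (mod 2 ^ e)" by (simp add: cong_iff_dvd_diff algebra_simps)
  qed
  have "[2 * geo a j + a ^ j = 2 * geo a j' + a ^ j'] (mod 2 ^ e)"
    using *[OF assms(3)] by (intro cong_add)
  then show ?thesis using assms(1) *[OF assms(3)] *[OF assms(4)]
    unfolding affine_relations_def by (meson cong_sym cong_trans)
qed

text \<open>Replacing \<open>r\<close> by \<open>t\<^sup>l r\<close> keeps \<open>j\<close> and
  turns \<open>k\<close> into \<open>l + j * l + k\<close>; so \<open>k\<close> may be shifted by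
  multiples of \<open>1 + j\<close>. The integer solution \<open>x\<close> is reduced to a natural
  exponent.\<close>

lemma solve_exponent:
  fixes j k t :: nat
  assumes "[x * (1 + int j) + int k = int t] (mod 2 ^ m)"
  shows "\<exists>l::nat. [int (l + j * l + k) = int t] (mod 2 ^ m)"
proof
  let ?l = "nat (x mod 2 ^ m)"
  have "[int ?l * (1 + int j) + int k = x * (1 + int j) + int k] (mod 2 ^ m)"
    by (intro cong_add cong_mult cong_refl) (simp add: cong_def)
  moreover have "int (?l + j * ?l + k) = int ?l * (1 + int j) + int k"
    by (simp add: algebra_simps)
  ultimately show "[int (?l + j * ?l + k) = int t] (mod 2 ^ m)" using assms cong_trans by metis
qed

text \<open>With \<open>n = 2 ^ (e - 2)\<close>, \<open>j\<close> is \<open>1\<close>,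
  \<open>1 + n\<close>, \<open>-1\<close> or \<open>-1 + n\<close> modulo \<open>2 * n\<close>.
  After shifting \<open>k\<close>, the cases are: for \<open>1\<close>, the product of a cyclic
  group with one of order 2 (\<open>k = 0\<close>) and the cyclic group (\<open>k = 1\<close>); for
  \<open>1 + n\<close>, the modular group; for \<open>-1\<close>, the dihedral
  (\<open>k = 0\<close>) and generalised quaternion (\<open>k = n\<close>) groups; for
  \<open>-1 + n\<close>, the semidihedral group. If \<open>k = 0\<close>, the relation for the
  square of \<open>r\<close> forces \<open>b = -1\<close>, and \<open>a\<close> is then read off
  from the relation for \<open>r t\<close>.\<close>

lemma exists_affine_relations:
  fixes j k :: nat
  assumes e: "2 \<le> e"
    and jj: "[int j * int j = 1] (mod 2 ^ (e - 1))" and jk: "[int j * int k = int k] (mod 2 ^ (e - 1))"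
  shows "\<exists>l a b. affine_relations e j (l + j * l + k) a b"
proof -
  define d where "d = e - 2"
  define n :: int where "n = 2 ^ d"
  have ed: "e = Suc (Suc d)" using e by (simp add: d_def)
  have m: "(2::int) ^ (e - 1) = 2 * n" "(2::int) ^ e = 4 * n" by (simp_all add: ed n_def)
  have finish: ?thesis
    if "affine_relations e j' t a b" "[int j' = int j] (mod 2 * n)"
      "[x * (1 + int j) + int k = int t] (mod 2 * n)" for j' t a b x
  proof -
    have "[x * (1 + int j) + int k = int t] (mod 2 ^ (e - 1))" using that(3) m by simp
    then obtain l :: nat where "[int (l + j * l + k) = int t] (mod 2 ^ (e - 1))"
      using solve_exponent by blast
    then have "affine_relations e j (l + j * l + k) a b"
      using affine_relations_cong[OF that(1), of j] that(2) e m by (simp add: cong_sym)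
    then show ?thesis by blast
  qed
  have dvd1: "2 * n dvd (int j - 1) * (int j + 1)"
    using jj unfolding m cong_iff_dvd_diff by (simp add: algebra_simps)
  have dvd2: "2 * n dvd (int j - 1) * int k"
    using jk unfolding m cong_iff_dvd_diff by (simp add: algebra_simps)
  have "even ((int j - 1) * (int j + 1))" using dvd1 by (rule dvd_mult_left)
  then have "odd (int j)" by auto
  then consider "int j mod 4 = 1" | "int j mod 4 = 3" using odd_mod4 by blast
  then show ?thesis
  proof cases
    case 1
    define s where "s = int j div 4"
    have s: "int j = 4 * s + 1" using 1 mult_div_mod_eq[of 4 "int j"] by (simp add: s_def)
    have "2 * n dvd 2 * ((int j - 1) * (2 * s + 1))" using dvd1 by (simp add: s algebra_simps)
    then have "n dvd (int j - 1) * (2 * s + 1)" by simp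
    then have nj: "n dvd int j - 1" unfolding n_def by (subst (asm) pow2_dvd_mult_odd) simp_all
    show ?thesis
    proof (cases "2 * n dvd int j - 1")
      case True
      then have j1: "[int 1 = int j] (mod 2 * n)" by (simp add: cong_iff_dvd_diff dvd_diff_commute)
      show ?thesis
      proof (cases "even k")
        case True
        then obtain k' where k': "k = 2 * k'" by blast
        \<comment> \<open>For \<open>j = 1\<close> and \<open>k = 0\<close> the relations contain
          \<open>0 = 1 + b\<close> and \<open>2 + a = 1 + 2 * b\<close>.\<close>
        have "affine_relations e 1 0 (-3) (-1)" by (simp add: affine_relations_def)
        moreover have "[- int k' * (1 + int j) + int k = int 0] (mod 2 * n)"
        proof -
          have "- int k' * (1 + int j) + int k = - int k' * (int j - 1)" by (simp add: k' algebra_simps)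
          then show ?thesis using \<open>2 * n dvd int j - 1\<close> by (simp add: cong_0_iff)
        qed
        ultimately show ?thesis using finish j1 by blast
      next
        case False
        then obtain k' where k': "k = 2 * k' + 1" by (rule oddE)
        have "affine_relations e 1 1 1 1" by (simp add: affine_relations_def)
        moreover have "[- int k' * (1 + int j) + int k = int 1] (mod 2 * n)"
        proof -
          have "- int k' * (1 + int j) + int k - 1 = - int k' * (int j - 1)" by (simp add: k' algebra_simps)
          then show ?thesis using \<open>2 * n dvd int j - 1\<close> by (simp add: cong_iff_dvd_diff)
        qed
        ultimately show ?thesis using finish j1 by blast
      qed
    next
      case False
      obtain w where w: "int j - 1 = n * w" using nj by blast
      have "odd w" using False w by auto
      \<comment> \<open>\<open>j - 1\<close> is divisible by 4 but not by \<open>2 * n\<close>, so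
        \<open>2 * n\<close> does not divide 4; thus \<open>n\<close> is a multiple of 4
        here.\<close>
      have "\<not> d \<le> 1"
      proof
        assume "d \<le> 1"
        then have "2 * n dvd 4" by (cases d) (auto simp: n_def)
        then show False using False s by (auto intro: dvd_trans)
      qed
      then obtain d' where d': "d = Suc (Suc d')" by (metis Suc_leI le_Suc_ex not_less_eq_eq One_nat_def plus_1_eq_Suc add_Suc)
      define r where "r = (2::int) ^ d'"
      have n4: "n = 4 * r" by (simp add: n_def d' r_def)
      have "2 * n dvd n * (w * int k)" using dvd2 by (simp add: w mult.assoc)
      then have "even (w * int k)" by (simp add: n_def mult.commute)
      then have "even k" using \<open>odd w\<close> by simp
      then obtain k' where k': "k = 2 * k'" by blast
      \<comment> \<open>Compared with the case \<open>j = 1\<close>, doubling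
        \<open>geo a (1 + 2 ^ d)\<close> gives the extra term \<open>2 * a * (n * t)\<close>, which
        is \<open>2 * n\<close> modulo \<open>4 * n\<close> as \<open>a\<close> and \<open>t\<close>
        are odd; the shift of the slope compensates it.\<close>
      define a where "a = -3 + 2 * n"
      have a4: "a mod 4 = 1" by (simp add: a_def n4) presburger
      obtain t where t: "odd t" "geo a (2 ^ d) = n * t" using geo_pow2[OF a4] n_def by blast
      have g: "geo a (1 + 2 ^ d) = 1 + a * (n * t)" using geo_add[of a 1 "2 ^ d"] t by simp
      have p: "a ^ (1 + 2 ^ d) = a * (1 + (a - 1) * (n * t))" using geo_diff[of a "2 ^ d"] t by simp
      obtain t' where t': "t = 2 * t' + 1" using t(1) by (rule oddE)
      have "affine_relations e (1 + 2 ^ d) 0 a (-1)"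
      proof -
        have p1: "[a ^ (1 + 2 ^ d) = a] (mod 4 * n)"
        proof -
          have "a ^ (1 + 2 ^ d) - a = 4 * n * (a * (2 * r - 1) * t)"
            unfolding p by (simp add: a_def n4 algebra_simps)
          then show ?thesis by (simp add: cong_iff_dvd_diff)
        qed
        have "[2 * geo a (1 + 2 ^ d) + a ^ (1 + 2 ^ d) = 2 * (1 + a * (n * t)) + a] (mod 4 * n)"
          unfolding g by (intro cong_add cong_refl p1)
        also have "[2 * (1 + a * (n * t)) + a = 1 + 2 * (-1)] (mod 4 * n)"
        proof -
          have "2 * (1 + a * (n * t)) + a - (1 + 2 * (-1)) = 4 * n * (a * t' + 4 * r - 1)"
            unfolding t' by (simp add: a_def n4 algebra_simps)
          then show ?thesis unfolding cong_iff_dvd_diff by simp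
        qed
        finally show ?thesis using p1 a4 by (simp add: affine_relations_def m)
      qed
      moreover have "[int (1 + 2 ^ d) = int j] (mod 2 * n)"
      proof -
        obtain w' where "w = 2 * w' + 1" using \<open>odd w\<close> by (rule oddE)
        then have "int (1 + 2 ^ d) - int j = 2 * n * (- w')" using w by (simp add: n_def algebra_simps)
        then show ?thesis by (simp add: cong_iff_dvd_diff)
      qed
      \<comment> \<open>\<open>1 + j\<close> is \<open>2 * (2 * s + 1)\<close> and
        \<open>k = 2 * k'\<close>, so \<open>x\<close> is \<open>- k'\<close> times an inverse of
        \<open>2 * s + 1\<close> modulo \<open>n\<close>.\<close>
      moreover have "\<exists>x. [x * (1 + int j) + int k = int 0] (mod 2 * n)"
      proof -
        have "odd (2 * s + 1)" by simp
        then have "coprime (2 * s + 1) (2 ^ d)" by simp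
        then obtain v where v: "[(2 * s + 1) * v = 1] (mod n)" using cong_solve_coprime_int n_def by metis
        then obtain y where "(2 * s + 1) * v = 1 + n * y"
          by (metis cong_iff_lin cong_sym)
        then have "- int k' * v * (1 + int j) + int k = 2 * n * (- int k' * y)"
          unfolding s k' of_nat_mult of_nat_numeral by Groebner_Basis.algebra
        then show ?thesis by (metis cong_0_iff dvd_triv_left of_nat_0)
      qed
      ultimately show ?thesis using finish by blast
    qed
  next
    case 2
    define s where "s = int j div 4"
    have s: "int j = 4 * s + 3" using 2 mult_div_mod_eq[of 4 "int j"] by (simp add: s_def)
    have "2 * n dvd 2 * ((int j + 1) * (2 * s + 1))" using dvd1 by (simp add: s algebra_simps)
    then have "n dvd (int j + 1) * (2 * s + 1)" by simp
    then have nj: "n dvd int j + 1" unfolding n_def by (subst (asm) pow2_dvd_mult_odd) simp_all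
    have "2 * n dvd 2 * (int k * (2 * s + 1))" using dvd2 by (simp add: s algebra_simps)
    then have "n dvd int k * (2 * s + 1)" by simp
    then have nk: "n dvd int k" unfolding n_def by (subst (asm) pow2_dvd_mult_odd) simp_all
    show ?thesis
    proof (cases "2 * n dvd int j + 1")
      case True
      have n1: "int (2 ^ Suc d - 1) = 2 * n - 1" by (simp add: n_def of_nat_diff)
      have geo1: "geo 1 i = int i" for i by (simp add: geo_def)
      have j1: "[int (2 ^ Suc d - 1) = int j] (mod 2 * n)"
      proof -
        have eq: "int (2 ^ Suc d - 1) - int j = 2 * n - (int j + 1)" unfolding n1 by simp
        show ?thesis unfolding cong_iff_dvd_diff eq by (rule dvd_diff[OF dvd_refl True])
      qed
      \<comment> \<open>Here \<open>1 + j\<close> vanishes modulo \<open>2 * n\<close>, so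
        \<open>k\<close> cannot be shifted, and its two possible residues 0 and \<open>n\<close>
        need different slopes \<open>b\<close>.\<close>
      show ?thesis
      proof (cases "2 * n dvd int k")
        case k0: True
        have "affine_relations e (2 ^ Suc d - 1) 0 1 (-1)"
          unfolding affine_relations_def geo1 n1 m by (simp add: cong_iff_dvd_diff)
        moreover have "[0 * (1 + int j) + int k = int 0] (mod 2 * n)"
          using k0 by (simp add: cong_0_iff)
        ultimately show ?thesis using finish j1 by blast
      next
        case k1: False
        obtain w where w: "int k = n * w" using nk by blast
        have "odd w" using k1 w by auto
        then obtain w' where w': "w = 2 * w' + 1" by (rule oddE)
        have "[1 ^ 2 ^ d = (-1 + 2 * n) * (-1 + 2 * n)] (mod 4 * n)"
        proof -
          have "1 - (-1 + 2 * n) * (-1 + 2 * n) = 4 * n * (1 - n)" by (simp add: algebra_simps)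
          then show ?thesis by (simp add: cong_iff_dvd_diff)
        qed
        moreover have "[2 * (2 * n - 1) + 1 = 1 + 2 * (-1 + 2 * n)] (mod 4 * n)"
          by (simp add: algebra_simps)
        ultimately have "affine_relations e (2 ^ Suc d - 1) (2 ^ d) 1 (-1 + 2 * n)"
          unfolding affine_relations_def geo1 n1 m by (simp add: n_def)
        moreover have "[0 * (1 + int j) + int k = int (2 ^ d)] (mod 2 * n)"
        proof -
          have "int k - int (2 ^ d) = 2 * n * w'" unfolding w w' by (simp add: n_def algebra_simps)
          then show ?thesis by (simp add: cong_iff_dvd_diff)
        qed
        ultimately show ?thesis using finish j1 by blast
      qed
    next
      case False
      obtain w where w: "int j + 1 = n * w" using nj by blast
      have "odd w" using False w by auto
      have "\<not> d \<le> 1"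
      proof
        assume "d \<le> 1"
        then have "2 * n dvd 4" by (cases d) (auto simp: n_def)
        then show False using False s by (auto intro: dvd_trans)
      qed
      then obtain d' where d': "d = Suc (Suc d')" by (metis Suc_leI le_Suc_ex not_less_eq_eq One_nat_def plus_1_eq_Suc add_Suc)
      define r where "r = (2::int) ^ d'"
      have n4: "n = 4 * r" by (simp add: n_def d' r_def)
      \<comment> \<open>Modulo \<open>2 * n\<close> this slope is 1, hence \<open>geo a i\<close> is
        \<open>i\<close>. The extra \<open>2 * n\<close> makes \<open>2 * (n - 1) + a\<close> equal
        to \<open>-1\<close> modulo \<open>4 * n\<close>.\<close>
      define a where "a = 1 + 2 * n"
      have a4: "a mod 4 = 1" by (simp add: a_def n4) presburger
      have j0: "int (2 ^ d - 1) = n - 1" by (simp add: n_def of_nat_diff)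
      have g: "[geo a i = int i] (mod 2 * n)" for i
      proof (induction i)
        case (Suc i)
        have "2 * n dvd (a - 1) * geo a i" by (simp add: a_def)
        then have "[a ^ i = 1] (mod 2 * n)" by (simp add: geo_diff cong_iff_dvd_diff)
        with Suc have "[geo a i + a ^ i = int i + 1] (mod 2 * n)" by (rule cong_add)
        then show ?case by (simp add: geo_Suc add.commute)
      qed simp
      obtain y where y: "geo a (2 ^ d - 1) = n - 1 + 2 * n * y"
        using g[of "2 ^ d - 1"] unfolding j0 by (metis cong_iff_lin cong_sym)
      have p: "a ^ (2 ^ d - 1) = 1 + 2 * n * (n - 1 + 2 * n * y)"
        using geo_diff[of a "2 ^ d - 1"] unfolding y by (simp add: a_def)
      have "affine_relations e (2 ^ d - 1) 0 a (-1)"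
      proof -
        have "a ^ (2 ^ d - 1) - a = 4 * n * (2 * r - 1 + n * y)"
          unfolding p by (simp add: a_def n4 algebra_simps)
        then have "[a ^ (2 ^ d - 1) = a] (mod 4 * n)" by (simp add: cong_iff_dvd_diff)
        moreover have "2 * geo a (2 ^ d - 1) + a ^ (2 ^ d - 1) - (1 + 2 * (-1)) = 4 * n * (2 * r + y + n * y)"
          unfolding p y by (simp add: n4 algebra_simps)
        then have "[2 * geo a (2 ^ d - 1) + a ^ (2 ^ d - 1) = 1 + 2 * (-1)] (mod 4 * n)"
          unfolding cong_iff_dvd_diff by simp
        ultimately show ?thesis using a4 by (simp add: affine_relations_def m)
      qed
      moreover have "[int (2 ^ d - 1) = int j] (mod 2 * n)"
      proof -
        obtain w' where "w = 2 * w' + 1" using \<open>odd w\<close> by (rule oddE)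
        then have "int j + 1 = n + 2 * n * w'" using w by (simp add: algebra_simps)
        then have "int (2 ^ d - 1) - int j = 2 * n * (- w')" unfolding j0 by simp
        then show ?thesis by (simp add: cong_iff_dvd_diff)
      qed
      \<comment> \<open>\<open>k = n * v\<close> and \<open>1 + j = n * w\<close> with
        \<open>w\<close> odd, so \<open>x = v\<close> gives \<open>n * v * (w + 1)\<close> with
        \<open>w + 1\<close> even.\<close>
      moreover have "\<exists>x. [x * (1 + int j) + int k = int 0] (mod 2 * n)"
      proof -
        obtain v where "int k = n * v" using nk by blast
        moreover obtain w' where "w = 2 * w' + 1" using \<open>odd w\<close> by (rule oddE)
        ultimately have "v * (1 + int j) + int k = 2 * n * (v * (w' + 1))"
          using w by (simp add: algebra_simps)
        then show ?thesis by (metis cong_0_iff dvd_triv_left of_nat_0)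
      qed
      ultimately show ?thesis using finish by blast
    qed
  qed
qed

section \<open>The holomorph as a group\<close>

lemma carrier_hol_iff:
  "(u, a) \<in> carrier (hol e) \<longleftrightarrow> 0 \<le> u \<and> u < 2 ^ e \<and> 0 \<le> a \<and> a < 2 ^ e \<and> odd a"
  by (simp add: hol_def)

lemma mult_hol: "(u, a) \<otimes>\<^bsub>hol e\<^esub> (v, b) = ((u + v * a) mod 2 ^ e, (a * b) mod 2 ^ e)"
  by (simp add: hol_def)

lemma one_hol: "\<one>\<^bsub>hol e\<^esub> = (0, 1)"
  by (simp add: hol_def)

lemma odd_mod_pow2: "1 \<le> e \<Longrightarrow> odd ((a::int) mod 2 ^ e) \<longleftrightarrow> odd a"
  using cong_power2_even[of "a mod 2 ^ e" a e] by simp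

lemma mod_in_carrier_hol: "1 \<le> e \<Longrightarrow> odd a \<Longrightarrow> (u mod 2 ^ e, a mod 2 ^ e) \<in> carrier (hol e)"
  by (simp add: carrier_hol_iff odd_mod_pow2)

lemma hol_eqI:
  assumes "x \<in> carrier (hol e)" "y \<in> carrier (hol e)"
    "[fst x = fst y] (mod 2 ^ e)" "[snd x = snd y] (mod 2 ^ e)"
  shows "x = y"
  using assms by (cases x; cases y) (simp add: carrier_hol_iff cong_def)

lemma group_hol:
  assumes "1 \<le> e"
  shows "group (hol e)"
proof (rule groupI)
  fix x y assume "x \<in> carrier (hol e)" "y \<in> carrier (hol e)"
  then show "x \<otimes>\<^bsub>hol e\<^esub> y \<in> carrier (hol e)"
    by (cases x; cases y) (simp add: mult_hol odd_mod_pow2[OF assms] carrier_hol_iff)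
next
  have "(1::int) < 2 ^ e" using assms by simp
  then show "\<one>\<^bsub>hol e\<^esub> \<in> carrier (hol e)" by (simp add: one_hol carrier_hol_iff)
next
  fix x y z assume "x \<in> carrier (hol e)" "y \<in> carrier (hol e)" "z \<in> carrier (hol e)"
  show "x \<otimes>\<^bsub>hol e\<^esub> y \<otimes>\<^bsub>hol e\<^esub> z = x \<otimes>\<^bsub>hol e\<^esub> (y \<otimes>\<^bsub>hol e\<^esub> z)"
  proof (cases x; cases y; cases z)
    fix u a v b w c assume *: "x = (u, a)" "y = (v, b)" "z = (w, c)"
    have "[(u + v * a) mod 2 ^ e + w * (a * b mod 2 ^ e) = (u + v * a) + w * (a * b)] (mod 2 ^ e)"
      by (intro cong_add cong_mult cong_refl) (simp_all add: cong_def)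
    moreover have "[u + (v + w * b) mod 2 ^ e * a = u + (v + w * b) * a] (mod 2 ^ e)"
      by (intro cong_add cong_mult cong_refl) (simp_all add: cong_def)
    ultimately show ?thesis
      by (simp add: * mult_hol cong_def mod_simps algebra_simps)
  qed
next
  fix x assume "x \<in> carrier (hol e)"
  then show "\<one>\<^bsub>hol e\<^esub> \<otimes>\<^bsub>hol e\<^esub> x = x"
    by (cases x) (simp add: mult_hol one_hol carrier_hol_iff)
next
  fix x assume x: "x \<in> carrier (hol e)"
  obtain u a where ua: "x = (u, a)" by (cases x)
  have "coprime a (2 ^ e)" using x ua by (simp add: carrier_hol_iff)
  then obtain b where b: "[a * b = 1] (mod 2 ^ e)" using cong_solve_coprime_int by blast
  have "odd (a * b)" using cong_power2_even[OF b assms] by simp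
  then have "odd b" by simp
  then have y: "((- u * b) mod 2 ^ e, b mod 2 ^ e) \<in> carrier (hol e)"
    using assms by (rule mod_in_carrier_hol[rotated])
  have "[- u * b mod 2 ^ e + u * (b mod 2 ^ e) = - u * b + u * b] (mod 2 ^ e)"
    by (intro cong_add cong_mult cong_refl) (simp_all add: cong_def)
  then have "(- u * b mod 2 ^ e + u * (b mod 2 ^ e)) mod 2 ^ e = 0" by (simp add: cong_def)
  moreover have "(b mod 2 ^ e * a) mod 2 ^ e = 1"
    using b assms by (simp add: cong_def mod_simps mult.commute)
  ultimately have "((- u * b) mod 2 ^ e, b mod 2 ^ e) \<otimes>\<^bsub>hol e\<^esub> x = \<one>\<^bsub>hol e\<^esub>"
    by (simp add: ua mult_hol one_hol)
  then show "\<exists>y\<in>carrier (hol e). y \<otimes>\<^bsub>hol e\<^esub> x = \<one>\<^bsub>hol e\<^esub>" using y by blast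
qed

lemma affine_rep_hom:
  assumes "2 \<le> e" "group G" "F \<in> hom G (hol e)"
  shows "affine_rep G e (\<lambda>x. fst (F x)) (\<lambda>x. snd (F x))"
proof -
  interpret group G by fact
  have F: "F x \<in> carrier (hol e)" if "x \<in> carrier G" for x
    using assms(3) that by (auto simp: hom_def)
  show ?thesis
  proof unfold_locales
    fix x y assume "x \<in> carrier G" "y \<in> carrier G"
    then have "F (x \<otimes>\<^bsub>G\<^esub> y) = F x \<otimes>\<^bsub>hol e\<^esub> F y" using assms(3) by (simp add: hom_def)
    then show "[fst (F (x \<otimes>\<^bsub>G\<^esub> y)) = fst (F x) + snd (F x) * fst (F y)] (mod 2 ^ e)"
      "[snd (F (x \<otimes>\<^bsub>G\<^esub> y)) = snd (F x) * snd (F y)] (mod 2 ^ e)"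
      by (cases "F x"; cases "F y"; simp add: mult_hol cong_def mult.commute)+
  next
    fix x assume "x \<in> carrier G"
    then show "odd (snd (F x))" using F[of x] by (cases "F x") (simp add: carrier_hol_iff)
  qed (rule assms(1))
qed

lemma affine_rep_hol: "2 \<le> e \<Longrightarrow> affine_rep (hol e) e fst snd"
  using affine_rep_hom[of e "hol e" "\<lambda>x. x"] by (simp add: group_hol hom_def)

section \<open>Homomorphisms out of groups with a cyclic subgroup of index 2\<close>

context group
begin

lemma
  assumes t: "t \<in> carrier G" and r: "r \<in> carrier G"
    and rt: "r \<otimes> t = t [^] (j::nat) \<otimes> r" and rr: "r \<otimes> r = t [^] (k::nat)"
  shows ext_mult_10: "t [^] (a::nat) \<otimes> r \<otimes> t [^] (b::nat) = t [^] (a + j * b) \<otimes> r"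
    and ext_mult_11: "t [^] (a::nat) \<otimes> r \<otimes> (t [^] (b::nat) \<otimes> r) = t [^] (a + j * b + k)"
proof -
  have *: "r \<otimes> t [^] i = t [^] (j * i) \<otimes> r" for i :: nat
  proof (induction i)
    case (Suc i)
    have "r \<otimes> t [^] Suc i = (r \<otimes> t [^] i) \<otimes> t" using t r by (simp add: m_assoc)
    also have "\<dots> = t [^] (j * i) \<otimes> (r \<otimes> t)" unfolding Suc.IH using t r by (simp add: m_assoc)
    also have "\<dots> = t [^] (j * i) \<otimes> t [^] j \<otimes> r" unfolding rt using t r by (simp add: m_assoc)
    also have "\<dots> = t [^] (j * Suc i) \<otimes> r" using t by (simp add: nat_pow_mult add.commute)
    finally show ?case .
  qed (use t r in simp)
  show 10: "t [^] a \<otimes> r \<otimes> t [^] b = t [^] (a + j * b) \<otimes> r" for a b :: nat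
    using t r *[of b] by (simp add: m_assoc nat_pow_mult[symmetric])
  have "t [^] a \<otimes> r \<otimes> (t [^] b \<otimes> r) = t [^] a \<otimes> r \<otimes> t [^] b \<otimes> r"
    using t r by (simp add: m_assoc)
  also have "\<dots> = t [^] (a + j * b) \<otimes> (r \<otimes> r)"
    unfolding 10 using t r by (simp add: m_assoc)
  also have "\<dots> = t [^] (a + j * b + k)" unfolding rr using t by (simp add: nat_pow_mult)
  finally show "t [^] a \<otimes> r \<otimes> (t [^] b \<otimes> r) = t [^] (a + j * b + k)" .
qed

text \<open>Von Dyck's principle made concrete: elements have a normal form, a power of
  \<open>t\<close> times 1 or \<open>r\<close>, and both groups multiply normal forms by the same
  rules. \<open>disj\<close> separates the two shapes, and \<open>pow\<close> makes \<open>F\<close>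
  independent of the exponent chosen by \<open>SOME\<close>.\<close>

lemma ex_hom_cyclic_extension:
  assumes L: "group L" and t: "t \<in> carrier G" and r: "r \<in> carrier G"
    and rt: "r \<otimes> t = t [^] (j::nat) \<otimes> r" and rr: "r \<otimes> r = t [^] (k::nat)"
    and gen: "\<And>x. x \<in> carrier G \<Longrightarrow> \<exists>i::nat. x = t [^] i \<or> x = t [^] i \<otimes> r"
    and disj: "\<And>(i::nat) (i'::nat). t [^] i \<noteq> t [^] i' \<otimes> r"
    and t': "t' \<in> carrier L" and r': "r' \<in> carrier L"
    and rt': "r' \<otimes>\<^bsub>L\<^esub> t' = t' [^]\<^bsub>L\<^esub> j \<otimes>\<^bsub>L\<^esub> r'" and rr': "r' \<otimes>\<^bsub>L\<^esub> r' = t' [^]\<^bsub>L\<^esub> k"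
    and pow: "\<And>(i::nat) (i'::nat). t [^] i = t [^] i' \<Longrightarrow> t' [^]\<^bsub>L\<^esub> i = t' [^]\<^bsub>L\<^esub> i'"
  shows "\<exists>F \<in> hom G L. (\<forall>i::nat. F (t [^] i) = t' [^]\<^bsub>L\<^esub> i \<and> F (t [^] i \<otimes> r) = t' [^]\<^bsub>L\<^esub> i \<otimes>\<^bsub>L\<^esub> r')"
proof -
  interpret L: group L by fact
  define F where "F x = (if \<exists>i::nat. x = t [^] i then t' [^]\<^bsub>L\<^esub> (SOME i::nat. x = t [^] i)
    else t' [^]\<^bsub>L\<^esub> (SOME i::nat. x = t [^] i \<otimes> r) \<otimes>\<^bsub>L\<^esub> r')" for x
  have F0: "F (t [^] i) = t' [^]\<^bsub>L\<^esub> i" for i :: nat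
  proof -
    have "t [^] i = t [^] (SOME i'::nat. t [^] i = t [^] i')" by (rule someI) simp
    from pow[OF this] have "t' [^]\<^bsub>L\<^esub> (SOME i'::nat. t [^] i = t [^] i') = t' [^]\<^bsub>L\<^esub> i" ..
    moreover have "\<exists>i'::nat. t [^] i = t [^] i'" by blast
    ultimately show ?thesis by (simp only: F_def if_True)
  qed
  have F1: "F (t [^] i \<otimes> r) = t' [^]\<^bsub>L\<^esub> i \<otimes>\<^bsub>L\<^esub> r'" for i :: nat
  proof -
    have "t [^] i \<otimes> r = t [^] (SOME i'::nat. t [^] i \<otimes> r = t [^] i' \<otimes> r) \<otimes> r" by (rule someI) simp
    then have "t [^] i = t [^] (SOME i'::nat. t [^] i \<otimes> r = t [^] i' \<otimes> r)" using t r by simp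
    from pow[OF this] have "t' [^]\<^bsub>L\<^esub> (SOME i'::nat. t [^] i \<otimes> r = t [^] i' \<otimes> r) = t' [^]\<^bsub>L\<^esub> i" ..
    moreover have "\<not> (\<exists>i'::nat. t [^] i \<otimes> r = t [^] i')" using disj[symmetric] by blast
    ultimately show ?thesis by (simp only: F_def if_False)
  qed
  have "F \<in> hom G L"
  proof (rule homI)
    fix x assume "x \<in> carrier G"
    then show "F x \<in> carrier L" using gen[of x] t' r' by (auto simp: F0 F1)
  next
    fix x y assume "x \<in> carrier G" "y \<in> carrier G"
    then obtain a b :: nat where ab: "x = t [^] a \<or> x = t [^] a \<otimes> r" "y = t [^] b \<or> y = t [^] b \<otimes> r"
      using gen by meson
    have 01: "t [^] a \<otimes> (t [^] b \<otimes> r) = t [^] (a + b) \<otimes> r"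
      "t' [^]\<^bsub>L\<^esub> a \<otimes>\<^bsub>L\<^esub> (t' [^]\<^bsub>L\<^esub> b \<otimes>\<^bsub>L\<^esub> r') = t' [^]\<^bsub>L\<^esub> (a + b) \<otimes>\<^bsub>L\<^esub> r'"
      using t r t' r' by (simp_all add: m_assoc[symmetric] L.m_assoc[symmetric] nat_pow_mult L.nat_pow_mult)
    show "F (x \<otimes> y) = F x \<otimes>\<^bsub>L\<^esub> F y"
      using ab t t'
      by (auto simp: F0 F1 01 nat_pow_mult L.nat_pow_mult ext_mult_10[OF t r rt rr] ext_mult_11[OF t r rt rr]
        L.ext_mult_10[OF t' r' rt' rr'] L.ext_mult_11[OF t' r' rt' rr'])
  qed
  then show ?thesis using F0 F1 by blast
qed

lemma pow_eq_iff_cong: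
  assumes t: "t \<in> carrier G" and ord: "\<And>i::nat. t [^] i = \<one> \<longleftrightarrow> n dvd i"
  shows "t [^] (i::nat) = t [^] (j::nat) \<longleftrightarrow> [int i = int j] (mod int n)"
proof -
  have *: "t [^] i = t [^] j \<longleftrightarrow> [int i = int j] (mod int n)" if "i \<le> j" for i j :: nat
  proof -
    have eq: "t [^] j = t [^] i \<otimes> t [^] (j - i)" using t that by (simp add: nat_pow_mult)
    have "t [^] i = t [^] j \<longleftrightarrow> t [^] (j - i) = \<one>" unfolding eq using t by simp
    also have "\<dots> \<longleftrightarrow> int n dvd int j - int i" by (simp only: ord of_nat_diff[OF that, symmetric] of_nat_dvd_iff)
    finally show ?thesis by (simp add: cong_iff_dvd_diff dvd_diff_commute)
  qed
  show ?thesis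
  proof (cases "i \<le> j")
    case False
    then show ?thesis using *[of j i] by (auto simp: cong_sym_eq)
  qed (rule *)
qed

text \<open>An element outside the cyclic subgroup yields \<open>j\<close> and \<open>k\<close>;
  corrected by a power of \<open>t\<close>, it satisfies the same relations as an explicit pair of
  affine maps. Powers of \<open>t\<close> send 0 to even points and the other coset sends 0 to odd
  points, which makes the action regular.\<close>

lemma affine_rep_of_index_2_cyclic:
  assumes e: "2 \<le> e" and card: "card (carrier G) = 2 ^ e"
    and t: "t \<in> carrier G" and ord: "\<And>i::nat. t [^] i = \<one> \<longleftrightarrow> 2 ^ (e - 1) dvd i"
  shows "\<exists>c \<alpha>. affine_rep G e c \<alpha> \<and> (\<forall>x\<in>carrier G. [c x = 0] (mod 2 ^ e) \<longleftrightarrow> x = \<one>)"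
proof -
  define n :: nat where "n = 2 ^ (e - 1)"
  have n: "n > 0" "2 ^ e = 2 * n" "int n = 2 ^ (e - 1)" using e by (cases e; simp add: n_def)+
  have ord': "t [^] i = t [^] j \<longleftrightarrow> [int i = int j] (mod int n)" for i j :: nat
    by (rule pow_eq_iff_cong[OF t]) (simp add: ord n_def)
  define P where "P = (\<lambda>i::nat. t [^] i) ` {..<n}"
  have P: "t [^] i \<in> P" for i :: nat
  proof -
    have "t [^] i = t [^] (i mod n)" by (simp add: ord' cong_def zmod_int)
    then show ?thesis using n by (auto simp: P_def)
  qed
  have inj: "inj_on (\<lambda>i::nat. t [^] i) {..<n}"
    by (rule inj_onI) (simp add: ord' cong_int_iff cong_def)
  then have card_P: "card P = n" by (simp add: P_def card_image)
  have P_sub: "P \<subseteq> carrier G" using t by (auto simp: P_def)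
  have "P \<noteq> carrier G" using card card_P n by auto
  then obtain r0 where r0: "r0 \<in> carrier G" "r0 \<notin> P" using P_sub by blast
  have disj: "t [^] i \<noteq> t [^] j \<otimes> r" if "r \<in> carrier G" "r \<notin> P" for i j :: nat and r
  proof
    assume *: "t [^] i = t [^] j \<otimes> r"
    have "t [^] ((n - 1) * j) \<otimes> t [^] j = \<one>"
    proof -
      have "(n - 1) * j + j = n * j" using n(1) by (simp add: algebra_simps)
      then show ?thesis using t ord[of "n * j"] by (simp add: nat_pow_mult n_def)
    qed
    then have "r = t [^] ((n - 1) * j) \<otimes> (t [^] j \<otimes> r)" using t that by (simp add: m_assoc[symmetric])
    also have "\<dots> = t [^] ((n - 1) * j + i)" unfolding *[symmetric] using t by (simp add: nat_pow_mult)
    finally show False using that P by metis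
  qed
  have gen: "\<exists>i::nat. x = t [^] i \<or> x = t [^] i \<otimes> r" if r: "r \<in> carrier G" "r \<notin> P" and x: "x \<in> carrier G" for r x
  proof -
    let ?R = "(\<lambda>y. y \<otimes> r) ` P"
    have "finite P" using card_P n(1) by (simp add: P_def)
    moreover have "card ?R = n"
    proof -
      have "inj_on (\<lambda>y. y \<otimes> r) P"
        by (rule inj_onI) (use r P_sub in \<open>metis subsetD right_cancel\<close>)
      then show ?thesis by (simp add: card_image card_P)
    qed
    moreover have "P \<inter> ?R = {}" using disj[OF r] by (auto simp: P_def)
    ultimately have "card (P \<union> ?R) = card (carrier G)" by (simp add: card_Un_disjoint card_P card n)
    moreover have "P \<union> ?R \<subseteq> carrier G" using P_sub r by auto
    moreover have "finite (carrier G)" using card n(1) n(2) by (metis card.infinite mult_eq_0_iff not_gr0 zero_neq_numeral)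
    ultimately have "P \<union> ?R = carrier G" by (metis card_subset_eq)
    then show ?thesis using x by (auto simp: P_def)
  qed
  obtain j :: nat where j: "r0 \<otimes> t = t [^] j \<otimes> r0"
  proof -
    obtain i :: nat where "r0 \<otimes> t = t [^] i \<or> r0 \<otimes> t = t [^] i \<otimes> r0" using gen[OF r0, of "r0 \<otimes> t"] r0 t by auto
    moreover have "r0 \<otimes> t \<noteq> t [^] i"
    proof
      assume *: "r0 \<otimes> t = t [^] i"
      have "t \<otimes> t [^] (n - 1) = \<one>"
        using t n(1) ord[of n] nat_pow_mult[of t 1 "n - 1"] by (simp add: n_def)
      then have "r0 = (r0 \<otimes> t) \<otimes> t [^] (n - 1)" using r0 t by (simp add: m_assoc)
      also have "\<dots> = t [^] (i + (n - 1))" unfolding * using t by (simp add: nat_pow_mult)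
      finally show False using r0 P by metis
    qed
    ultimately show thesis using that by blast
  qed
  obtain k :: nat where k: "r0 \<otimes> r0 = t [^] k"
  proof -
    obtain i :: nat where "r0 \<otimes> r0 = t [^] i \<or> r0 \<otimes> r0 = t [^] i \<otimes> r0" using gen[OF r0, of "r0 \<otimes> r0"] r0 by auto
    moreover have "r0 \<otimes> r0 \<noteq> t [^] i \<otimes> r0" using r0 t P by (metis nat_pow_closed right_cancel)
    ultimately show thesis using that by blast
  qed
  note ext = ext_mult_10[OF t r0(1) j k] ext_mult_11[OF t r0(1) j k]
  \<comment> \<open>Conjugating \<open>t\<close> twice by \<open>r0\<close> is conjugating it by a
    power of \<open>t\<close>.\<close>
  have jj: "[int j * int j = 1] (mod 2 ^ (e - 1))"
  proof -
    have "t [^] k \<otimes> t = r0 \<otimes> (r0 \<otimes> t)" using r0 t by (simp add: k[symmetric] m_assoc)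
    also have "\<dots> = t [^] (0::nat) \<otimes> r0 \<otimes> (t [^] j \<otimes> r0)" using r0 t j by simp
    also have "\<dots> = t [^] (j * j + k)" unfolding ext by simp
    finally have "t [^] (k + 1) = t [^] (j * j + k)" using t by simp
    then show ?thesis unfolding ord' n(3)[symmetric] by (simp add: cong_iff_dvd_diff algebra_simps dvd_diff_commute)
  qed
  \<comment> \<open>\<open>r0\<close> commutes with its own square.\<close>
  have jk: "[int j * int k = int k] (mod 2 ^ (e - 1))"
  proof -
    have "t [^] (j * k) \<otimes> r0 = t [^] (0::nat) \<otimes> r0 \<otimes> t [^] k" unfolding ext by simp
    also have "\<dots> = r0 \<otimes> r0 \<otimes> r0" using r0 t by (simp add: k[symmetric] m_assoc)
    also have "\<dots> = t [^] k \<otimes> r0" by (simp add: k)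
    finally have "t [^] (j * k) = t [^] k" using r0 t by simp
    then show ?thesis unfolding ord' n(3)[symmetric] by simp
  qed
  obtain l :: nat and a b where rel: "affine_relations e j (l + j * l + k) a b"
    using exists_affine_relations[OF e jj jk] by blast
  define r where "r = t [^] l \<otimes> r0"
  have r: "r \<in> carrier G" "r \<notin> P" proof -
    show "r \<in> carrier G" using t r0 by (simp add: r_def)
    show "r \<notin> P"
    proof
      assume "r \<in> P"
      then obtain i :: nat where "r = t [^] i" unfolding P_def by (rule imageE)
      then show False using disj[OF r0, of i l] by (simp add: r_def)
    qed
  qed
  have rt: "r \<otimes> t = t [^] j \<otimes> r"
  proof -
    have "r \<otimes> t = t [^] l \<otimes> r0 \<otimes> t [^] (1::nat)" using t by (simp add: r_def)
    also have "\<dots> = t [^] (j + l) \<otimes> r0" unfolding ext by (simp add: add.commute)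
    finally show ?thesis using t r0 by (simp add: r_def nat_pow_mult[symmetric] m_assoc)
  qed
  have rr: "r \<otimes> r = t [^] (l + j * l + k)" unfolding r_def ext ..
  interpret L: affine_rep "hol e" e fst snd using e by (rule affine_rep_hol)
  define t' r' where "t' = (2 mod (2::int) ^ e, a mod 2 ^ e)" and "r' = (1 mod (2::int) ^ e, b mod 2 ^ e)"
  have a4: "a mod 4 = 1" and "odd b" using rel by (auto simp: affine_relations_def)
  then have t': "t' \<in> carrier (hol e)" and r': "r' \<in> carrier (hol e)"
    unfolding t'_def r'_def using e mod4_eq_1_odd[of a] by (auto simp only: intro!: mod_in_carrier_hol)
  have fs: "[fst t' = 2] (mod 2 ^ e)" "[snd t' = a] (mod 2 ^ e)" "[fst r' = 1] (mod 2 ^ e)" "[snd r' = b] (mod 2 ^ e)"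
    by (simp_all add: t'_def r'_def cong_def)
  have st4: "snd t' mod 4 = 1" using cong_power2_mod4[OF fs(2) e] a4 by simp
  have geo_a: "[geo (snd t') i = geo a i] (mod 2 ^ e)" for i
    unfolding geo_def by (intro cong_sum cong_pow fs)
  have X: "[fst (t' [^]\<^bsub>hol e\<^esub> i) = 2 * geo a i] (mod 2 ^ e)" for i :: nat
    using L.X_pow[OF t', of i] cong_mult[OF fs(1) geo_a[of i]] by (rule cong_trans)
  have A: "[snd (t' [^]\<^bsub>hol e\<^esub> i) = a ^ i] (mod 2 ^ e)" for i :: nat
    using L.A_pow[OF t', of i] cong_pow[OF fs(2)] by (rule cong_trans)
  have pow: "t' [^]\<^bsub>hol e\<^esub> i = t' [^]\<^bsub>hol e\<^esub> i'" if "t [^] i = t [^] i'" for i i' :: nat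
  proof (rule hol_eqI)
    have c: "[int i = int i'] (mod 2 ^ (e - 1))" using that by (simp add: ord' n)
    have "2 * 2 ^ (e - 1) dvd 2 * (geo a i - geo a i')"
      using iffD2[OF geo_cong_iff[OF a4] c] unfolding cong_iff_dvd_diff by (intro mult_dvd_mono dvd_refl)
    then have "[2 * geo a i = 2 * geo a i'] (mod 2 ^ e)"
      using L.e_split unfolding cong_iff_dvd_diff right_diff_distrib by metis
    then show "[fst (t' [^]\<^bsub>hol e\<^esub> i) = fst (t' [^]\<^bsub>hol e\<^esub> i')] (mod 2 ^ e)"
      using X by (meson cong_sym cong_trans)
    have "[a ^ i = a ^ i'] (mod 2 ^ e)" using power_cong[OF a4 c] e by (cases e) simp_all
    then show "[snd (t' [^]\<^bsub>hol e\<^esub> i) = snd (t' [^]\<^bsub>hol e\<^esub> i')] (mod 2 ^ e)"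
      using A by (meson cong_sym cong_trans)
  qed (use t' in simp_all)
  have rt': "r' \<otimes>\<^bsub>hol e\<^esub> t' = t' [^]\<^bsub>hol e\<^esub> j \<otimes>\<^bsub>hol e\<^esub> r'"
  proof (rule hol_eqI)
    have *: "[2 * geo a j + a ^ j * 1 = 1 + b * 2] (mod 2 ^ e)" "[a ^ j * b = b * a] (mod 2 ^ e)"
      using rel cong_mult[of "a ^ j" a "2 ^ e" b b] by (auto simp: affine_relations_def mult.commute)
    have "[fst (r' \<otimes>\<^bsub>hol e\<^esub> t') = 1 + b * 2] (mod 2 ^ e)"
      using L.X_mult[OF r' t'] by (rule cong_trans) (intro cong_add cong_mult fs)
    moreover have "[fst (t' [^]\<^bsub>hol e\<^esub> j \<otimes>\<^bsub>hol e\<^esub> r') = 2 * geo a j + a ^ j * 1] (mod 2 ^ e)"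
      using L.X_mult[of "t' [^]\<^bsub>hol e\<^esub> j" r'] t' r' X[of j] A[of j] fs(3)
      by (meson L.nat_pow_closed cong_add cong_mult cong_trans)
    ultimately show "[fst (r' \<otimes>\<^bsub>hol e\<^esub> t') = fst (t' [^]\<^bsub>hol e\<^esub> j \<otimes>\<^bsub>hol e\<^esub> r')] (mod 2 ^ e)"
      using *(1) by (meson cong_sym cong_trans)
    have "[snd (r' \<otimes>\<^bsub>hol e\<^esub> t') = b * a] (mod 2 ^ e)"
      using L.A_mult[OF r' t'] by (rule cong_trans) (intro cong_mult fs)
    moreover have "[snd (t' [^]\<^bsub>hol e\<^esub> j \<otimes>\<^bsub>hol e\<^esub> r') = a ^ j * b] (mod 2 ^ e)"
      using L.A_mult[of "t' [^]\<^bsub>hol e\<^esub> j" r'] t' r' A[of j] fs(4)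
      by (meson L.nat_pow_closed cong_mult cong_trans)
    ultimately show "[snd (r' \<otimes>\<^bsub>hol e\<^esub> t') = snd (t' [^]\<^bsub>hol e\<^esub> j \<otimes>\<^bsub>hol e\<^esub> r')] (mod 2 ^ e)"
      using *(2) by (meson cong_sym cong_trans)
  qed (use t' r' in simp_all)
  have rr': "r' \<otimes>\<^bsub>hol e\<^esub> r' = t' [^]\<^bsub>hol e\<^esub> (l + j * l + k)"
  proof (rule hol_eqI)
    have *: "[2 * geo a (l + j * l + k) = 1 + b * 1] (mod 2 ^ e)" "[a ^ (l + j * l + k) = b * b] (mod 2 ^ e)"
      using rel by (auto simp: affine_relations_def)
    have "[fst (r' \<otimes>\<^bsub>hol e\<^esub> r') = 1 + b * 1] (mod 2 ^ e)"
      using L.X_mult[OF r' r'] by (rule cong_trans) (intro cong_add cong_mult fs)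
    then show "[fst (r' \<otimes>\<^bsub>hol e\<^esub> r') = fst (t' [^]\<^bsub>hol e\<^esub> (l + j * l + k))] (mod 2 ^ e)"
      using *(1) X by (meson cong_sym cong_trans)
    have "[snd (r' \<otimes>\<^bsub>hol e\<^esub> r') = b * b] (mod 2 ^ e)"
      using L.A_mult[OF r' r'] by (rule cong_trans) (intro cong_mult fs)
    then show "[snd (r' \<otimes>\<^bsub>hol e\<^esub> r') = snd (t' [^]\<^bsub>hol e\<^esub> (l + j * l + k))] (mod 2 ^ e)"
      using *(2) A by (meson cong_sym cong_trans)
  qed (use t' r' in simp_all)
  obtain F where F: "F \<in> hom G (hol e)"
    "\<And>i::nat. F (t [^] i) = t' [^]\<^bsub>hol e\<^esub> i" "\<And>i::nat. F (t [^] i \<otimes> r) = t' [^]\<^bsub>hol e\<^esub> i \<otimes>\<^bsub>hol e\<^esub> r'"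
    using ex_hom_cyclic_extension[OF L.group_axioms t r(1) rt rr gen[OF r] disj[OF r] t' r' rt' rr' pow] by blast
  have "affine_rep G e (\<lambda>x. fst (F x)) (\<lambda>x. snd (F x))"
    using e group_axioms F(1) by (rule affine_rep_hom)
  moreover have "[fst (F x) = 0] (mod 2 ^ e) \<longleftrightarrow> x = \<one>" if xc: "x \<in> carrier G" for x
  proof -
    obtain i :: nat where "x = t [^] i \<or> x = t [^] i \<otimes> r" using gen[OF r xc] by blast
    then show ?thesis
    proof
      assume x: "x = t [^] i"
      have "[fst (F x) = 0] (mod 2 ^ e) \<longleftrightarrow> 2 ^ e dvd 2 * geo a i"
        using X[of i] by (simp add: x F cong_0_iff cong_dvd_iff)
      also have "\<dots> \<longleftrightarrow> 2 ^ e dvd 2 * int i" by (rule pow2_dvd_mult_geo_iff[OF a4])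
      also have "\<dots> \<longleftrightarrow> (2::int) ^ (e - 1) dvd int i" using e by (cases e) simp_all
      also have "\<dots> \<longleftrightarrow> int (2 ^ (e - 1)) dvd int i" by simp
      also have "\<dots> \<longleftrightarrow> x = \<one>" unfolding of_nat_dvd_iff x ord ..
      finally show ?thesis .
    next
      assume x: "x = t [^] i \<otimes> r"
      have "even (fst (t' [^]\<^bsub>hol e\<^esub> i))" using cong_power2_even[OF X[of i]] e by simp
      moreover have "odd (fst r')" using cong_power2_even[OF fs(3)] e by simp
      ultimately have "odd (fst (F x))"
        using L.X_mult_even[of "t' [^]\<^bsub>hol e\<^esub> i" r'] t' r' by (simp add: x F)
      then have "\<not> [fst (F x) = 0] (mod 2 ^ e)" using cong_power2_even[of "fst (F x)" 0 e] e by auto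
      moreover have "x \<noteq> \<one>" using disj[OF r, of 0 i] by (simp add: x)
      ultimately show ?thesis by blast
    qed
  qed
  ultimately show ?thesis by blast
qed

end

section \<open>Representations with normal kernel and twists\<close>

text \<open>Surjectivity of \<open>c\<close> is recovered from the index of \<open>H\<close> in
  \<open>affine_rep_transitive\<close>, and the kernel turns out to be the core of \<open>H\<close>;
  so the stabiliser is the only thing to prescribe.\<close>

definition has_affine_rep :: "('a, 'b) monoid_scheme \<Rightarrow> nat \<Rightarrow> 'a set \<Rightarrow> bool" where
  "has_affine_rep G e H \<longleftrightarrow>
    (\<exists>c \<alpha>. affine_rep G e c \<alpha> \<and> (\<forall>x\<in>carrier G. [c x = 0] (mod 2 ^ e) \<longleftrightarrow> x \<in> H))"

context faithful_affine_rep
begin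

text \<open>The quotient by \<open>H\<close> has order \<open>2 ^ e\<close>, and the regular
  \<open>g\<close> has order exactly \<open>2 ^ (e - 1)\<close> in it, because of the size of the
  translations in \<open>H\<close>. The regular action of the quotient is pulled back to
  \<open>G\<close>.\<close>

lemma has_affine_rep_normal:
  assumes H: "H \<lhd> G" and card: "card (rcosets H) = 2 ^ e"
    and g: "g \<in> carrier G" "odd (X g)" "A g mod 4 = 1"
    and zin: "\<And>x. \<lbrakk>x \<in> carrier G; [A x = 1] (mod 2 ^ e); 2 ^ (e - 1) dvd X x\<rbrakk> \<Longrightarrow> x \<in> H"
    and zout: "\<And>x. \<lbrakk>x \<in> H; [A x = 1] (mod 2 ^ e)\<rbrakk> \<Longrightarrow> 2 ^ (e - 1) dvd X x"
  shows "has_affine_rep G e H"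
proof -
  interpret H: normal H G by fact
  interpret Q: group "G Mod H" by (rule H.factorgroup_is_group)
  interpret q: group_hom G "G Mod H" "\<lambda>x. H #> x"
    by unfold_locales (rule H.r_coset_hom_Mod)
  have one_iff: "H #> x = \<one>\<^bsub>G Mod H\<^esub> \<longleftrightarrow> x \<in> H" if "x \<in> carrier G" for x
    using that coset_join1[OF _ that H.subgroup_axioms] coset_join2[OF that H.subgroup_axioms]
    by (auto simp: FactGroup_def)
  have pow_H: "x [^] (i::nat) \<in> H" if "x \<in> H" for x i
    using that by (rule H.nat_pow_in_subgroup)
  have ord: "g [^] i \<in> H \<longleftrightarrow> 2 ^ (e - 1) dvd i" for i :: nat
  proof
    assume "2 ^ (e - 1) dvd i"
    then obtain l where "i = 2 ^ (e - 1) * l" by blast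
    then have "g [^] i = (g [^] (2 ^ (e - 1) :: nat)) [^] l" using g(1) by (simp add: nat_pow_pow)
    moreover have "g [^] (2 ^ (e - 1) :: nat) \<in> H"
      by (rule zin) (use g(1) A_pow_half X_pow_half in simp_all)
    ultimately show "g [^] i \<in> H" using pow_H by simp
  next
    assume gi: "g [^] i \<in> H"
    show "2 ^ (e - 1) dvd i"
    proof (rule ccontr)
      assume not_dvd: "\<not> 2 ^ (e - 1) dvd i"
      then have "i \<noteq> 0" by (metis dvd_0_right)
      then obtain r s where i: "i = 2 ^ r * s" "odd s" by (rule two_adic_nat)
      have "r \<le> e - 2"
      proof (rule ccontr)
        assume "\<not> r \<le> e - 2"
        then have "(2::nat) ^ (e - 1) dvd 2 ^ r" by (intro le_imp_power_dvd) simp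
        then show False using not_dvd i by simp
      qed
      \<comment> \<open>This multiple of \<open>i\<close> turns \<open>g [^] i\<close> into a
        translation by an odd multiple of \<open>2 ^ (e - 2)\<close>, which \<open>zout\<close>
        keeps out of \<open>H\<close>.\<close>
      define k :: nat where "k = 2 ^ (e - 2) * s"
      have eq: "(2::nat) ^ (e - 2) = 2 ^ r * 2 ^ (e - 2 - r)"
        by (simp only: power_add[symmetric] le_add_diff_inverse[OF \<open>r \<le> e - 2\<close>])
      have k: "k = i * 2 ^ (e - 2 - r)" by (simp only: k_def i(1) eq mult_ac)
      have gk: "g [^] k \<in> H" unfolding k using gi g(1) pow_H by (simp add: nat_pow_pow[symmetric])
      have "[A (g [^] (2 ^ (e - 2) :: nat)) = 1] (mod 2 ^ e)"
        by (rule A_pow_pow2[OF g(1) g(3) mod4_eq_1_dvd[OF g(3)]]) (use e_ge_2 in simp)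
      then have "[A (g [^] (2 ^ (e - 2) :: nat)) ^ s = 1 ^ s] (mod 2 ^ e)" by (rule cong_pow)
      then have "[A (g [^] k) = 1] (mod 2 ^ e)"
        using A_pow[of "g [^] (2 ^ (e - 2) :: nat)" s] g(1)
        by (simp add: k_def nat_pow_pow cong_def)
      then have "2 ^ (e - 1) dvd X (g [^] k)" using zout gk by blast
      then have "2 ^ (e - 1) dvd X g * int k"
        using X_pow_dvd_iff[OF g(1,3), of "e - 1" k] by simp
      then have "2 ^ (e - 1) dvd (X g * int s) * 2 ^ (e - 2)" by (simp add: k_def mult_ac)
      moreover have "(2::int) ^ (e - 1) = 2 * 2 ^ (e - 2)" using e_split by blast
      ultimately have "2 * 2 ^ (e - 2) dvd (X g * int s) * 2 ^ (e - 2)" by (simp only:)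
      then have "even (X g * int s)" by simp
      then show False using g(2) i(2) by simp
    qed
  qed
  have cQ: "card (carrier (G Mod H)) = 2 ^ e" using card by (simp add: FactGroup_def)
  have tQ: "H #> g \<in> carrier (G Mod H)" using g(1) q.hom_closed by blast
  have oQ: "(H #> g) [^]\<^bsub>G Mod H\<^esub> (i::nat) = \<one>\<^bsub>G Mod H\<^esub> \<longleftrightarrow> 2 ^ (e - 1) dvd i" for i
    using q.hom_nat_pow[OF g(1), of i] one_iff[of "g [^] i"] g(1) ord[of i] by simp
  obtain c \<alpha> where R: "affine_rep (G Mod H) e c \<alpha>"
    and zero: "\<And>x. x \<in> carrier (G Mod H) \<Longrightarrow> [c x = 0] (mod 2 ^ e) \<longleftrightarrow> x = \<one>\<^bsub>G Mod H\<^esub>"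
    using Q.affine_rep_of_index_2_cyclic[OF e_ge_2 cQ tQ oQ] by blast
  interpret R: affine_rep "G Mod H" e c \<alpha> by fact
  have "affine_rep G e (\<lambda>x. c (H #> x)) (\<lambda>x. \<alpha> (H #> x))"
  proof unfold_locales
    fix x y assume x: "x \<in> carrier G" and y: "y \<in> carrier G"
    note closed = q.hom_closed[OF x] q.hom_closed[OF y]
    show "[c (H #> (x \<otimes> y)) = c (H #> x) + \<alpha> (H #> x) * c (H #> y)] (mod 2 ^ e)"
      "[\<alpha> (H #> (x \<otimes> y)) = \<alpha> (H #> x) * \<alpha> (H #> y)] (mod 2 ^ e)"
      unfolding q.hom_mult[OF x y] using R.X_mult[OF closed] R.A_mult[OF closed] by simp_all
  next
    fix x assume "x \<in> carrier G"
    then show "odd (\<alpha> (H #> x))" using R.A_odd q.hom_closed by blast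
  qed (rule e_ge_2)
  moreover have "[c (H #> x) = 0] (mod 2 ^ e) \<longleftrightarrow> x \<in> H" if "x \<in> carrier G" for x
    using zero[OF q.hom_closed[OF that]] one_iff[OF that] by simp
  ultimately show ?thesis unfolding has_affine_rep_def by blast
qed

text \<open>Moves the base point from 0 to \<open>w\<close>: the new translation part is the image
  of \<open>w\<close> under \<open>x\<close> minus \<open>w\<close>.\<close>

lemma translate: "faithful_affine_rep G e (\<lambda>x. X x + (A x - 1) * w) A"
proof unfold_locales
  fix x y assume xy: "x \<in> carrier G" "y \<in> carrier G"
  show "[X (x \<otimes> y) + (A (x \<otimes> y) - 1) * w =
      X x + (A x - 1) * w + A x * (X y + (A y - 1) * w)] (mod 2 ^ e)"
    using X_mult[OF xy] A_mult[OF xy] unfolding fold_cong by Groebner_Basis.algebra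
  show "[A (x \<otimes> y) = A x * A y] (mod 2 ^ e)" by (rule A_mult[OF xy])
next
  fix v
  obtain y where y: "y \<in> carrier G" "[X y = w] (mod 2 ^ e)" using X_surj by blast
  obtain z where z: "z \<in> carrier G" "[X z = v + w] (mod 2 ^ e)" using X_surj by blast
  have "z \<otimes> inv y \<otimes> y = z" using y z by (simp add: m_assoc)
  then have "[X z = X (z \<otimes> inv y) + A (z \<otimes> inv y) * X y] (mod 2 ^ e)"
    using X_mult[of "z \<otimes> inv y" y] y z by simp
  then have "[X (z \<otimes> inv y) + (A (z \<otimes> inv y) - 1) * w = v] (mod 2 ^ e)"
    using y(2) z(2) unfolding fold_cong by Groebner_Basis.algebra
  then show "\<exists>x\<in>carrier G. [X x + (A x - 1) * w = v] (mod 2 ^ e)" using y z by blast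
next
  fix x assume x: "x \<in> carrier G" "[X x + (A x - 1) * w = 0] (mod 2 ^ e)" "[A x = 1] (mod 2 ^ e)"
  then have "[X x = 0] (mod 2 ^ e)" unfolding fold_cong by Groebner_Basis.algebra
  then show "x = \<one>" using x faithful by blast
qed (use A_odd e_ge_2 finite_carrier in auto)

text \<open>\<open>A\<close> is injective on \<open>K\<close>, and the slopes 1 modulo 4 form a
  cyclic group; so \<open>K\<close> is generated by an element \<open>k0\<close> with
  \<open>A k0 - 1\<close> of least valuation \<open>s\<close>. The order of \<open>k0\<close> forces
  \<open>2 ^ s dvd X k0\<close>, which makes the fixed point equation of \<open>k0\<close>
  solvable.\<close>

lemma common_fixed_point:
  assumes K: "subgroup K G" and K4: "\<And>k. k \<in> K \<Longrightarrow> A k mod 4 = 1"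
    and KN: "\<And>k. \<lbrakk>k \<in> K; [A k = 1] (mod 2 ^ e)\<rbrakk> \<Longrightarrow> k = \<one>"
  shows "\<exists>w. \<forall>k\<in>K. [X k + (A k - 1) * w = 0] (mod 2 ^ e)"
proof (cases "\<forall>k\<in>K. [A k = 1] (mod 2 ^ e)")
  case True
  then have "\<forall>k\<in>K. [X k + (A k - 1) * 0 = 0] (mod 2 ^ e)" using KN X_one by auto
  then show ?thesis by blast
next
  case False
  have Kc: "k \<in> carrier G" if "k \<in> K" for k using K that by (rule subgroup.mem_carrier)
  have pow_K: "k [^] (n::nat) \<in> K" if "k \<in> K" for k n
    using K that by (rule subgroup.nat_pow_in_subgroup)
  have val: "\<exists>s t. odd t \<and> A k - 1 = 2 ^ s * t" if "\<not> [A k = 1] (mod 2 ^ e)" for k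
  proof -
    have "A k - 1 \<noteq> 0" using that by auto
    then show ?thesis by (metis two_adic_int)
  qed
  define P where "P s \<longleftrightarrow> (\<exists>k\<in>K. \<exists>t. \<not> [A k = 1] (mod 2 ^ e) \<and> odd t \<and> A k - 1 = 2 ^ s * t)" for s
  define s where "s = (LEAST s. P s)"
  obtain k where "k \<in> K" "\<not> [A k = 1] (mod 2 ^ e)" using False by blast
  then have "\<exists>s. P s" using val[of k] unfolding P_def by blast
  then have "P s" unfolding s_def by (rule LeastI_ex)
  then obtain k0 t where k0: "k0 \<in> K" "\<not> [A k0 = 1] (mod 2 ^ e)" "odd t" "A k0 - 1 = 2 ^ s * t"
    unfolding P_def by blast
  have "s < e" using k0 pow2_not_dvd_less[of e s t] by (simp add: cong_iff_dvd_diff)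
  have min: "2 ^ s dvd A k - 1" if "k \<in> K" for k
  proof (cases "[A k = 1] (mod 2 ^ e)")
    case True
    then show ?thesis using \<open>s < e\<close> unfolding cong_iff_dvd_diff
      by (meson dvd_trans le_imp_power_dvd less_imp_le)
  next
    case False
    then obtain s' t' where s': "odd t'" "A k - 1 = 2 ^ s' * t'" using val by blast
    then have "P s'" using False that unfolding P_def by blast
    then have "s \<le> s'" unfolding s_def by (rule Least_le)
    then show ?thesis using s' by (simp add: le_imp_power_dvd)
  qed
  note k0c = Kc[OF k0(1)] and k04 = K4[OF k0(1)]
  have "2 ^ s dvd X k0"
  proof -
    let ?p = "k0 [^] (2 ^ (e - s) :: nat)"
    have "[A ?p = 1] (mod 2 ^ e)" by (rule A_pow_pow2[OF k0c k04, of s]) (use k0(4) in simp_all)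
    then have "?p = \<one>" using KN pow_K k0(1) by blast
    then have "2 ^ e dvd X ?p" using X_one by (simp add: cong_0_iff)
    then have "2 ^ e dvd X k0 * int (2 ^ (e - s))" using X_pow_dvd_iff[OF k0c k04] by blast
    moreover have "(2::int) ^ e = 2 ^ s * 2 ^ (e - s)" using \<open>s < e\<close> by (simp add: power_add[symmetric])
    ultimately show ?thesis by simp
  qed
  then obtain v where v: "X k0 = 2 ^ s * v" by blast
  have "coprime t (2 ^ e)" using k0(3) by simp
  then obtain y where y: "[t * y = 1] (mod 2 ^ e)" using cong_solve_coprime_int by blast
  show ?thesis
  proof (intro exI ballI)
    fix k assume k: "k \<in> K"
    obtain r where r: "A k - 1 = 2 ^ s * r" using min[OF k] by blast
    \<comment> \<open>Chosen so that \<open>k0 [^] i\<close> has the slope of \<open>k\<close>; by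
      injectivity of \<open>A\<close> on \<open>K\<close> the two elements are then equal.\<close>
    obtain i where i: "[geo (A k0) i = y * r] (mod 2 ^ e)" using geo_surj[OF k04] by blast
    have "[A k0 ^ i = A k] (mod 2 ^ e)"
    proof -
      have "[A k0 ^ i - 1 = 2 ^ s * t * (y * r)] (mod 2 ^ e)"
        unfolding geo_diff[symmetric] k0(4) using i by (rule cong_mult[OF cong_refl])
      also have "2 ^ s * t * (y * r) = (2 ^ s * r) * (t * y)" by (simp add: mult_ac)
      also have "[(2 ^ s * r) * (t * y) = (2 ^ s * r) * 1] (mod 2 ^ e)" using y by (rule cong_mult[OF cong_refl])
      finally show ?thesis unfolding mult_1_right r[symmetric] by (simp add: cong_iff_dvd_diff)
    qed
    then have A_eq: "[A (k0 [^] i) = A k] (mod 2 ^ e)" using A_pow[OF k0c] cong_trans by blast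
    have "inv (k0 [^] i) \<otimes> k \<in> K"
      using K pow_K[OF k0(1)] k by (simp add: subgroup.m_closed subgroup.m_inv_closed)
    then have "inv (k0 [^] i) \<otimes> k = \<one>" using KN A_inv_mult_1[OF _ Kc[OF k] A_eq] k0c by simp
    then have "k = k0 [^] i" using k0c Kc[OF k] by (metis inv_equality inv_inv nat_pow_closed inv_closed)
    then have "[X k = 2 ^ s * v * geo (A k0) i] (mod 2 ^ e)" using X_pow[OF k0c, of i] v by simp
    also have "[2 ^ s * v * geo (A k0) i = 2 ^ s * v * (y * r)] (mod 2 ^ e)"
      using i by (rule cong_mult[OF cong_refl])
    finally have "[X k + (A k - 1) * (- (y * v)) = 2 ^ s * v * (y * r) + 2 ^ s * r * (- (y * v))] (mod 2 ^ e)"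
      unfolding r by (rule cong_add) simp
    then show "[X k + (A k - 1) * (- (y * v)) = 0] (mod 2 ^ e)" by (simp add: algebra_simps)
  qed
qed

end

section \<open>Twisted representations\<close>

context affine_rep
begin

definition \<nu> :: "'a \<Rightarrow> int" where
  "\<nu> x = (if A x mod 4 = 1 then 0 else 1)"

lemma \<nu>_mult:
  assumes "x \<in> carrier G" "y \<in> carrier G"
  shows "\<nu> (x \<otimes> y) = (if \<nu> x = \<nu> y then 0 else 1)"
  using A_mult_mod4_eq_1[OF assms] by (auto simp: \<nu>_def)

text \<open>The twisted cocycle vanishes where \<open>X = 0\<close> and \<open>A \<equiv> 1\<close>, or \<open>X = u\<close> and \<open>A \<equiv> 3\<close> mod 4: it
  moves into the stabiliser of 0 those elements with \<open>A \<equiv> 3\<close> that used to send 0 to \<open>u\<close>.\<close>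

lemma affine_rep_twist:
  assumes 1: "\<And>x. \<lbrakk>x \<in> carrier G; A x mod 4 = 1\<rbrakk> \<Longrightarrow> [u * (A x - 1) = 2 ^ (e - 1) * \<kappa> * X x] (mod 2 ^ e)"
    and 3: "\<And>x. \<lbrakk>x \<in> carrier G; A x mod 4 = 3\<rbrakk> \<Longrightarrow> [u * (A x + 1) = 2 ^ (e - 1) * \<kappa> * (X x + u)] (mod 2 ^ e)"
  shows "affine_rep G e (\<lambda>x. (X x - u * \<nu> x) * (1 + 2 ^ (e - 1) * \<kappa> * \<nu> x))
    (\<lambda>x. A x * (1 + 2 ^ (e - 1) * \<kappa> * \<nu> x))"
proof unfold_locales
  define q where "q = 2 ^ (e - 1) * \<kappa>"
  have e1: "(2::int) ^ e = 2 * 2 ^ (e - 1)" and e2: "(2::int) ^ (e - 1) = 2 * 2 ^ (e - 2)"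
    using e_split by blast+
  \<comment> \<open>\<open>q\<close> acts like an infinitesimal: modulo \<open>2 ^ e\<close> both
    \<open>2 * q\<close> and \<open>q * q\<close> vanish, so \<open>1 + q\<close> is its own inverse
    and signs next to \<open>q\<close> are irrelevant.\<close>
  have q2: "[2 * q = 0] (mod 2 ^ e)" unfolding e1 by (simp add: q_def cong_0_iff)
  have qq: "[q * q = 0] (mod 2 ^ e)"
  proof -
    have qe: "q = 2 * (2 ^ (e - 2) * \<kappa>)" unfolding q_def e2 by (simp only: mult.assoc)
    have "[(2 * q) * (2 ^ (e - 2) * \<kappa>) = 0 * (2 ^ (e - 2) * \<kappa>)] (mod 2 ^ e)"
      using q2 by (rule cong_mult[OF _ cong_refl])
    moreover have "(2 * q) * (2 ^ (e - 2) * \<kappa>) = q * (2 * (2 ^ (e - 2) * \<kappa>))" by simp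
    ultimately show ?thesis unfolding qe[symmetric] by simp
  qed
  fix x y assume xy: "x \<in> carrier G" "y \<in> carrier G"
  obtain a where a: "A x = 2 * a + 1" using A_odd[OF xy(1)] by (rule oddE)
  have 1: "[u * (A x - 1) = q * X x] (mod 2 ^ e)" if "\<nu> x = 0"
    using 1[OF xy(1)] that by (simp add: \<nu>_def q_def split: if_splits)
  have 3: "[u * (A x + 1) = q * (X x + u)] (mod 2 ^ e)" if "\<nu> x = 1"
    using 3[OF xy(1)] A_mod4[OF xy(1)] that by (auto simp: \<nu>_def q_def split: if_splits)
  note mults = X_mult[OF xy] A_mult[OF xy]
  have \<nu>01: "\<nu> z = 0 \<or> \<nu> z = 1" for z by (simp add: \<nu>_def)
  have "[(X (x \<otimes> y) - u * \<nu> (x \<otimes> y)) * (1 + q * \<nu> (x \<otimes> y)) =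
      (X x - u * \<nu> x) * (1 + q * \<nu> x) + A x * (1 + q * \<nu> x) * ((X y - u * \<nu> y) * (1 + q * \<nu> y))] (mod 2 ^ e) \<and>
    [A (x \<otimes> y) * (1 + q * \<nu> (x \<otimes> y)) = A x * (1 + q * \<nu> x) * (A y * (1 + q * \<nu> y))] (mod 2 ^ e)"
  proof (cases "\<nu> x = 0"; cases "\<nu> y = 0")
    assume n: "\<nu> x = 0" "\<nu> y = 0"
    then show ?thesis using mults by (simp add: \<nu>_mult[OF xy])
  next
    assume n: "\<nu> x = 0" "\<nu> y \<noteq> 0"
    then have y1: "\<nu> y = 1" using \<nu>01[of y] by simp
    have "[(X (x \<otimes> y) - u) * (1 + q) = X x + A x * ((X y - u) * (1 + q))] (mod 2 ^ e)"
    proof -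
      have "(X (x \<otimes> y) - u) * (1 + q) - (X x + A x * ((X y - u) * (1 + q))) =
          (X (x \<otimes> y) - (X x + A x * X y)) * (1 + q) + (u * (A x - 1) - q * X x) + 2 * q * (X x + a * u)"
        unfolding a by (simp add: algebra_simps)
      moreover have "2 ^ e dvd \<dots>"
        using mults(1) 1[OF n(1)] q2 unfolding cong_iff_dvd_diff diff_zero
        by (blast intro: dvd_add dvd_mult2)
      ultimately show ?thesis by (simp only: cong_iff_dvd_diff)
    qed
    moreover have "[A (x \<otimes> y) * (1 + q) = A x * (A y * (1 + q))] (mod 2 ^ e)"
      using mults(2) unfolding fold_cong by Groebner_Basis.algebra
    ultimately show ?thesis by (simp add: \<nu>_mult[OF xy] n(1) y1)
  next
    assume n: "\<nu> x \<noteq> 0" "\<nu> y = 0"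
    then have x1: "\<nu> x = 1" using \<nu>01[of x] by simp
    have "[(X (x \<otimes> y) - u) * (1 + q) = (X x - u) * (1 + q) + A x * (1 + q) * X y] (mod 2 ^ e)"
      using mults(1) unfolding fold_cong by Groebner_Basis.algebra
    moreover have "[A (x \<otimes> y) * (1 + q) = A x * (1 + q) * A y] (mod 2 ^ e)"
      using mults(2) unfolding fold_cong by Groebner_Basis.algebra
    ultimately show ?thesis by (simp add: \<nu>_mult[OF xy] n(2) x1)
  next
    assume n: "\<nu> x \<noteq> 0" "\<nu> y \<noteq> 0"
    then have x1: "\<nu> x = 1" and y1: "\<nu> y = 1" using \<nu>01[of x] \<nu>01[of y] by simp_all
    have "[X (x \<otimes> y) = (X x - u) * (1 + q) + A x * (1 + q) * ((X y - u) * (1 + q))] (mod 2 ^ e)"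
    proof -
      have "X (x \<otimes> y) - ((X x - u) * (1 + q) + A x * (1 + q) * ((X y - u) * (1 + q))) =
          (X (x \<otimes> y) - (X x + A x * X y)) + (u * (A x + 1) - q * (X x + u))
            + 2 * q * (u - A x * (X y - u)) + q * q * (A x * (u - X y))"
        by (simp add: algebra_simps)
      moreover have "2 ^ e dvd \<dots>"
        using mults(1) 3[OF x1] q2 qq unfolding cong_iff_dvd_diff diff_zero
        by (blast intro: dvd_add dvd_mult2)
      ultimately show ?thesis by (simp only: cong_iff_dvd_diff)
    qed
    moreover have "[A (x \<otimes> y) = A x * (1 + q) * (A y * (1 + q))] (mod 2 ^ e)"
    proof -
      have "A (x \<otimes> y) - A x * (1 + q) * (A y * (1 + q)) =
          (A (x \<otimes> y) - A x * A y) + 2 * q * (- (A x * A y)) + q * q * (- (A x * A y))"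
        by (simp add: algebra_simps)
      moreover have "2 ^ e dvd \<dots>"
        using mults(2) q2 qq unfolding cong_iff_dvd_diff diff_zero
        by (blast intro: dvd_add dvd_mult2)
      ultimately show ?thesis by (simp only: cong_iff_dvd_diff)
    qed
    ultimately show ?thesis by (simp add: \<nu>_mult[OF xy] x1 y1)
  qed
  then show "[(X (x \<otimes> y) - u * \<nu> (x \<otimes> y)) * (1 + 2 ^ (e - 1) * \<kappa> * \<nu> (x \<otimes> y)) =
      (X x - u * \<nu> x) * (1 + 2 ^ (e - 1) * \<kappa> * \<nu> x) +
      A x * (1 + 2 ^ (e - 1) * \<kappa> * \<nu> x) * ((X y - u * \<nu> y) * (1 + 2 ^ (e - 1) * \<kappa> * \<nu> y))] (mod 2 ^ e)"
    "[A (x \<otimes> y) * (1 + 2 ^ (e - 1) * \<kappa> * \<nu> (x \<otimes> y)) =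
      A x * (1 + 2 ^ (e - 1) * \<kappa> * \<nu> x) * (A y * (1 + 2 ^ (e - 1) * \<kappa> * \<nu> y))] (mod 2 ^ e)"
    by (simp_all add: q_def)
next
  fix x assume "x \<in> carrier G"
  moreover have "even ((2::int) ^ (e - 1))" using e_ge_2 by simp
  ultimately show "odd (A x * (1 + 2 ^ (e - 1) * \<kappa> * \<nu> x))" using A_odd by simp
qed (rule e_ge_2)

end

lemma pow2_dvd_cong_half:
  fixes w :: int
  assumes "1 \<le> k" "2 ^ (k - 1) dvd w" "\<not> 2 ^ k dvd w"
  shows "[w = 2 ^ (k - 1)] (mod 2 ^ k)"
proof -
  obtain v where v: "w = 2 ^ (k - 1) * v" using assms(2) by blast
  have "odd v" using assms(3) pow2_dvd_mult_half_iff[OF assms(1), of v] by (simp add: v mult.commute)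
  then have "2 ^ k dvd (v - 1) * 2 ^ (k - 1)" unfolding pow2_dvd_mult_half_iff[OF assms(1)] by simp
  then show ?thesis by (simp add: v cong_iff_dvd_diff algebra_simps)
qed

context affine_rep
begin

lemma \<nu>_01: "\<nu> x \<in> {0, 1}"
  by (simp add: \<nu>_def)

text \<open>This twist turns the reflection with \<open>X = u\<close> and \<open>A = -1\<close> into the linear map of slope
  \<open>1 + 2 ^ (e - 1)\<close>.\<close>

lemma affine_rep_twist':
  assumes e3: "3 \<le> e" and u: "odd u"
    and D: "\<And>x. x \<in> carrier G \<Longrightarrow> 2 ^ (e - 1) dvd 2 * X x - u * (1 - A x)"
    and parity: "\<And>x. x \<in> carrier G \<Longrightarrow> odd (X x) \<longleftrightarrow> A x mod 4 = 3"
  defines "\<iota> \<equiv> \<lambda>x. if [2 * X x = u * (1 - A x)] (mod 2 ^ e) then 0 else 1 :: int"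
  defines "j \<equiv> \<lambda>x. if \<nu> x = \<iota> x then 0 else 1 :: int"
  shows "affine_rep G e (\<lambda>x. X x + u * j x * A x - 2 ^ (e - 2) * u * \<iota> x)
    (\<lambda>x. if j x = 0 then A x else A x * (2 ^ (e - 1) - 1))"
proof unfold_locales
  \<comment> \<open>The quantity in \<open>D\<close> is, up to a unit, the commutator of
    \<open>x\<close> with the reflection \<open>v \<mapsto> u - v\<close>; \<open>\<iota> x\<close>
    records whether it is 0 or \<open>2 ^ (e - 1)\<close>, and \<open>j\<close> is the sum of
    \<open>\<nu>\<close> and \<open>\<iota>\<close> modulo 2.\<close>
  define r :: int where "r = 2 ^ (e - 2)"
  have m: "(2::int) ^ e = 4 * r" and q: "(2::int) ^ (e - 1) = 2 * r"
    using e_split unfolding r_def by blast+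
  obtain r' where r': "r = 2 * r'"
  proof
    have "e - 2 = Suc (e - 3)" using e3 by simp
    then show "r = 2 * 2 ^ (e - 3)" by (simp add: r_def)
  qed
  have "r \<noteq> 0" by (simp add: r_def)
  have \<iota>_01: "\<iota> z \<in> {0, 1}" for z by (simp add: \<iota>_def)
  have Dz: "\<exists>z. 2 * X x - u * (1 - A x) = 2 * r * \<iota> x + 4 * r * z" if "x \<in> carrier G" for x
  proof (cases "[2 * X x = u * (1 - A x)] (mod 2 ^ e)")
    case True
    then show ?thesis by (auto simp: \<iota>_def cong_iff_dvd_diff m)
  next
    case False
    then have "[2 * X x - u * (1 - A x) = 2 ^ (e - 1)] (mod 2 ^ e)"
      using e3 D[OF that] by (intro pow2_dvd_cong_half) (simp_all add: cong_iff_dvd_diff)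
    then obtain z where "2 * X x - u * (1 - A x) = 2 * r + 4 * r * z"
      unfolding m q by (metis cong_iff_lin cong_sym)
    moreover have "\<iota> x = 1" using False by (simp add: \<iota>_def)
    ultimately show ?thesis by auto
  qed
  fix x y assume xy: "x \<in> carrier G" "y \<in> carrier G"
  obtain k1 where k1: "X (x \<otimes> y) = X x + A x * X y + 4 * r * k1"
    using X_mult[OF xy] unfolding m by (metis cong_iff_lin cong_sym)
  obtain k2 where k2: "A (x \<otimes> y) = A x * A y + 4 * r * k2"
    using A_mult[OF xy] unfolding m by (metis cong_iff_lin cong_sym)
  obtain d where d: "2 * X x - u * (1 - A x) = 2 * r * \<iota> x + 4 * r * d" using Dz[OF xy(1)] by blast
  obtain z1 where z1: "2 * X y - u * (1 - A y) = 2 * r * \<iota> y + 4 * r * z1" using Dz[OF xy(2)] by blast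
  obtain d' where d': "2 * X (x \<otimes> y) - u * (1 - A (x \<otimes> y)) = 2 * r * \<iota> (x \<otimes> y) + 4 * r * d'"
    using Dz[of "x \<otimes> y"] xy by auto
  obtain a where a: "A x = 2 * a + 1" using A_odd[OF xy(1)] by (rule oddE)
  have \<iota>_mult: "\<iota> (x \<otimes> y) = (if \<iota> x = \<iota> y then 0 else 1)"
  proof -
    have "2 * r * (\<iota> (x \<otimes> y) - \<iota> x - \<iota> y) = 2 * r * (2 * (a * \<iota> y + d + A x * z1 - d' + 2 * k1 + u * k2))"
      using d z1 d' k1 k2 a by Groebner_Basis.algebra
    then have "\<iota> (x \<otimes> y) - \<iota> x - \<iota> y = 2 * (a * \<iota> y + d + A x * z1 - d' + 2 * k1 + u * k2)"
      using \<open>r \<noteq> 0\<close> by simp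
    then have "even (\<iota> (x \<otimes> y) - \<iota> x - \<iota> y)" by simp
    then show ?thesis using \<iota>_01[of "x \<otimes> y"] \<iota>_01[of x] \<iota>_01[of y] by auto
  qed
  have j_mult: "j (x \<otimes> y) = (if j x = j y then 0 else 1)"
    using \<nu>_mult[OF xy] \<iota>_mult \<nu>_01[of x] \<nu>_01[of y] \<iota>_01[of x] \<iota>_01[of y]
    by (auto simp: j_def)
  have j_01: "j z \<in> {0, 1}" for z by (simp add: j_def)
  have A4: "4 dvd A x - 1 + 2 * \<nu> x"
    using A_mod4[OF xy(1)] by (auto simp: \<nu>_def) presburger+
  show "[X (x \<otimes> y) + u * j (x \<otimes> y) * A (x \<otimes> y) - 2 ^ (e - 2) * u * \<iota> (x \<otimes> y) =
      X x + u * j x * A x - 2 ^ (e - 2) * u * \<iota> x + (if j x = 0 then A x else A x * (2 ^ (e - 1) - 1)) *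
      (X y + u * j y * A y - 2 ^ (e - 2) * u * \<iota> y)] (mod 2 ^ e)"
  proof (cases "j x = 0")
    case True
    then have jj: "j (x \<otimes> y) = j y" using j_mult j_01[of y] by auto
    \<comment> \<open>Modulo 4 is enough since \<open>\<iota>\<close> enters with the factor
      \<open>2 ^ (e - 2)\<close>. For \<open>j x = 0\<close> the slope is 1 or -1 modulo 4 according
      to \<open>\<iota> x\<close>, the sign that makes a sum of bits exact; for
      \<open>j x = 1\<close> it is the opposite sign.\<close>
    have "4 dvd \<iota> (x \<otimes> y) - \<iota> x - A x * \<iota> y"
    proof (cases "\<iota> x = 0")
      case i0: True
      then have "\<nu> x = 0" using True by (simp add: j_def split: if_splits)
      then have "4 dvd (A x - 1) * \<iota> y" using A4 by simp
      then have "4 dvd - ((A x - 1) * \<iota> y)" by (simp only: dvd_minus_iff)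
      moreover have "\<iota> (x \<otimes> y) = \<iota> y" using \<iota>_mult i0 \<iota>_01[of y] by auto
      then have "\<iota> (x \<otimes> y) - \<iota> x - A x * \<iota> y = - ((A x - 1) * \<iota> y)" using i0 by (simp add: algebra_simps)
      ultimately show ?thesis by (simp only:)
    next
      case False
      then have i1: "\<iota> x = 1" using \<iota>_01[of x] by simp
      then have "\<nu> x = 1" using True by (simp add: j_def split: if_splits)
      then have "4 dvd (A x + 1) * \<iota> y" using A4 by (simp add: add.commute)
      then have "4 dvd - ((A x + 1) * \<iota> y)" by (simp only: dvd_minus_iff)
      moreover have "\<iota> (x \<otimes> y) = 1 - \<iota> y" using \<iota>_mult i1 \<iota>_01[of y] by auto
      then have "\<iota> (x \<otimes> y) - \<iota> x - A x * \<iota> y = - ((A x + 1) * \<iota> y)" using i1 by (simp add: algebra_simps)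
      ultimately show ?thesis by (simp only:)
    qed
    then obtain z where z: "\<iota> (x \<otimes> y) - \<iota> x - A x * \<iota> y = 4 * z" by blast
    have "X (x \<otimes> y) + u * j y * A (x \<otimes> y) - r * u * \<iota> (x \<otimes> y) -
        (X x + u * 0 * A x - r * u * \<iota> x + A x * (X y + u * j y * A y - r * u * \<iota> y)) =
        4 * r * (k1 + u * j y * k2 - u * z)"
      using k1 k2 z by Groebner_Basis.algebra
    then show ?thesis unfolding jj True r_def[symmetric] m cong_iff_dvd_diff by simp
  next
    case False
    then have j1: "j x = 1" using j_01[of x] by simp
    then have jj: "j (x \<otimes> y) = 1 - j y" using j_mult j_01[of y] by auto
    have "4 dvd \<iota> (x \<otimes> y) - \<iota> x + A x * \<iota> y"
    proof (cases "\<iota> x = 0")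
      case i0: True
      then have "\<nu> x = 1" using j1 \<nu>_01[of x] by (auto simp: j_def split: if_splits)
      then have "4 dvd (A x + 1) * \<iota> y" using A4 by (simp add: add.commute)
      moreover have "\<iota> (x \<otimes> y) = \<iota> y" using \<iota>_mult i0 \<iota>_01[of y] by auto
      then have "\<iota> (x \<otimes> y) - \<iota> x + A x * \<iota> y = (A x + 1) * \<iota> y" using i0 by (simp add: algebra_simps)
      ultimately show ?thesis by (simp only:)
    next
      case False
      then have i1: "\<iota> x = 1" using \<iota>_01[of x] by simp
      then have "\<nu> x = 0" using j1 \<nu>_01[of x] by (auto simp: j_def split: if_splits)
      then have "4 dvd (A x - 1) * \<iota> y" using A4 by simp
      moreover have "\<iota> (x \<otimes> y) = 1 - \<iota> y" using \<iota>_mult i1 \<iota>_01[of y] by auto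
      then have "\<iota> (x \<otimes> y) - \<iota> x + A x * \<iota> y = (A x - 1) * \<iota> y" using i1 by (simp add: algebra_simps)
      ultimately show ?thesis by (simp only:)
    qed
    then obtain z3 where z3: "\<iota> (x \<otimes> y) - \<iota> x + A x * \<iota> y = 4 * z3" by blast
    \<comment> \<open>The new slope differs from \<open>- A x\<close> by a multiple of
      \<open>2 ^ (e - 1)\<close>, so the parity of what it multiplies matters. By
      \<open>parity\<close>, \<open>X y\<close> has the parity of \<open>\<nu> y\<close>.\<close>
    have "even (X y + u * j y * A y - \<iota> y)"
    proof -
      have "odd (X y) \<longleftrightarrow> \<nu> y = 1" using parity[OF xy(2)] A_mod4[OF xy(2)] by (auto simp: \<nu>_def)
      then show ?thesis using u A_odd[OF xy(2)] \<nu>_01[of y] \<iota>_01[of y] by (auto simp: j_def)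
    qed
    then obtain z2 where z2: "X y + u * j y * A y = \<iota> y + 2 * z2" by (metis add_diff_cancel_left' diff_add_cancel dvdE add.commute)
    have "X (x \<otimes> y) + u * (1 - j y) * A (x \<otimes> y) - r * u * \<iota> (x \<otimes> y) -
        (X x + u * 1 * A x - r * u * \<iota> x + A x * (2 * r - 1) * (X y + u * j y * A y - r * u * \<iota> y)) =
        4 * r * (k1 + u * (1 - j y) * k2 - u * z3 + A x * (z1 - z2 + r' * u * \<iota> y))"
      using k1 k2 z1 z2 z3 r' by Groebner_Basis.algebra
    moreover have "(if (1::int) = 0 then A x else A x * (2 * r - 1)) = A x * (2 * r - 1)" by simp
    ultimately show ?thesis unfolding jj j1 r_def[symmetric] m q cong_iff_dvd_diff by simp
  qed
  have "[A (x \<otimes> y) * (2 * r - 1) = A x * A y * (2 * r - 1)] (mod 4 * r)"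
    unfolding k2 cong_iff_dvd_diff by (simp add: algebra_simps)
  moreover have "[A (x \<otimes> y) = A x * (2 * r - 1) * (A y * (2 * r - 1))] (mod 4 * r)"
  proof -
    have "A (x \<otimes> y) - A x * (2 * r - 1) * (A y * (2 * r - 1)) = 4 * r * (k2 + A x * A y * (1 - r))"
      unfolding k2 by (simp add: algebra_simps)
    then show ?thesis unfolding cong_iff_dvd_diff by simp
  qed
  ultimately show "[if j (x \<otimes> y) = 0 then A (x \<otimes> y) else A (x \<otimes> y) * (2 ^ (e - 1) - 1) =
      (if j x = 0 then A x else A x * (2 ^ (e - 1) - 1)) *
      (if j y = 0 then A y else A y * (2 ^ (e - 1) - 1))] (mod 2 ^ e)"
    unfolding q m using j_mult j_01[of x] j_01[of y] A_mult[OF xy, unfolded m]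
    by (auto simp: mult_ac)
next
  fix x assume "x \<in> carrier G"
  moreover have "odd ((2::int) ^ (e - 1) - 1)" using e3 by simp
  ultimately show "odd (if j x = 0 then A x else A x * (2 ^ (e - 1) - 1))" using A_odd by simp
qed (rule e_ge_2)

end


section \<open>Subgroups that meet the translations trivially\<close>

context faithful_affine_rep
begin

text \<open>Decided by where slopes 3 modulo 4 occur. If not in \<open>H\<close>, counting gives
  \<open>H = stab\<close>. If in both \<open>H\<close> and \<open>stab\<close>, their parts with
  slope 1 modulo 4 coincide, and \<open>affine_rep_twist\<close> moves \<open>h\<close> into the
  stabiliser. If only in \<open>H\<close>, there are no regular elements, \<open>X h\<close> is odd,
  and both groups shrink to order 2.\<close>

lemma complement_cases:
  assumes H: "subgroup H G" and cardH: "card H = card stab"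
    and HN: "\<And>h. \<lbrakk>h \<in> H; [A h = 1] (mod 2 ^ e)\<rbrakk> \<Longrightarrow> h = \<one>"
    and fixed: "\<And>h. \<lbrakk>h \<in> H; A h mod 4 = 1\<rbrakk> \<Longrightarrow> [X h = 0] (mod 2 ^ e)"
  obtains "has_affine_rep G e H"
  | h s where "3 \<le> e" "H = {\<one>, h}" "odd (X h)" "[A h = -1] (mod 2 ^ e)"
      "stab = {\<one>, s}" "[A s = 1 + 2 ^ (e - 1)] (mod 2 ^ e)"
      "\<And>x. x \<in> carrier G \<Longrightarrow> odd (X x) \<longleftrightarrow> A x mod 4 = 3"
proof -
  have Hc: "x \<in> carrier G" if "x \<in> H" for x using H that by (rule subgroup.mem_carrier)
  have stab_c: "x \<in> carrier G" if "x \<in> stab" for x using that by (simp add: stab_def)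
  define H1 S1 where "H1 = {h \<in> H. A h mod 4 = 1}" and "S1 = {s \<in> stab. A s mod 4 = 1}"
  have fin_stab: "finite stab" using finite_carrier by (rule finite_subset[rotated]) (use stab_c in blast)
  have finH: "finite H" using finite_carrier by (rule finite_subset[rotated]) (use Hc in blast)
  have H1S1: "H1 \<subseteq> S1" using fixed Hc by (auto simp: H1_def S1_def stab_def)
  have finS1: "finite S1" using fin_stab by (simp add: S1_def)
  have one_H: "\<one> \<in> H" using H by (rule subgroup.one_closed)
  show thesis
  proof (cases "\<forall>h\<in>H. A h mod 4 = 1")
    case True
    then have "H \<subseteq> stab" using fixed Hc by (auto simp: stab_def)
    then have "H = stab" using fin_stab cardH by (metis card_subset_eq)
    then have "has_affine_rep G e H"
      unfolding has_affine_rep_def stab_def using affine_rep_axioms by blast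
    then show thesis by (rule that(1))
  next
    case False
    then obtain h where h: "h \<in> H" "A h mod 4 = 3" using A_mod4 Hc by blast
    note hc = Hc[OF h(1)]
    have card1: "card H = 2 * card H1" unfolding H1_def by (rule card_subgroup_A_mod4[OF H finH h])
    define u where "u = X h"
    \<comment> \<open>\<open>h\<close> and \<open>h1\<close> commute, since their commutator is a
      translation in \<open>H\<close>.\<close>
    have hu: "2 ^ e dvd u * (A h1 - 1)" if "h1 \<in> H1" for h1
    proof -
      have h1: "h1 \<in> H" "[X h1 = 0] (mod 2 ^ e)" "h1 \<in> carrier G"
        using that fixed Hc by (auto simp: H1_def)
      let ?k = "inv (h \<otimes> h1) \<otimes> (h1 \<otimes> h)"
      have "?k \<in> H" using h h1 H by (simp add: subgroup.m_closed subgroup.m_inv_closed)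
      then have "?k = \<one>" using HN A_commutator[OF h1(3) hc] by blast
      then have "2 ^ e dvd X ?k" using X_one by (simp add: cong_0_iff)
      then have "2 ^ e dvd (A h1 - 1) * X h - (A h - 1) * X h1"
        using X_commutator_dvd_iff[OF h1(3) hc, of e] by simp
      moreover have "[(A h1 - 1) * X h - (A h - 1) * X h1 = (A h1 - 1) * X h - (A h - 1) * 0] (mod 2 ^ e)"
        by (intro cong_diff cong_mult cong_refl h1)
      ultimately show ?thesis by (simp add: cong_dvd_iff u_def mult.commute)
    qed
    \<comment> \<open>The square of \<open>h\<close> has slope 1 modulo 4, so it fixes 0.\<close>
    have hh: "2 ^ e dvd u * (A h + 1)"
    proof -
      have "[X (h \<otimes> h) = 0] (mod 2 ^ e)"
        using h hc H square_of_3_mod_4(1)[OF hc h(2)] by (intro fixed) (simp_all add: subgroup.m_closed)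
      then show ?thesis using X_mult[OF hc hc] unfolding u_def fold_cong by Groebner_Basis.algebra
    qed
    show thesis
    proof (cases "\<exists>s\<in>stab. A s mod 4 = 3")
      case True
      then obtain s where s: "s \<in> stab" "A s mod 4 = 3" by blast
      note sc = stab_c[OF s(1)]
      have s0: "[X s = 0] (mod 2 ^ e)" using s(1) by (simp add: stab_def)
      have "card stab = 2 * card S1" unfolding S1_def by (rule card_subgroup_A_mod4[OF subgroup_stab fin_stab s])
      then have "H1 = S1" using card1 cardH H1S1 finS1 by (simp add: card_subset_eq)
      have in_H: "x \<in> H" if "x \<in> carrier G" "[X x = 0] (mod 2 ^ e)" "A x mod 4 = 1" for x
        using that \<open>H1 = S1\<close> by (auto simp: H1_def S1_def stab_def)
      have hu': "2 ^ e dvd u * (A x - 1)" if "x \<in> carrier G" "[X x = 0] (mod 2 ^ e)" "A x mod 4 = 1" for x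
        using that in_H hu by (simp add: H1_def)
      have "even (X s)" using cong_power2_even[OF s0] e_ge_2 by simp
      then obtain g where g: "g \<in> carrier G" "odd (X g)" "A g mod 4 = 1"
        using ex_odd_1[OF sc _ s(2)] by blast
      \<comment> \<open>\<open>z\<close> is a power of \<open>g\<close> times an element of
        \<open>S1\<close>, which is \<open>H1\<close>; multiplication by \<open>u\<close> makes the
        slope of the latter invisible.\<close>
      have decomp: "\<exists>n::nat. [X z = X g * geo (A g) n] (mod 2 ^ e) \<and> [u * A z = u * A g ^ n] (mod 2 ^ e)"
        if z: "z \<in> carrier G" "A z mod 4 = 1" for z
      proof -
        obtain n :: nat where n: "[X (g [^] n) = X z] (mod 2 ^ e)" using ex_pow_X[OF g] by blast
        let ?s = "inv (g [^] n) \<otimes> z"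
        have gn: "g [^] n \<in> carrier G" and zs: "?s \<in> carrier G" using g z by simp_all
        have "A (g [^] n) mod 4 = 1"
          using cong_power2_mod4[OF A_pow[OF g(1)] e_ge_2, of n] mod4_power[OF g(3)] by simp
        then have "2 ^ e dvd u * (A ?s - 1)"
          using X_inv_mult_0_iff[OF gn z(1)] n z gn zs
          by (intro hu') (simp_all add: A_mult_mod4_eq_1 A_inv_mod4)
        moreover have "[A z = A (g [^] n) * A ?s] (mod 2 ^ e)"
          using A_mult[OF gn zs] gn z by (simp add: m_assoc[symmetric])
        ultimately have "[u * A z = u * A (g [^] n)] (mod 2 ^ e)"
          unfolding fold_cong by Groebner_Basis.algebra
        also have "[u * A (g [^] n) = u * A g ^ n] (mod 2 ^ e)"
          using A_pow[OF g(1)] by (rule cong_mult[OF cong_refl])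
        finally show ?thesis using n X_pow[OF g(1), of n] by (meson cong_sym cong_trans)
      qed
      \<comment> \<open>The commutator of \<open>s\<close> and \<open>g\<close> is a translation by
        twice an odd number, so \<open>g \<otimes> g\<close> is one of its powers times an element
        of slope 1 modulo 4 fixing 0. Hence \<open>u * (A g * A g - 1)\<close> vanishes, and
        cancelling \<open>A g + 1\<close>, twice an odd number, costs one factor 2.\<close>
      have "2 ^ (e - 1) dvd u * (A g - 1)"
      proof -
        let ?k = "inv (g \<otimes> s) \<otimes> (s \<otimes> g)"
        have kc: "?k \<in> carrier G" using g sc by simp
        have k1: "[A ?k = 1] (mod 2 ^ e)" by (rule A_commutator[OF sc g(1)])
        define o' where "o' = A s div 4"
        have As: "A s - 1 = 2 * (2 * o' + 1)" using s(2) mult_div_mod_eq[of 4 "A s"] by (simp add: o'_def)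
        have dvd_iff: "2 ^ j dvd X ?k \<longleftrightarrow> (2::int) ^ j dvd 2" if "j \<le> e" for j
        proof -
          have "[(A s - 1) * X g - (A g - 1) * X s = (A s - 1) * X g - (A g - 1) * 0] (mod 2 ^ j)"
            using s0 that cong_dvd_modulus le_imp_power_dvd by (intro cong_diff cong_mult cong_refl) blast
          then have "2 ^ j dvd X ?k \<longleftrightarrow> 2 ^ j dvd (A s - 1) * X g"
            using X_commutator_dvd_iff[OF sc g(1) that] by (simp add: cong_dvd_iff)
          also have "(A s - 1) * X g = 2 * ((2 * o' + 1) * X g)" unfolding As by simp
          also have "2 ^ j dvd 2 * ((2 * o' + 1) * X g) \<longleftrightarrow> (2::int) ^ j dvd 2"
            using g(2) by (intro pow2_dvd_mult_odd) simp
          finally show ?thesis .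
        qed
        obtain t where t: "X ?k = 2 ^ 1 * t" using dvd_iff[of 1] e_ge_2 by auto
        have "odd t" using dvd_iff[of 2] e_ge_2 t by auto
        have "X (g \<otimes> g) mod 4 = (X g + A g * X g) mod 4" by (rule X_mult_mod4[OF g(1,1)])
        then have "even (X (g \<otimes> g))" using X_mult_even[OF g(1,1)] by simp
        then obtain l :: nat where l: "[X (?k [^] l) = X (g \<otimes> g)] (mod 2 ^ e)"
          using ex_pow_X_dvd[OF kc A_mod4_of_kernel[OF k1] t \<open>odd t\<close>, of "X (g \<otimes> g)"] by auto
        have kl: "?k [^] l \<in> carrier G" using kc by (rule nat_pow_closed)
        have gg: "g \<otimes> g \<in> carrier G" using g by simp
        have Akl: "[A (?k [^] l) = 1] (mod 2 ^ e)"
          using cong_trans[OF A_pow[OF kc, of l] cong_pow[OF k1, of l]] by simp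
        let ?s = "inv (?k [^] l) \<otimes> (g \<otimes> g)"
        have sc': "?s \<in> carrier G" using kl gg by blast
        have "A (g \<otimes> g) mod 4 = 1" using A_mult_mod4_eq_1[OF g(1,1)] by simp
        then have "A ?s mod 4 = 1"
          using kl gg A_mod4_of_kernel[OF Akl] A_mult_mod4_eq_1[of "inv (?k [^] l)" "g \<otimes> g"] A_inv_mod4[OF kl] by simp
        then have "2 ^ e dvd u * (A ?s - 1)"
          using X_inv_mult_0_iff[OF kl gg] l sc' by (intro hu') simp_all
        moreover have "[A (g \<otimes> g) = A (?k [^] l) * A ?s] (mod 2 ^ e)"
        proof -
          have "?k [^] l \<otimes> ?s = g \<otimes> g" using kl gg by (simp only: m_assoc[symmetric] inv_closed r_inv l_one)
          then show ?thesis using A_mult[OF kl sc'] by simp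
        qed
        ultimately have "2 ^ e dvd u * (A g * A g - 1)"
          using A_mult[OF g(1,1)] Akl unfolding fold_cong by Groebner_Basis.algebra
        moreover define y where "y = A g div 4"
        then have Ag: "A g = 4 * y + 1" using g(3) mult_div_mod_eq[of 4 "A g"] by simp
        moreover have "(2::int) ^ e = 2 * 2 ^ (e - 1)" using e_split by blast
        ultimately have "2 * 2 ^ (e - 1) dvd u * (A g * A g - 1)" by (simp only:)
        moreover have "u * (A g * A g - 1) = 2 * (u * (A g - 1) * (2 * y + 1))"
          unfolding Ag by (simp add: algebra_simps)
        ultimately have "2 ^ (e - 1) dvd u * (A g - 1) * (2 * y + 1)" by simp
        then show ?thesis by (subst (asm) pow2_dvd_mult_odd) simp_all
      qed
      \<comment> \<open>The parity of \<open>\<kappa>\<close> measures how far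
        \<open>u * (A g - 1)\<close> is from vanishing; the factor \<open>1 + q\<close> in the twist
        repairs this defect.\<close>
      then obtain \<kappa> where \<kappa>: "u * (A g - 1) = 2 ^ (e - 1) * \<kappa>" by blast
      define q where "q = 2 ^ (e - 1) * \<kappa>"
      have q_odd: "[q * (a * b) = q * b] (mod 2 ^ e)" if a: "odd a" for a b
      proof -
        obtain c where "a = 2 * c + 1" using a by (rule oddE)
        moreover have "(2::int) ^ e = 2 * 2 ^ (e - 1)" using e_split by blast
        ultimately have "q * (a * b) - q * b = 2 ^ e * (\<kappa> * c * b)" by (simp add: q_def algebra_simps)
        then show ?thesis by (simp add: cong_iff_dvd_diff)
      qed
      have q_neg: "[q * - b = q * b] (mod 2 ^ e)" for b using q_odd[of "-1" b] by simp
      have P1: "[u * (A z - 1) = q * X z] (mod 2 ^ e)" if z: "z \<in> carrier G" "A z mod 4 = 1" for z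
      proof -
        obtain n :: nat where n: "[X z = X g * geo (A g) n] (mod 2 ^ e)" "[u * A z = u * A g ^ n] (mod 2 ^ e)"
          using decomp[OF z] by blast
        have "[u * A z - u = u * A g ^ n - u] (mod 2 ^ e)" by (intro cong_diff n cong_refl)
        also have "u * A g ^ n - u = q * geo (A g) n"
          using \<kappa> geo_diff[of "A g" n] unfolding q_def by (metis mult.assoc mult_1_right right_diff_distrib)
        also have "[q * geo (A g) n = q * (X g * geo (A g) n)] (mod 2 ^ e)" by (rule cong_sym[OF q_odd[OF g(2)]])
        also have "[q * (X g * geo (A g) n) = q * X z] (mod 2 ^ e)" by (intro cong_mult cong_refl cong_sym[OF n(1)])
        finally show ?thesis by (simp add: right_diff_distrib)
      qed
      have P3': "[u * (A z * A s - 1) = q * X z] (mod 2 ^ e)" if z: "z \<in> carrier G" "A z mod 4 = 3" for z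
      proof -
        have zs: "z \<otimes> s \<in> carrier G" "A (z \<otimes> s) mod 4 = 1"
          using z sc s(2) by (simp_all add: A_mult_mod4_eq_1)
        have "[q * X (z \<otimes> s) = q * (X z + A z * 0)] (mod 2 ^ e)"
          using cong_trans[OF X_mult[OF z(1) sc] cong_add[OF cong_refl cong_mult[OF cong_refl s0]]]
          by (rule cong_mult[OF cong_refl])
        moreover have "[u * (A z * A s - 1) = u * (A (z \<otimes> s) - 1)] (mod 2 ^ e)"
          using A_mult[OF z(1) sc] by (intro cong_mult cong_diff cong_refl) (rule cong_sym)
        ultimately show ?thesis using P1[OF zs] by (simp add: cong_def)
      qed
      have P3: "[u * (A z + 1) = q * (X z + u)] (mod 2 ^ e)" if z: "z \<in> carrier G" "A z mod 4 = 3" for z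
      proof -
        \<comment> \<open>\<open>P3'\<close> at \<open>z = h\<close> together with
          \<open>hh\<close>, which replaces \<open>u * A h\<close> by \<open>- u\<close>.\<close>
        have "[u * (A s + 1) = q * - u] (mod 2 ^ e)"
          using P3'[OF hc h(2)] hh unfolding u_def[symmetric] fold_cong by Groebner_Basis.algebra
        then have us: "[u * (A s + 1) = q * u] (mod 2 ^ e)" using q_neg cong_trans by blast
        have "[q * (A z * u) = q * u] (mod 2 ^ e)" by (rule q_odd[OF A_odd[OF z(1)]])
        then have "[u * (A z + 1) = q * u + q * - X z] (mod 2 ^ e)"
          using us P3'[OF z] unfolding fold_cong by Groebner_Basis.algebra
        also have "[q * u + q * - X z = q * u + q * X z] (mod 2 ^ e)" by (intro cong_add cong_refl q_neg)
        finally show ?thesis by (simp add: algebra_simps)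
      qed
      have rep: "affine_rep G e (\<lambda>x. (X x - u * \<nu> x) * (1 + 2 ^ (e - 1) * \<kappa> * \<nu> x))
          (\<lambda>x. A x * (1 + 2 ^ (e - 1) * \<kappa> * \<nu> x))"
        using P1 P3 by (intro affine_rep_twist) (simp_all add: q_def)
      have "[(X x - u * \<nu> x) * (1 + 2 ^ (e - 1) * \<kappa> * \<nu> x) = 0] (mod 2 ^ e) \<longleftrightarrow> x \<in> H"
        if x: "x \<in> carrier G" for x
      proof -
        have "odd (1 + 2 ^ (e - 1) * \<kappa> * \<nu> x)" using e_ge_2 by simp
        then have *: "[(X x - u * \<nu> x) * (1 + 2 ^ (e - 1) * \<kappa> * \<nu> x) = 0] (mod 2 ^ e) \<longleftrightarrow>
            [X x - u * \<nu> x = 0] (mod 2 ^ e)"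
          unfolding cong_0_iff by (rule pow2_dvd_mult_odd)
        show ?thesis
        proof (cases "A x mod 4 = 1")
          case True
          then show ?thesis unfolding * using in_H[OF x] fixed[of x] by (auto simp: \<nu>_def)
        next
          case False
          then have x3: "A x mod 4 = 3" using A_mod4[OF x] by simp
          have hx: "inv h \<otimes> x \<in> carrier G" "A (inv h \<otimes> x) mod 4 = 1"
            using hc x h(2) x3 by (simp_all add: A_mult_mod4_eq_1 A_inv_mod4)
          have "[X x - u * \<nu> x = 0] (mod 2 ^ e) \<longleftrightarrow> [X (inv h \<otimes> x) = 0] (mod 2 ^ e)"
            using X_inv_mult_0_iff[OF hc x] False
            by (simp add: \<nu>_def u_def cong_0_iff cong_iff_dvd_diff dvd_diff_commute)
          also have "\<dots> \<longleftrightarrow> inv h \<otimes> x \<in> H" using in_H[OF hx(1) _ hx(2)] fixed[OF _ hx(2)] by blast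
          also have "\<dots> \<longleftrightarrow> x \<in> H"
          proof
            assume "inv h \<otimes> x \<in> H"
            then have "h \<otimes> (inv h \<otimes> x) \<in> H" using h(1) H by (simp add: subgroup.m_closed)
            then show "x \<in> H" using hc x by (simp add: m_assoc[symmetric])
          next
            assume "x \<in> H"
            then show "inv h \<otimes> x \<in> H" using h(1) H by (simp add: subgroup.m_closed subgroup.m_inv_closed)
          qed
          finally show ?thesis unfolding * .
        qed
      qed
      then have "has_affine_rep G e H" unfolding has_affine_rep_def using rep by blast
      then show thesis by (rule that(1))
    next
      case False
      then have S4: "A s mod 4 = 1" if "s \<in> stab" for s using that A_mod4 stab_c by blast
      have no_reg: "\<not> (\<exists>y\<in>carrier G. odd (X y) \<and> A y mod 4 = 1)"
      proof
        assume "\<exists>y\<in>carrier G. odd (X y) \<and> A y mod 4 = 1"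
        then obtain y where y: "y \<in> carrier G" "odd (X y)" "A y mod 4 = 1" by blast
        show False using ex_stab_A_mod4_eq_3[OF y hc h(2)] S4 by force
      qed
      note parity = odd_X_iff[OF no_reg]
      have "odd u" using parity[OF hc] h(2) by (simp add: u_def)
      \<comment> \<open>With \<open>u\<close> odd, \<open>hu\<close> forces slope 1, and
        \<open>HN\<close> leaves only the identity.\<close>
      have "H1 = {\<one>}"
      proof -
        have "x = \<one>" if "x \<in> H1" for x
        proof (rule HN)
          show "x \<in> H" using that by (simp add: H1_def)
          have "2 ^ e dvd (A x - 1) * u" using hu[OF that] by (simp add: mult.commute)
          then show "[A x = 1] (mod 2 ^ e)"
            unfolding cong_iff_dvd_diff pow2_dvd_mult_odd[OF \<open>odd u\<close>] .
        qed
        moreover have "\<one> \<in> H1" using one_H A_mod4_of_kernel[OF A_one] by (simp add: H1_def)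
        ultimately show ?thesis by blast
      qed
      then have "card H = 2" using card1 by simp
      have "h \<noteq> \<one>" using h(2) A_mod4_of_kernel[OF A_one] by auto
      then have "H = {\<one>, h}" using \<open>card H = 2\<close> one_H h(1)
        by (intro card_seteq[symmetric]) (auto simp: finH)
      moreover have "[A h = -1] (mod 2 ^ e)"
      proof -
        have "2 ^ e dvd (A h + 1) * u" using hh by (simp add: mult.commute)
        then show ?thesis unfolding pow2_dvd_mult_odd[OF \<open>odd u\<close>] by (simp add: cong_iff_dvd_diff)
      qed
      moreover obtain s where s: "stab = {\<one>, s}" "s \<noteq> \<one>"
      proof -
        have one_stab: "\<one> \<in> stab" using subgroup_stab by (rule subgroup.one_closed)
        have "card stab = 2" using cardH \<open>card H = 2\<close> by simp
        then obtain x y where "stab = {x, y}" "x \<noteq> y" by (auto simp: card_2_iff)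
        then show thesis using that[of x] that[of y] one_stab by auto
      qed
      moreover have "[A s = 1 + 2 ^ (e - 1)] (mod 2 ^ e)"
      proof -
        have s': "s \<in> stab" using s by simp
        note sc = stab_c[OF s']
        have "s \<otimes> s \<in> stab" using subgroup_stab s' by (simp add: subgroup.m_closed)
        moreover have "s \<otimes> s \<noteq> s" using s(2) sc by simp
        ultimately have "s \<otimes> s = \<one>" using s(1) by blast
        then have "2 ^ e dvd A s * A s - 1"
          using A_mult[OF sc sc] A_one by (metis cong_iff_dvd_diff cong_sym cong_trans)
        then have "2 ^ (e - 1) dvd A s - 1" using S4[OF s'] by (intro pow2_dvd_pred_of_square)
        moreover have "\<not> 2 ^ e dvd A s - 1"
          using faithful[OF sc] s' s(2) by (auto simp: stab_def cong_iff_dvd_diff)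
        ultimately have "[A s - 1 = 2 ^ (e - 1)] (mod 2 ^ e)"
          using e_ge_2 by (intro pow2_dvd_cong_half) simp_all
        then show ?thesis by (simp add: cong_iff_dvd_diff algebra_simps)
      qed
      \<comment> \<open>For \<open>e = 2\<close> the slope \<open>1 + 2 ^ (e - 1)\<close> is 3,
        which \<open>S4\<close> excludes.\<close>
      moreover have "3 \<le> e"
      proof (rule ccontr)
        assume "\<not> 3 \<le> e"
        then have "e = 2" using e_ge_2 by simp
        have "s \<in> stab" using s by simp
        then have "A s mod 4 = 1" by (rule S4)
        then show False using \<open>[A s = 1 + 2 ^ (e - 1)] (mod 2 ^ e)\<close> \<open>e = 2\<close> by (simp add: cong_def)
      qed
      ultimately show thesis using that(2) \<open>odd u\<close> parity u_def by blast
    qed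
  qed
qed

end

section \<open>Counting in the kernel of the character\<close>

context affine_rep
begin

text \<open>\<open>A\<close> is a homomorphism to an abelian group, and so is \<open>X\<close>
  modulo 2, because slopes are odd.\<close>

lemma derived_in_kernel:
  "x \<in> derived G (carrier G) \<Longrightarrow> x \<in> carrier G \<and> [A x = 1] (mod 2 ^ e) \<and> even (X x)"
proof -
  let ?L = "{x \<in> carrier G. [A x = 1] (mod 2 ^ e) \<and> even (X x)}"
  have inv_even: "even (X (inv x)) \<longleftrightarrow> even (X x)" if "x \<in> carrier G" for x
    using X_mult_even[of "inv x" x] cong_power2_even[OF X_one] e_ge_2 that by simp
  have A_prod: "[A (x \<otimes> y) = 1] (mod 2 ^ e)"
    if "x \<in> carrier G" "y \<in> carrier G" "[A x = 1] (mod 2 ^ e)" "[A y = 1] (mod 2 ^ e)" for x y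
    using A_mult[OF that(1,2)] that(3,4) unfolding fold_cong by Groebner_Basis.algebra
  have "subgroup ?L G"
  proof
    show "\<one> \<in> ?L" using A_one cong_power2_even[OF X_one] e_ge_2 by simp
  next
    fix x y assume "x \<in> ?L" "y \<in> ?L"
    then show "x \<otimes> y \<in> ?L" using A_prod by (simp add: X_mult_even)
  next
    fix x assume x: "x \<in> ?L"
    then have "[A (inv x) = 1] (mod 2 ^ e)" using A_inv[of x] unfolding fold_cong
      by simp Groebner_Basis.algebra
    then show "inv x \<in> ?L" using x inv_even by simp
  qed auto
  moreover have "(\<Union>h1\<in>carrier G. \<Union>h2\<in>carrier G. {h1 \<otimes> h2 \<otimes> inv h1 \<otimes> inv h2}) \<subseteq> ?L"
  proof clarify
    fix x y assume xy: "x \<in> carrier G" "y \<in> carrier G"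
    have "[A (x \<otimes> y \<otimes> inv x \<otimes> inv y) = 1] (mod 2 ^ e)"
      using A_mult[OF xy] A_mult[of "x \<otimes> y" "inv x"] A_mult[of "x \<otimes> y \<otimes> inv x" "inv y"]
        A_inv[OF xy(1)] A_inv[OF xy(2)] xy
      unfolding fold_cong by simp Groebner_Basis.algebra
    then show "x \<otimes> y \<otimes> inv x \<otimes> inv y \<in> carrier G \<and> [A (x \<otimes> y \<otimes> inv x \<otimes> inv y) = 1] (mod 2 ^ e)
        \<and> even (X (x \<otimes> y \<otimes> inv x \<otimes> inv y))"
      using xy by (auto simp: X_mult_even inv_even)
  qed
  ultimately have "derived G (carrier G) \<subseteq> ?L"
    unfolding derived_def by (rule generate_subgroup_incl[rotated])
  then show "x \<in> derived G (carrier G) \<Longrightarrow> x \<in> carrier G \<and> [A x = 1] (mod 2 ^ e) \<and> even (X x)" by blast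
qed

lemma commutator_in_derived:
  assumes "x \<in> carrier G" "y \<in> carrier G"
  shows "inv (y \<otimes> x) \<otimes> (x \<otimes> y) \<in> derived G (carrier G)"
proof -
  have "inv (y \<otimes> x) \<otimes> (x \<otimes> y) = inv x \<otimes> inv y \<otimes> inv (inv x) \<otimes> inv (inv y)"
    using assms by (simp add: inv_mult_group m_assoc)
  then show ?thesis unfolding derived_def using assms by (blast intro: generate.incl inv_closed)
qed

text \<open>\<open>H #> x \<mapsto> X (inv x)\<close> is injective from \<open>2 ^ e\<close> cosets
  into \<open>2 ^ e\<close> residues, hence onto. The inverse appears because points correspond to
  left cosets of the stabiliser, whereas the index is counted with right ones.\<close>

lemma affine_rep_transitive:
  assumes H: "subgroup H G" and card: "card (rcosets H) = 2 ^ e"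
    and zero: "\<And>x. x \<in> carrier G \<Longrightarrow> [X x = 0] (mod 2 ^ e) \<longleftrightarrow> x \<in> H"
  shows "transitive_affine_rep G e X A"
proof unfold_locales
  fix w :: int
  let ?f = "\<lambda>x. X (inv x) mod 2 ^ e"
  have f_eq: "?f x = ?f y \<longleftrightarrow> H #> x = H #> y" if xy: "x \<in> carrier G" "y \<in> carrier G" for x y
  proof -
    have "?f x = ?f y \<longleftrightarrow> x \<otimes> inv y \<in> H"
      using X_inv_mult_0_iff[of "inv x" "inv y"] zero[of "x \<otimes> inv y"] xy by (simp add: cong_def)
    also have "\<dots> \<longleftrightarrow> x \<in> H #> y"
    proof
      assume "x \<otimes> inv y \<in> H"
      then have "(x \<otimes> inv y) \<otimes> y \<in> H #> y" by (auto simp: r_coset_def)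
      then show "x \<in> H #> y" using xy by (simp add: m_assoc)
    next
      assume "x \<in> H #> y"
      then obtain h where h: "h \<in> H" "x = h \<otimes> y" by (auto simp: r_coset_def)
      then show "x \<otimes> inv y \<in> H" using xy subgroup.mem_carrier[OF H h(1)] by (simp add: m_assoc)
    qed
    also have "\<dots> \<longleftrightarrow> H #> x = H #> y"
      using repr_independence[OF _ xy(2) H] rcos_self[OF xy(1) H] by metis
    finally show ?thesis .
  qed
  have rc: "rcosets H = (\<lambda>x. H #> x) ` carrier G" by (auto simp: RCOSETS_def)
  define g where "g = (\<lambda>R. ?f (SOME x. x \<in> carrier G \<and> R = H #> x))"
  have g: "g (H #> x) = ?f x" if "x \<in> carrier G" for x
  proof -
    define y where "y = (SOME y. y \<in> carrier G \<and> H #> x = H #> y)"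
    have y: "y \<in> carrier G \<and> H #> x = H #> y"
      unfolding y_def by (rule someI[of _ x]) (use that in simp)
    have "g (H #> x) = ?f y" by (simp only: g_def y_def)
    also have "?f y = ?f x" using y f_eq[of y x] that by simp
    finally show ?thesis .
  qed
  have "inj_on g (rcosets H)" unfolding rc by (rule inj_onI) (auto simp: g f_eq)
  then have "card (g ` (rcosets H)) = 2 ^ e" using card by (simp add: card_image)
  moreover have "g ` (rcosets H) \<subseteq> {0..<2 ^ e}" unfolding rc by (auto simp: g)
  ultimately have "g ` (rcosets H) = {0..<2 ^ e}" by (intro card_subset_eq) (simp_all add: nat_power_eq)
  moreover have "w mod 2 ^ e \<in> {0..<2 ^ e}" by simp
  ultimately have "w mod 2 ^ e \<in> g ` (rcosets H)" by (simp only:)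
  then obtain R where R: "R \<in> rcosets H" "w mod 2 ^ e = g R" by blast
  then obtain x where x: "x \<in> carrier G" "R = H #> x" unfolding rc by blast
  then have "w mod 2 ^ e = ?f x" using R(2) g by simp
  then have "inv x \<in> carrier G" "[X (inv x) = w] (mod 2 ^ e)" using x(1) by (simp_all add: cong_def)
  then show "\<exists>x\<in>carrier G. [X x = w] (mod 2 ^ e)" by blast
qed

end

context faithful_affine_rep
begin

text \<open>The negated divisibility bounds the valuation of \<open>X y\<close> by \<open>r\<close>,
  so \<open>y\<close> is a translation with at least \<open>2 ^ (e - r)\<close> distinct
  powers.\<close>

lemma card_kernel_subgroup_ge:
  assumes P: "subgroup P G" and y: "y \<in> P" "[A y = 1] (mod 2 ^ e)" "\<not> 2 ^ Suc r dvd X y"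
  shows "2 ^ (e - r) \<le> card P"
proof -
  have Pc: "P \<subseteq> carrier G" using P by (rule subgroup.subset)
  have yc: "y \<in> carrier G" using y Pc by blast
  have "X y \<noteq> 0" using y(3) by (metis dvd_0_right)
  then obtain r' t where t: "X y = 2 ^ r' * t" "odd t" by (rule two_adic_int)
  have "r' \<le> r" using pow2_not_dvd_less[of "Suc r" r' t] y(3) t by simp
  have one: "2 ^ (e - r) dvd i" if "y [^] i = \<one>" for i :: nat
  proof (cases "e \<le> r'")
    case True
    then show ?thesis using \<open>r' \<le> r\<close> by simp
  next
    case False
    have "2 ^ e dvd X (y [^] i)" using that X_one by (simp add: cong_0_iff)
    then have "2 ^ e dvd 2 ^ r' * int i * t"
      using X_pow_dvd_iff[OF yc A_mod4_of_kernel[OF y(2)], of e i] by (simp add: t mult_ac)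
    then have "2 ^ e dvd 2 ^ r' * int i" by (simp only: pow2_dvd_mult_odd[OF t(2)])
    moreover have "(2::int) ^ e = 2 ^ r' * 2 ^ (e - r')" using False by (simp add: power_add[symmetric])
    ultimately have "(2::int) ^ (e - r') dvd int i" by simp
    moreover have "(2::int) ^ (e - r) dvd 2 ^ (e - r')" using \<open>r' \<le> r\<close> by (intro le_imp_power_dvd) simp
    ultimately have "int (2 ^ (e - r)) dvd int i" using dvd_trans by fastforce
    then show ?thesis by (simp only: of_nat_dvd_iff)
  qed
  have "inj_on (\<lambda>i::nat. y [^] i) {..<2 ^ (e - r)}"
  proof (rule linorder_inj_onI)
    fix i j :: nat assume ij: "i < j" "i \<in> {..<2 ^ (e - r)}" "j \<in> {..<2 ^ (e - r)}"
    show "y [^] i \<noteq> y [^] j"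
    proof
      assume eq: "y [^] i = y [^] j"
      have "y [^] i \<otimes> y [^] (j - i) = y [^] j" using ij(1) yc by (simp add: nat_pow_mult)
      then have "y [^] i \<otimes> y [^] (j - i) = y [^] i \<otimes> \<one>" using eq yc by simp
      then have "y [^] (j - i) = \<one>" using yc by simp
      then have "2 ^ (e - r) \<le> j - i" using one ij(1) by (auto intro!: dvd_imp_le)
      then show False using ij by simp
    qed
  qed auto
  moreover have "(\<lambda>i::nat. y [^] i) ` {..<2 ^ (e - r)} \<subseteq> P"
  proof clarify
    fix i :: nat
    show "y [^] i \<in> P" using P y(1) by (rule subgroup.nat_pow_in_subgroup)
  qed
  moreover have "finite P" using finite_carrier Pc by (rule finite_subset[rotated])
  ultimately have "card {..<2 ^ (e - r) :: nat} \<le> card P" by (rule card_inj_on_le)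
  then show ?thesis by simp
qed

lemma card_kernel_subset_le:
  assumes P: "\<And>x. x \<in> P \<Longrightarrow> x \<in> carrier G \<and> [A x = 1] (mod 2 ^ e) \<and> 2 ^ r dvd X x" and r: "r \<le> e"
  shows "card P \<le> 2 ^ (e - r)"
proof -
  let ?f = "\<lambda>x. X x mod 2 ^ e"
  have "inj_on ?f P"
    by (rule inj_onI, rule eqI) (use P in \<open>auto simp: cong_def\<close>)
  moreover have "?f ` P \<subseteq> (\<lambda>i. 2 ^ r * i) ` {0..<2 ^ (e - r)}"
  proof clarify
    fix x assume x: "x \<in> P"
    obtain k where k: "X x = 2 ^ r * k" using P[OF x] by blast
    have eq: "(2::int) ^ e = 2 ^ r * 2 ^ (e - r)" using r by (simp add: power_add[symmetric])
    have "X x mod 2 ^ e = 2 ^ r * (k mod 2 ^ (e - r))" by (simp only: k eq mult_mod_right)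
    then show "X x mod 2 ^ e \<in> (\<lambda>i. 2 ^ r * i) ` {0..<2 ^ (e - r)}" by auto
  qed
  ultimately have "card P \<le> card ((\<lambda>i. (2::int) ^ r * i) ` {0..<2 ^ (e - r)})"
    by (intro card_inj_on_le) auto
  also have "\<dots> \<le> card {0..<(2::int) ^ (e - r)}" by (rule card_image_le) simp
  also have "\<dots> = 2 ^ (e - r)" by (simp add: nat_power_eq)
  finally show ?thesis .
qed

lemma ex_pow_kernel:
  assumes y: "y \<in> carrier G" "[A y = 1] (mod 2 ^ e)" "\<not> 2 ^ Suc r dvd X y" and w: "2 ^ r dvd w"
  shows "\<exists>n::nat. [A (y [^] n) = 1] (mod 2 ^ e) \<and> [X (y [^] n) = w] (mod 2 ^ e)"
proof -
  have "X y \<noteq> 0" using y(3) by (metis dvd_0_right)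
  then obtain r' t where t: "X y = 2 ^ r' * t" "odd t" by (rule two_adic_int)
  have "r' \<le> r" using pow2_not_dvd_less[of "Suc r" r' t] y(3) t by simp
  then have "2 ^ r' dvd w" using w le_imp_power_dvd dvd_trans by blast
  then obtain n :: nat where "[X (y [^] n) = w] (mod 2 ^ e)"
    using ex_pow_X_dvd[OF y(1) A_mod4_of_kernel[OF y(2)] t] by blast
  moreover have "[A (y [^] n) = 1] (mod 2 ^ e)"
    using cong_trans[OF A_pow[OF y(1), of n] cong_pow[OF y(2), of n]] by simp
  ultimately show ?thesis by blast
qed

text \<open>Subgroups of a cyclic 2-group form a chain: a translation of valuation at most
  \<open>r\<close> has every translation by a multiple of \<open>2 ^ r\<close> among its
  powers.\<close>

lemma kernel_subgroup_contains:
  assumes P: "subgroup P G" and y: "y \<in> P" "[A y = 1] (mod 2 ^ e)" "\<not> 2 ^ Suc r dvd X y"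
    and x: "x \<in> carrier G" "[A x = 1] (mod 2 ^ e)" "2 ^ r dvd X x"
  shows "x \<in> P"
proof -
  have yc: "y \<in> carrier G" using P y(1) by (rule subgroup.mem_carrier)
  obtain n :: nat where "[A (y [^] n) = 1] (mod 2 ^ e)" "[X (y [^] n) = X x] (mod 2 ^ e)"
    using ex_pow_kernel[OF yc y(2,3) x(3)] by blast
  then have "y [^] n = x" using yc x by (intro eqI) (simp_all add: cong_def)
  then show ?thesis using subgroup.nat_pow_in_subgroup[OF P y(1), of n] by simp
qed

lemma subgroup_kernel: "subgroup {x \<in> carrier G. [A x = 1] (mod 2 ^ e)} G"
proof
  show "\<one> \<in> {x \<in> carrier G. [A x = 1] (mod 2 ^ e)}" using A_one by simp
next
  fix x y assume xy: "x \<in> {x \<in> carrier G. [A x = 1] (mod 2 ^ e)}" "y \<in> {x \<in> carrier G. [A x = 1] (mod 2 ^ e)}"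
  then have "[A (x \<otimes> y) = 1 * 1] (mod 2 ^ e)" by (intro cong_trans[OF A_mult] cong_mult) auto
  then show "x \<otimes> y \<in> {x \<in> carrier G. [A x = 1] (mod 2 ^ e)}" using xy by simp
next
  fix x assume x: "x \<in> {x \<in> carrier G. [A x = 1] (mod 2 ^ e)}"
  then have "[A (inv x \<otimes> \<one>) = 1] (mod 2 ^ e)"
    using A_one by (intro A_inv_mult_1) (auto simp: cong_def)
  then show "inv x \<in> {x \<in> carrier G. [A x = 1] (mod 2 ^ e)}" using x by simp
qed auto

lemma subgroup_Int_kernel:
  assumes "subgroup H G"
  shows "subgroup {x \<in> H. [A x = 1] (mod 2 ^ e)} G"
proof -
  have "{x \<in> H. [A x = 1] (mod 2 ^ e)} = H \<inter> {x \<in> carrier G. [A x = 1] (mod 2 ^ e)}"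
    using subgroup.subset[OF assms] by auto
  then show ?thesis using subgroups_Inter_pair[OF assms subgroup_kernel] by simp
qed

lemma card_stab_le_2:
  assumes "e = 2"
  shows "card stab \<le> 2"
proof -
  let ?f = "\<lambda>x. A x mod 4"
  have e4: "(2::int) ^ e = 4" using assms by simp
  have "inj_on ?f stab"
    by (rule inj_onI, rule eqI) (auto simp: stab_def cong_def e4)
  moreover have "?f ` stab \<subseteq> {1, 3}" using A_mod4 by (auto simp: stab_def)
  ultimately have "card stab \<le> card {1, 3 :: int}" by (intro card_inj_on_le) auto
  then show ?thesis by simp
qed

text \<open>\<open>comm\<close> is the hypothesis \<open>D\<close> of
  \<open>affine_rep_twist'\<close> in terms of commutators; what remains is that only the identity
  and \<open>h\<close> fix 0 after the twist.\<close>

lemma has_affine_rep_involution: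
  assumes e3: "3 \<le> e" and H: "H = {\<one>, h}" and h: "h \<in> carrier G" "odd (X h)" "[A h = -1] (mod 2 ^ e)"
    and parity: "\<And>x. x \<in> carrier G \<Longrightarrow> odd (X x) \<longleftrightarrow> A x mod 4 = 3"
    and comm: "\<And>x. x \<in> carrier G \<Longrightarrow> 2 ^ (e - 1) dvd X (inv (h \<otimes> x) \<otimes> (x \<otimes> h))"
  shows "has_affine_rep G e H"
proof -
  define u where "u = X h"
  have "odd u" using h(2) by (simp add: u_def)
  have D: "2 ^ (e - 1) dvd 2 * X x - u * (1 - A x)" if "x \<in> carrier G" for x
  proof -
    have "2 ^ (e - 1) dvd (A x - 1) * X h - (A h - 1) * X x"
      using comm[OF that] X_commutator_dvd_iff[OF that h(1), of "e - 1"] by simp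
    moreover have "[(A x - 1) * X h - (A h - 1) * X x = 2 * X x - u * (1 - A x)] (mod 2 ^ e)"
      using h(3) unfolding u_def fold_cong by Groebner_Basis.algebra
    then have "[(A x - 1) * X h - (A h - 1) * X x = 2 * X x - u * (1 - A x)] (mod 2 ^ (e - 1))"
      by (rule cong_dvd_modulus) (simp add: le_imp_power_dvd)
    ultimately show ?thesis by (simp add: cong_dvd_iff)
  qed
  define \<iota> where "\<iota> = (\<lambda>x. if [2 * X x = u * (1 - A x)] (mod 2 ^ e) then 0 else 1 :: int)"
  define j where "j = (\<lambda>x. if \<nu> x = \<iota> x then 0 else 1 :: int)"
  have rep: "affine_rep G e (\<lambda>x. X x + u * j x * A x - 2 ^ (e - 2) * u * \<iota> x)
      (\<lambda>x. if j x = 0 then A x else A x * (2 ^ (e - 1) - 1))"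
    unfolding j_def \<iota>_def using e3 \<open>odd u\<close> D parity by (rule affine_rep_twist')
  have A_one4: "A \<one> mod 4 = 1" by (rule A_mod4_of_kernel[OF A_one])
  have h4: "A h mod 4 = 3" using cong_power2_mod4[OF h(3) e_ge_2] by simp
  define r :: int where "r = 2 ^ (e - 2)"
  have m: "(2::int) ^ e = 4 * r" and q: "(2::int) ^ (e - 1) = 2 * r"
    using e_split unfolding r_def by blast+
  have "[X x + u * j x * A x - r * u * \<iota> x = 0] (mod 2 ^ e) \<longleftrightarrow> x \<in> H"
    if x: "x \<in> carrier G" for x
  proof
    assume "x \<in> H"
    then consider "x = \<one>" | "x = h" using H by blast
    then show "[X x + u * j x * A x - r * u * \<iota> x = 0] (mod 2 ^ e)"
    proof cases
      case 1
      have "[2 * X \<one> = u * (1 - A \<one>)] (mod 2 ^ e)"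
        using X_one A_one unfolding fold_cong by Groebner_Basis.algebra
      then have "\<iota> \<one> = 0" "j \<one> = 0" using A_one4 by (simp_all add: \<iota>_def j_def \<nu>_def)
      then show ?thesis using X_one by (simp add: 1)
    next
      case 2
      have "[2 * X h = u * (1 - A h)] (mod 2 ^ e)"
        using h(3) unfolding u_def fold_cong by Groebner_Basis.algebra
      then have i: "\<iota> h = 0" "j h = 1" using h4 by (simp_all add: \<iota>_def j_def \<nu>_def)
      have "[X h + u * 1 * A h - r * u * 0 = 0] (mod 2 ^ e)"
        using h(3) unfolding u_def fold_cong by Groebner_Basis.algebra
      then show ?thesis unfolding 2 i .
    qed
  next
    assume c0: "[X x + u * j x * A x - r * u * \<iota> x = 0] (mod 2 ^ e)"
    have cancel_u: "[a = b] (mod 2 ^ e)" if "[u * a = u * b] (mod 2 ^ e)" for a b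
      using that cong_mult_lcancel[of u "2 ^ e" a b] \<open>odd u\<close> by simp
    have ru: "[2 * r * u = 2 * r] (mod 2 ^ e)"
    proof -
      obtain v where "u = 2 * v + 1" using \<open>odd u\<close> by (rule oddE)
      then have "2 * r * u - 2 * r = 4 * r * v" by (simp add: algebra_simps)
      then show ?thesis by (simp add: m cong_iff_dvd_diff)
    qed
    have D1: "[2 * X x - u * (1 - A x) = 2 * r] (mod 2 ^ e)" if "\<iota> x = 1"
      using that D[OF x] e3 unfolding q[symmetric]
      by (intro pow2_dvd_cong_half) (auto simp: \<iota>_def cong_iff_dvd_diff split: if_splits)
    have D0: "[2 * X x = u * (1 - A x)] (mod 2 ^ e)" if "\<iota> x = 0"
      using that by (auto simp: \<iota>_def split: if_splits)
    have \<iota>01: "\<iota> x = 0 \<or> \<iota> x = 1" by (simp add: \<iota>_def)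
    \<comment> \<open>In each combination of \<open>\<nu> x\<close> and \<open>\<iota> x\<close>,
      the vanishing of the twisted cocycle and the value of \<open>\<iota> x\<close> determine the
      slope as 1 or -1. For \<open>\<iota> x = 1\<close> this contradicts its class modulo 4; for
      \<open>\<iota> x = 0\<close> it leaves the identity and \<open>h\<close>.\<close>
    show "x \<in> H"
    proof (cases "A x mod 4 = 1")
      case True
      then have \<nu>: "\<nu> x = 0" by (simp add: \<nu>_def)
      show ?thesis
      proof (cases "\<iota> x = 0")
        case i: True
        then have "j x = 0" using \<nu> by (simp add: j_def)
        then have X0: "[X x = 0] (mod 2 ^ e)" using c0 i by simp
        have "[u * A x = u * 1] (mod 2 ^ e)" using D0[OF i] X0 unfolding fold_cong by Groebner_Basis.algebra
        then have "x = \<one>" using cancel_u faithful[OF x X0] by blast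
        then show ?thesis using H by simp
      next
        case False
        then have i: "\<iota> x = 1" "j x = 1" using \<nu> \<iota>01 by (simp_all add: j_def)
        have "[X x + u * A x - r * u = 0] (mod 2 ^ e)" using c0 i by simp
        then have "[u * A x = u * -1] (mod 2 ^ e)"
          using D1[OF i(1)] ru unfolding fold_cong by Groebner_Basis.algebra
        then have "[A x = -1] (mod 2 ^ e)" by (rule cancel_u)
        then have "A x mod 4 = (-1) mod 4" using e_ge_2 by (rule cong_power2_mod4)
        then show ?thesis using True by simp
      qed
    next
      case False
      then have \<nu>: "\<nu> x = 1" by (simp add: \<nu>_def)
      show ?thesis
      proof (cases "\<iota> x = 0")
        case i: True
        then have "j x = 1" using \<nu> by (simp add: j_def)
        then have X0: "[X x + u * A x = 0] (mod 2 ^ e)" using c0 i by simp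
        then have "[u * A x = u * -1] (mod 2 ^ e)" using D0[OF i] unfolding fold_cong by Groebner_Basis.algebra
        then have A1: "[A x = -1] (mod 2 ^ e)" by (rule cancel_u)
        have "x = h"
        proof (rule eqI[OF x h(1)])
          show "[X x = X h] (mod 2 ^ e)" using X0 A1 unfolding u_def fold_cong by Groebner_Basis.algebra
          show "[A x = A h] (mod 2 ^ e)" using A1 h(3) by (simp add: cong_def)
        qed
        then show ?thesis using H by simp
      next
        case False
        then have i: "\<iota> x = 1" "j x = 0" using \<nu> \<iota>01 by (simp_all add: j_def)
        have "[X x - r * u = 0] (mod 2 ^ e)" using c0 i by simp
        then have "[u * A x = u * 1] (mod 2 ^ e)"
          using D1[OF i(1)] ru unfolding fold_cong by Groebner_Basis.algebra
        then have "[A x = 1] (mod 2 ^ e)" by (rule cancel_u)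
        then show ?thesis using \<open>A x mod 4 \<noteq> 1\<close> A_mod4_of_kernel by blast
      qed
    qed
  qed
  then show ?thesis unfolding has_affine_rep_def using rep r_def by blast
qed

end

section \<open>Orders of elements and the full equivalence\<close>

context faithful_affine_rep
begin

text \<open>Expresses the condition on elements of order \<open>2 ^ e\<close> in (ii) through
  regular elements. For slope 3 modulo 4 or even \<open>X\<close>, half the exponent already kills
  the element.\<close>

lemma ord_eq_iff:
  assumes x: "x \<in> carrier G"
  shows "ord x = 2 ^ e \<longleftrightarrow> odd (X x) \<and> A x mod 4 = 1"
proof
  assume ord: "ord x = 2 ^ e"
  show "odd (X x) \<and> A x mod 4 = 1"
  proof (rule ccontr)
    assume "\<not> (odd (X x) \<and> A x mod 4 = 1)"
    then have "x [^] (2 ^ (e - 1) :: nat) = \<one>"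
      using faithful[of "x [^] (2 ^ (e - 1) :: nat)"] A_pow_half[OF x] X_pow_half_0[OF x] x by simp
    then have "(2::nat) ^ e dvd 2 ^ (e - 1)" using pow_eq_id[OF x] ord by metis
    then have "(2::nat) ^ e \<le> 2 ^ (e - 1)" by (rule dvd_imp_le) simp
    moreover have "(2::nat) ^ (e - 1) < 2 ^ e" using e_ge_2 by (intro power_strict_increasing) simp_all
    ultimately show False by linarith
  qed
next
  assume reg: "odd (X x) \<and> A x mod 4 = 1"
  have "x [^] n = \<one> \<longleftrightarrow> 2 ^ e dvd n" for n :: nat
  proof -
    have "2 ^ e dvd X (x [^] n) \<longleftrightarrow> 2 ^ e dvd int n * X x"
      using X_pow_dvd_iff[OF x, of e n] reg by (simp add: mult.commute)
    also have "\<dots> \<longleftrightarrow> 2 ^ e dvd int n" using reg by (intro pow2_dvd_mult_odd) simp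
    also have "\<dots> \<longleftrightarrow> int (2 ^ e) dvd int n" by simp
    finally have *: "2 ^ e dvd X (x [^] n) \<longleftrightarrow> 2 ^ e dvd n" unfolding of_nat_dvd_iff .
    have "[A (x [^] n) = 1] (mod 2 ^ e)" if n: "2 ^ e dvd n"
    proof -
      obtain k where "n = 2 ^ e * k" using n by blast
      then have "A x ^ n = (A x ^ (2 ^ e)) ^ k" by (simp add: power_mult)
      moreover have "[A x ^ (2 ^ e) = 1] (mod 2 ^ e)"
        using pow_mod_pow2_eq_1[of "A x" 0 e] reg by (simp add: cong_iff_dvd_diff)
      then have "[(A x ^ (2 ^ e)) ^ k = 1 ^ k] (mod 2 ^ e)" by (rule cong_pow)
      ultimately show ?thesis using A_pow[OF x, of n] by (simp add: cong_def)
    qed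
    then show ?thesis using * faithful[of "x [^] n"] x X_one by (auto simp: cong_0_iff)
  qed
  then show "ord x = 2 ^ e" by (simp add: ord_unique[OF x])
qed

lemma ex_kernel_X:
  assumes "y \<in> carrier G" "[A y = 1] (mod 2 ^ e)" "\<not> 2 ^ Suc r dvd X y"
  shows "\<exists>x\<in>carrier G. [A x = 1] (mod 2 ^ e) \<and> [X x = 2 ^ r] (mod 2 ^ e)"
  using ex_pow_kernel[OF assms dvd_refl] assms(1) nat_pow_closed by blast

lemma has_affine_rep_imp_two_affine_reps:
  assumes "subgroup H G" "card (rcosets H) = 2 ^ e" "has_affine_rep G e H"
  obtains c \<alpha> where "two_affine_reps G e X A c \<alpha> H"
proof -
  obtain c \<alpha> where R: "affine_rep G e c \<alpha>"
    and zero: "\<And>x. x \<in> carrier G \<Longrightarrow> [c x = 0] (mod 2 ^ e) \<longleftrightarrow> x \<in> H"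
    using assms(3) unfolding has_affine_rep_def by blast
  interpret R: transitive_affine_rep G e c \<alpha>
    by (rule affine_rep.affine_rep_transitive[OF R assms(1,2) zero])
  have "H = R.stab" using zero subgroup.subset[OF assms(1)] by (auto simp: R.stab_def)
  then have "two_affine_reps G e X A c \<alpha> H" by unfold_locales
  then show thesis by (rule that)
qed

text \<open>If \<open>H\<close> has a nontrivial element of slope 1 modulo 4, the base point is
  moved to a common fixed point; the exceptional outcome cannot arise, as \<open>h\<close> has slope
  3 modulo 4 there. Otherwise the base point stays, so that \<open>stab\<close> in the exceptional
  outcome is the stabiliser of 0 itself.\<close>

lemma has_affine_rep_trivial_intersection:
  assumes H: "subgroup H G" and cardH: "card H = card stab"
    and HN: "\<And>h. \<lbrakk>h \<in> H; [A h = 1] (mod 2 ^ e)\<rbrakk> \<Longrightarrow> h = \<one>"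
  defines "M \<equiv> {x \<in> carrier G. [A x = 1] (mod 2 ^ e)}"
  obtains "has_affine_rep G e H"
  | h s where "H = {\<one>, h}" "odd (X h)" "[A h = -1] (mod 2 ^ e)"
      "stab = {\<one>, s}" "[A s = 1 + 2 ^ (e - 1)] (mod 2 ^ e)"
      "8 \<le> card M \<or> card M = 4 \<and> card (derived G (carrier G)) = 4"
proof (cases "{h \<in> H. A h mod 4 = 1} = {\<one>}")
  case True
  have X0: "[X h = 0] (mod 2 ^ e)" if "h \<in> H" "A h mod 4 = 1" for h
  proof -
    have "h \<in> {h \<in> H. A h mod 4 = 1}" using that by simp
    then have "h = \<one>" unfolding True by simp
    then show ?thesis using X_one by simp
  qed
  show thesis
  proof (rule complement_cases[OF H cardH HN X0])
    fix h s
    assume e3: "3 \<le> e" and hs: "H = {\<one>, h}" "odd (X h)" "[A h = -1] (mod 2 ^ e)"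
      "stab = {\<one>, s}" "[A s = 1 + 2 ^ (e - 1)] (mod 2 ^ e)"
      and parity: "\<And>x. x \<in> carrier G \<Longrightarrow> odd (X x) \<longleftrightarrow> A x mod 4 = 3"
    have hc: "h \<in> carrier G" using hs(1) subgroup.subset[OF H] by blast
    show thesis
    proof (cases "8 \<le> card M \<or> card M = 4 \<and> card (derived G (carrier G)) = 4")
      case False
      \<comment> \<open>A longer commutator would generate at least four translations inside the
        derived subgroup, hence inside \<open>M\<close>, and force one of the two excluded
        cardinality conditions.\<close>
      have "2 ^ (e - 1) dvd X (inv (h \<otimes> x) \<otimes> (x \<otimes> h))" if x: "x \<in> carrier G" for x
      proof (rule ccontr)
        let ?k = "inv (h \<otimes> x) \<otimes> (x \<otimes> h)"
        let ?D = "derived G (carrier G)"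
        assume not_dvd: "\<not> 2 ^ (e - 1) dvd X ?k"
        have kD: "?k \<in> ?D" using commutator_in_derived[OF x hc] .
        have k1: "[A ?k = 1] (mod 2 ^ e)" by (rule A_commutator[OF x hc])
        have DM: "?D \<subseteq> M" using derived_in_kernel by (auto simp: M_def)
        have not_dvd': "\<not> 2 ^ Suc (e - 2) dvd X ?k"
        proof -
          have "Suc (e - 2) = e - 1" using e3 by simp
          then show ?thesis using not_dvd by simp
        qed
        have e2: "e - (e - 2) = 2" using e3 by simp
        have ge: "4 \<le> card P" if "subgroup P G" "?k \<in> P" for P
          using card_kernel_subgroup_ge[OF that k1 not_dvd'] by (simp add: e2)
        have "2 ^ (e - 2) dvd X y" if "y \<in> M" for y
        proof (rule ccontr)
          assume *: "\<not> 2 ^ (e - 2) dvd X y"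
          have "Suc (e - 3) = e - 2" "e - (e - 3) = 3" using e3 by simp_all
          then have "8 \<le> card M"
            using card_kernel_subgroup_ge[OF subgroup_kernel, of y "e - 3"] that *
            by (simp add: M_def)
          then show False using False by simp
        qed
        then have le: "card P \<le> 4" if "P \<subseteq> M" for P
          using card_kernel_subset_le[of P "e - 2"] that e2 by (auto simp: M_def)
        have "card M = 4"
          using ge[OF subgroup_kernel] le[of M] kD DM by (auto simp: M_def)
        moreover have "card ?D = 4"
          using ge[OF derived_is_subgroup kD] le[OF DM] by simp
        ultimately show False using False by blast
      qed
      then show thesis using has_affine_rep_involution[OF e3 hs(1) hc hs(2,3) parity] that(1) by blast
    qed (use that(2) hs in blast)
  qed ((assumption | rule that(1))+)
next
  case False
  obtain w where w: "\<forall>k\<in>{h \<in> H. A h mod 4 = 1}. [X k + (A k - 1) * w = 0] (mod 2 ^ e)"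
    using common_fixed_point[OF subgroup_A_mod4_eq_1[OF H]] HN by blast
  interpret T: faithful_affine_rep G e "\<lambda>x. X x + (A x - 1) * w" A by (rule translate)
  have cT: "card H = card T.stab"
    using cardH card_carrier[OF finite_carrier] T.card_carrier[OF finite_carrier] by simp
  have wX: "\<And>h. \<lbrakk>h \<in> H; A h mod 4 = 1\<rbrakk> \<Longrightarrow> [X h + (A h - 1) * w = 0] (mod 2 ^ e)"
    using w by blast
  show thesis
  proof (rule T.complement_cases[OF H cT HN wX])
    fix h assume "H = {\<one>, h}" "[A h = -1] (mod 2 ^ e)"
    moreover from this(2) have "A h mod 4 \<noteq> 1" using cong_power2_mod4[OF _ e_ge_2] by fastforce
    ultimately have "{h \<in> H. A h mod 4 = 1} = {\<one>}" using A_mod4_of_kernel[OF A_one] by auto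
    then show thesis using False by blast
  qed ((assumption | rule that(1))+)
qed

text \<open>\<open>N\<close> lies in a cyclic 2-group, so its order is 1, 2 or at least 4, and it
  contains every sufficiently divisible translation of \<open>G\<close>. The first two conditions on
  order 2 are handled together as one equivalence.\<close>

theorem not_has_affine_rep_iff:
  assumes H: "subgroup H G" and card: "card (rcosets H) = 2 ^ e"
  defines "N \<equiv> {x \<in> H. [A x = 1] (mod 2 ^ e)}" and "M \<equiv> {x \<in> carrier G. [A x = 1] (mod 2 ^ e)}"
  shows "\<not> has_affine_rep G e H \<longleftrightarrow>
      card N \<ge> 4
    \<or> (card N = 2 \<and> (\<forall>g\<in>carrier G. \<not> (odd (X g) \<and> A g mod 4 = 1)))
    \<or> (card N = 2 \<and> \<not> H \<lhd> G)
    \<or> (card N = 1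
       \<and> (\<exists>h s. H = {\<one>, h} \<and> odd (X h) \<and> [A h = -1] (mod 2 ^ e)
              \<and> stab = {\<one>, s} \<and> [A s = 1 + 2 ^ (e - 1)] (mod 2 ^ e))
       \<and> (card M \<ge> 8 \<or> (card M = 4 \<and> card (derived G (carrier G)) = 4)))"
proof -
  have Hc: "x \<in> carrier G" if "x \<in> H" for x using H that by (rule subgroup.mem_carrier)
  have finH: "finite H" using finite_carrier by (rule finite_subset[rotated]) (use Hc in blast)
  have finN: "finite N" using finH by (simp add: N_def)
  have subN: "subgroup N G" unfolding N_def by (rule subgroup_Int_kernel[OF H])
  have "2 ^ e * card H = 2 ^ e * card stab"
    using lagrange[OF H] card card_carrier[OF finite_carrier] by (simp add: order_def)
  then have cardH: "card H = card stab" by simp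
  have one_N: "\<one> \<in> N" using subN by (rule subgroup.one_closed)
  have e_arith: "Suc (e - 1) = e" "Suc (e - 2) = e - 1" "e - (e - 1) = 1" "e - (e - 2) = 2"
    using e_ge_2 by simp_all
  have large: "\<exists>x\<in>N. \<not> 2 ^ (e - 1) dvd X x" if "2 < card N"
  proof (rule ccontr)
    assume "\<not> ?thesis"
    then have "card N \<le> 2 ^ (e - (e - 1))"
      by (intro card_kernel_subset_le) (use Hc in \<open>auto simp: N_def\<close>)
    then show False using that unfolding e_arith by simp
  qed
  have small: "2 ^ (e - 1) dvd X x" if "x \<in> H" "[A x = 1] (mod 2 ^ e)" "card N < 4" for x
  proof (rule ccontr)
    assume "\<not> 2 ^ (e - 1) dvd X x"
    then have "\<not> 2 ^ Suc (e - 2) dvd X x" unfolding e_arith .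
    moreover have "x \<in> N" using that by (simp add: N_def)
    ultimately have "2 ^ (e - (e - 2)) \<le> card N" using card_kernel_subgroup_ge[OF subN _ that(2)] by blast
    then show False using that(3) unfolding e_arith by simp
  qed
  have zin: "x \<in> H" if "2 \<le> card N" "x \<in> carrier G" "[A x = 1] (mod 2 ^ e)" "2 ^ (e - 1) dvd X x" for x
  proof -
    have "\<not> N \<subseteq> {\<one>}"
    proof
      assume "N \<subseteq> {\<one>}"
      then have "card N \<le> card {\<one>}" by (intro card_mono) simp_all
      then show False using that(1) by simp
    qed
    then obtain y where y: "y \<in> N" "y \<noteq> \<one>" by blast
    have A1: "[A y = 1] (mod 2 ^ e)" using y(1) by (simp add: N_def)
    have "\<not> 2 ^ e dvd X y" using faithful[of y] Hc y by (auto simp: N_def cong_0_iff)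
    then have "\<not> 2 ^ Suc (e - 1) dvd X y" unfolding e_arith .
    then have "x \<in> N" using kernel_subgroup_contains[OF subN y(1) A1 _ that(2-4)] by blast
    then show ?thesis by (simp add: N_def)
  qed
  have H_le_2: "card H \<le> 2" if "e = 2" using card_stab_le_2[OF that] cardH by simp
  have N_le_H: "card N \<le> card H" using finH by (intro card_mono) (auto simp: N_def)
  have "card N \<noteq> 0" using one_N finN by auto
  moreover have "4 \<le> card N" if N2: "2 < card N"
  proof -
    obtain x where x: "x \<in> N" "\<not> 2 ^ (e - 1) dvd X x" using large[OF N2] by blast
    have A1: "[A x = 1] (mod 2 ^ e)" using x(1) by (simp add: N_def)
    have "\<not> 2 ^ Suc (e - 2) dvd X x" using x(2) unfolding e_arith .
    then have "2 ^ (e - (e - 2)) \<le> card N" by (rule card_kernel_subgroup_ge[OF subN x(1) A1])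
    then show ?thesis unfolding e_arith by simp
  qed
  ultimately consider "4 \<le> card N" | "card N = 2" | "card N = 1" by linarith
  then show ?thesis
  proof cases
    case 1
    have "\<not> has_affine_rep G e H"
    proof
      assume "has_affine_rep G e H"
      then obtain c \<alpha> where "two_affine_reps G e X A c \<alpha> H"
        using has_affine_rep_imp_two_affine_reps[OF H card] by blast
      then interpret two_affine_reps G e X A c \<alpha> H .
      have "3 \<le> e" using 1 N_le_H H_le_2 e_ge_2 by (cases "e = 2") simp_all
      then show False
      proof (rule H_not_contains_order_4)
        fix x assume x: "x \<in> carrier G" "[A x = 1] (mod 2 ^ e)" "2 ^ (e - 2) dvd X x"
        obtain y where y: "y \<in> N" "\<not> 2 ^ (e - 1) dvd X y" using large 1 by auto
        have A1: "[A y = 1] (mod 2 ^ e)" using y(1) by (simp add: N_def)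
        have "\<not> 2 ^ Suc (e - 2) dvd X y" using y(2) unfolding e_arith .
        then have "x \<in> N" by (rule kernel_subgroup_contains[OF subN y(1) A1 _ x])
        then show "x \<in> H" by (simp add: N_def)
      qed
    qed
    then show ?thesis using 1 by simp
  next
    case 2
    have zin': "\<And>x. \<lbrakk>x \<in> carrier G; [A x = 1] (mod 2 ^ e); 2 ^ (e - 1) dvd X x\<rbrakk> \<Longrightarrow> x \<in> H"
      using zin 2 by simp
    have zout: "\<And>x. \<lbrakk>x \<in> H; [A x = 1] (mod 2 ^ e)\<rbrakk> \<Longrightarrow> 2 ^ (e - 1) dvd X x"
      using small 2 by simp
    have "has_affine_rep G e H \<longleftrightarrow> (\<exists>g\<in>carrier G. odd (X g) \<and> A g mod 4 = 1) \<and> H \<lhd> G"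
    proof
      assume "(\<exists>g\<in>carrier G. odd (X g) \<and> A g mod 4 = 1) \<and> H \<lhd> G"
      then show "has_affine_rep G e H"
        using has_affine_rep_normal[OF _ card _ _ _ zin' zout] by blast
    next
      assume rep: "has_affine_rep G e H"
      show "(\<exists>g\<in>carrier G. odd (X g) \<and> A g mod 4 = 1) \<and> H \<lhd> G"
      proof (cases "e = 2")
        case False
        then have e3: "3 \<le> e" using e_ge_2 by simp
        obtain c \<alpha> where "two_affine_reps G e X A c \<alpha> H"
          using rep has_affine_rep_imp_two_affine_reps[OF H card] by blast
        then interpret two_affine_reps G e X A c \<alpha> H .
        have "\<exists>g\<in>carrier G. odd (X g) \<and> A g mod 4 = 1" using ex_regular[OF e3 zin'] by blast
        moreover have "H \<lhd> G" using normal_H \<alpha>_trivial_on_H[OF e3 zin' zout] by blast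
        ultimately show ?thesis by blast
      next
        \<comment> \<open>The results on two representations require \<open>3 \<le> e\<close>. For
          \<open>e = 2\<close> the right-hand side holds outright: \<open>H\<close> is the group of
          translations by multiples of 2, and a nontrivial stabiliser element has slope 3 modulo 4,
          which yields a regular element.\<close>
        case True
        then have "card H = 2" using H_le_2 N_le_H 2 by simp
        then have "N = H" using 2 finH by (intro card_subset_eq) (auto simp: N_def)
        have "x \<otimes> h \<otimes> inv x \<in> H" if x: "x \<in> carrier G" and h: "h \<in> H" for x h
        proof -
          have hc: "h \<in> carrier G" using h by (rule Hc)
          have A1: "[A h = 1] (mod 2 ^ e)" using h \<open>N = H\<close> by (auto simp: N_def)
          have "2 ^ (e - 1) dvd X h" using zout h A1 by blast
          have "[A (x \<otimes> h \<otimes> inv x) = 1] (mod 2 ^ e)"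
            using A_mult[of "x \<otimes> h" "inv x"] A_mult[OF x hc] A_inv[OF x] A1 x hc
            unfolding fold_cong by simp Groebner_Basis.algebra
          moreover have "[X (x \<otimes> h \<otimes> inv x) = A x * X h] (mod 2 ^ e)"
            using X_mult[of "x \<otimes> h" "inv x"] X_mult[OF x hc] A_mult[OF x hc]
              X_mult[of x "inv x"] X_one A1 x hc
            unfolding fold_cong by simp Groebner_Basis.algebra
          then have "[X (x \<otimes> h \<otimes> inv x) = A x * X h] (mod 2 ^ (e - 1))"
            by (rule cong_dvd_modulus) (simp add: le_imp_power_dvd)
          then have "2 ^ (e - 1) dvd X (x \<otimes> h \<otimes> inv x)"
            using \<open>2 ^ (e - 1) dvd X h\<close> by (simp add: cong_dvd_iff)
          ultimately show ?thesis using zin' x hc by simp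
        qed
        then have "H \<lhd> G" using H by (auto simp: normal_inv_iff)
        moreover have "\<exists>g\<in>carrier G. odd (X g) \<and> A g mod 4 = 1"
        proof -
          have "\<not> stab \<subseteq> {\<one>}"
          proof
            assume "stab \<subseteq> {\<one>}"
            then have "card stab \<le> card {\<one>}" by (intro card_mono) simp_all
            then show False using cardH \<open>card H = 2\<close> by simp
          qed
          then obtain s where s: "s \<in> carrier G" "[X s = 0] (mod 2 ^ e)" "s \<noteq> \<one>" by (auto simp: stab_def)
          have e4: "(2::int) ^ e = 4" using True by simp
          have "A s mod 4 \<noteq> 1" using faithful[OF s(1,2)] s(3) by (auto simp: cong_def e4)
          moreover have "even (X s)" using cong_power2_even[OF s(2)] e_ge_2 by simp
          ultimately show ?thesis using ex_odd_1[OF s(1)] A_mod4[OF s(1)] by blast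
        qed
        ultimately show ?thesis by blast
      qed
    qed
    then show ?thesis using 2 by auto
  next
    case 3
    then have "N = {\<one>}" using one_N by (metis card_1_singletonE singletonD)
    then have HN: "\<And>h. \<lbrakk>h \<in> H; [A h = 1] (mod 2 ^ e)\<rbrakk> \<Longrightarrow> h = \<one>" by (auto simp: N_def)
    have "\<not> has_affine_rep G e H"
      if hs: "H = {\<one>, h}" "odd (X h)" "[A h = -1] (mod 2 ^ e)"
        "stab = {\<one>, s}" "[A s = 1 + 2 ^ (e - 1)] (mod 2 ^ e)"
        and disj: "card M \<ge> 8 \<or> (card M = 4 \<and> card (derived G (carrier G)) = 4)" for h s
    proof
      assume "has_affine_rep G e H"
      then obtain c \<alpha> where "two_affine_reps G e X A c \<alpha> H"
        using has_affine_rep_imp_two_affine_reps[OF H card] by blast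
      then interpret two_affine_reps G e X A c \<alpha> H .
      have M_le: "card M \<le> 2 ^ (e - r)" if "\<forall>y\<in>M. 2 ^ r dvd X y" "r \<le> e" for r
        using that by (intro card_kernel_subset_le) (auto simp: M_def)
      have ex_small: "\<exists>y\<in>M. \<not> 2 ^ (e - 1) dvd X y"
      proof (rule ccontr)
        assume "\<not> ?thesis"
        then have "card M \<le> 2" using M_le[of "e - 1"] unfolding e_arith by simp
        then show False using disj by auto
      qed
      then obtain m where m: "m \<in> carrier G" "[A m = 1] (mod 2 ^ e)" "[X m = 2 ^ (e - 2)] (mod 2 ^ e)"
        using ex_kernel_X[of _ "e - 2"] unfolding e_arith(2) by (auto simp: M_def)
      \<comment> \<open>\<open>disj\<close> also rules out \<open>e = 2\<close>: there are not eight
        translations modulo 4, and a derived subgroup contains only even ones, whereas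
        \<open>X m\<close> would be odd.\<close>
      have "3 \<le> e \<and> (\<alpha> m mod 4 = 1 \<or> (\<exists>x\<in>carrier G. [A x = 1] (mod 2 ^ e) \<and> [X x = 2 ^ (e - 3)] (mod 2 ^ e)))"
        using disj
      proof
        assume M8: "8 \<le> card M"
        have "\<exists>y\<in>M. \<not> 2 ^ (e - 2) dvd X y"
        proof (rule ccontr)
          assume "\<not> ?thesis"
          then have "card M \<le> 4" using M_le[of "e - 2"] unfolding e_arith by simp
          then show False using M8 by simp
        qed
        then obtain y where y: "y \<in> M" "\<not> 2 ^ (e - 2) dvd X y" by blast
        then have "e \<noteq> 2" by auto
        then have e3: "3 \<le> e" using e_ge_2 by simp
        then have "Suc (e - 3) = e - 2" by simp
        then show ?thesis using ex_kernel_X[of y "e - 3"] y e3 by (auto simp: M_def)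
      next
        assume D: "card M = 4 \<and> card (derived G (carrier G)) = 4"
        have "derived G (carrier G) = M"
        proof (rule card_subset_eq)
          show "finite M" using finite_carrier by (simp add: M_def)
          show "derived G (carrier G) \<subseteq> M" using derived_in_kernel by (auto simp: M_def)
          show "card (derived G (carrier G)) = card M" using D by simp
        qed
        then have mD: "m \<in> derived G (carrier G)" using m by (simp add: M_def)
        \<comment> \<open>Membership in the derived subgroup does not refer to a representation, so
          it carries information from \<open>(X, A)\<close> over to \<open>\<alpha>\<close>.\<close>
        then have "\<alpha> m mod 4 = 1" using R.derived_in_kernel R.A_mod4_of_kernel by blast
        moreover have "e \<noteq> 2"
        proof
          assume "e = 2"
          then have "odd (X m)" using cong_power2_even[OF m(3)] by simp
          then show False using derived_in_kernel[OF mD] by simp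
        qed
        ultimately show ?thesis using e_ge_2 by simp
      qed
      moreover have "A s' mod 4 = 1" if "s' \<in> stab" "3 \<le> e" for s'
      proof (cases "s' = \<one>")
        case True
        then show ?thesis using A_mod4_of_kernel[OF A_one] by simp
      next
        case False
        then have "s' = s" using that hs(4) by simp
        moreover have "(2::int) ^ 2 dvd 2 ^ (e - 1)" using that(2) by (intro le_imp_power_dvd) simp
        then have "(1 + 2 ^ (e - 1)) mod 4 = (1::int)" by (auto simp: mod_eq_dvd_iff[of _ _ 1, simplified] elim!: dvdE)
        ultimately show ?thesis using cong_power2_mod4[OF hs(5) e_ge_2] by simp
      qed
      ultimately show False using no_rep_involution[OF _ hs(1-3) _ m] by blast
    qed
    moreover have "has_affine_rep G e H \<or> (\<exists>h s. H = {\<one>, h} \<and> odd (X h) \<and> [A h = -1] (mod 2 ^ e)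
              \<and> stab = {\<one>, s} \<and> [A s = 1 + 2 ^ (e - 1)] (mod 2 ^ e)) \<and>
            (card M \<ge> 8 \<or> (card M = 4 \<and> card (derived G (carrier G)) = 4))"
      unfolding M_def by (rule has_affine_rep_trivial_intersection[OF H cardH HN]) blast+
    ultimately show ?thesis using 3 by auto
  qed
qed

end

section \<open>The holomorph\<close>

lemma hom_of_affine_rep:
  assumes "affine_rep G e c \<alpha>"
  shows "(\<lambda>x. (c x mod 2 ^ e, \<alpha> x mod 2 ^ e)) \<in> hom G (hol e)"
proof -
  interpret affine_rep G e c \<alpha> by fact
  have e1: "1 \<le> e" using e_ge_2 by simp
  show ?thesis
  proof (rule homI)
    fix x assume "x \<in> carrier G"
    then show "(c x mod 2 ^ e, \<alpha> x mod 2 ^ e) \<in> carrier (hol e)"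
      using e1 A_odd by (intro mod_in_carrier_hol)
  next
    fix x y assume xy: "x \<in> carrier G" "y \<in> carrier G"
    have "[c x mod 2 ^ e + c y mod 2 ^ e * (\<alpha> x mod 2 ^ e) = c x + c y * \<alpha> x] (mod 2 ^ e)"
      by (intro cong_add cong_mult) (simp_all add: cong_def)
    moreover have "[\<alpha> x mod 2 ^ e * (\<alpha> y mod 2 ^ e) = \<alpha> x * \<alpha> y] (mod 2 ^ e)"
      by (intro cong_mult) (simp_all add: cong_def)
    ultimately show "(c (x \<otimes>\<^bsub>G\<^esub> y) mod 2 ^ e, \<alpha> (x \<otimes>\<^bsub>G\<^esub> y) mod 2 ^ e) =
        (c x mod 2 ^ e, \<alpha> x mod 2 ^ e) \<otimes>\<^bsub>hol e\<^esub> (c y mod 2 ^ e, \<alpha> y mod 2 ^ e)"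
      using X_mult[OF xy] A_mult[OF xy] by (simp add: mult_hol cong_def mult.commute)
  qed
qed

section \<open>The core and the passage to transitive subgroups\<close>

context group
begin

lemma core_iff:
  assumes H: "subgroup H G"
  shows "x \<in> core G H \<longleftrightarrow> x \<in> carrier G \<and> (\<forall>g\<in>carrier G. inv g \<otimes> x \<otimes> g \<in> H)"
proof -
  have Hc: "h \<in> carrier G" if "h \<in> H" for h using H that by (rule subgroup.mem_carrier)
  have "x \<in> {g \<otimes> h \<otimes> inv g | h. h \<in> H} \<longleftrightarrow> x \<in> carrier G \<and> inv g \<otimes> x \<otimes> g \<in> H" if g: "g \<in> carrier G" for g
  proof
    assume "x \<in> {g \<otimes> h \<otimes> inv g | h. h \<in> H}"
    then obtain h where h: "h \<in> H" "x = g \<otimes> h \<otimes> inv g" by blast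
    have "inv g \<otimes> (g \<otimes> h \<otimes> inv g) \<otimes> g = h"
      using g Hc[OF h(1)] by (simp add: m_assoc) (simp add: m_assoc[symmetric])
    then show "x \<in> carrier G \<and> inv g \<otimes> x \<otimes> g \<in> H" using h g Hc[OF h(1)] by simp
  next
    assume x: "x \<in> carrier G \<and> inv g \<otimes> x \<otimes> g \<in> H"
    have "x = g \<otimes> (inv g \<otimes> x \<otimes> g) \<otimes> inv g"
      using g x by (simp add: m_assoc) (simp add: m_assoc[symmetric])
    then show "x \<in> {g \<otimes> h \<otimes> inv g | h. h \<in> H}" using x by blast
  qed
  then show ?thesis unfolding core_def using one_closed by auto
qed

lemma core_subset:
  assumes "subgroup H G"
  shows "core G H \<subseteq> H"
proof
  fix x assume x: "x \<in> core G H"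
  then have "inv \<one> \<otimes> x \<otimes> \<one> \<in> H" unfolding core_iff[OF assms] by blast
  then show "x \<in> H" using x by (simp add: core_iff[OF assms])
qed

lemma normal_core:
  assumes H: "subgroup H G"
  shows "core G H \<lhd> G"
  unfolding normal_inv_iff
proof (intro conjI ballI)
  show "subgroup (core G H) G"
  proof
    show "core G H \<subseteq> carrier G" by (auto simp: core_iff[OF H])
    show "\<one> \<in> core G H" using subgroup.one_closed[OF H] by (simp add: core_iff[OF H])
  next
    fix x y assume xy: "x \<in> core G H" "y \<in> core G H"
    have "inv g \<otimes> (x \<otimes> y) \<otimes> g \<in> H" if g: "g \<in> carrier G" for g
    proof -
      have "inv g \<otimes> (x \<otimes> y) \<otimes> g = (inv g \<otimes> x \<otimes> g) \<otimes> (inv g \<otimes> y \<otimes> g)"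
      proof -
        have "g \<otimes> (inv g \<otimes> (y \<otimes> g)) = y \<otimes> g" using xy g by (simp add: core_iff[OF H] m_assoc[symmetric])
        then show ?thesis using xy g by (simp add: core_iff[OF H] m_assoc)
      qed
      then show ?thesis using xy g H by (simp add: core_iff[OF H] subgroup.m_closed)
    qed
    then show "x \<otimes> y \<in> core G H" using xy by (simp add: core_iff[OF H])
  next
    fix x assume x: "x \<in> core G H"
    have "inv g \<otimes> inv x \<otimes> g \<in> H" if g: "g \<in> carrier G" for g
    proof -
      have "inv g \<otimes> inv x \<otimes> g = inv (inv g \<otimes> x \<otimes> g)"
        using x g by (simp add: core_iff[OF H] inv_mult_group m_assoc)
      then show ?thesis using x g H by (simp add: core_iff[OF H] subgroup.m_inv_closed)
    qed
    then show "inv x \<in> core G H" using x by (simp add: core_iff[OF H])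
  qed
next
  fix y x assume y: "y \<in> carrier G" and x: "x \<in> core G H"
  have "inv g \<otimes> (y \<otimes> x \<otimes> inv y) \<otimes> g \<in> H" if g: "g \<in> carrier G" for g
  proof -
    have "inv g \<otimes> (y \<otimes> x \<otimes> inv y) \<otimes> g = inv (inv y \<otimes> g) \<otimes> x \<otimes> (inv y \<otimes> g)"
      using x y g by (simp add: core_iff[OF H] inv_mult_group m_assoc)
    then show ?thesis using x y g by (simp add: core_iff[OF H])
  qed
  then show "y \<otimes> x \<otimes> inv y \<in> core G H" using x y by (simp add: core_iff[OF H])
qed

text \<open>The point stabilisers of a transitive action are the conjugates of \<open>H\<close>, so
  their intersection, the kernel of the action, is the core. Hence the image of a representation is
  a copy of the quotient; conversely an isomorphism is composed with the projection.\<close>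

lemma ex_iso_transitive_sub_iff:
  assumes e: "2 \<le> e" and H: "subgroup H G" and card: "card (rcosets H) = 2 ^ e"
  shows "(\<exists>T \<phi>. transitive_sub e T \<and> \<phi> \<in> iso (G Mod core G H) ((hol e)\<lparr>carrier := T\<rparr>) \<and>
      \<phi> ` ((\<lambda>h. core G H #> h) ` H) = stab1 e T) \<longleftrightarrow> has_affine_rep G e H"
proof
  let ?C = "core G H"
  interpret C: normal ?C G by (rule normal_core[OF H])
  have Hc: "h \<in> carrier G" if "h \<in> H" for h using H that by (rule subgroup.mem_carrier)
  assume "\<exists>T \<phi>. transitive_sub e T \<and> \<phi> \<in> iso (G Mod ?C) ((hol e)\<lparr>carrier := T\<rparr>) \<and>
      \<phi> ` ((\<lambda>h. ?C #> h) ` H) = stab1 e T"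
  then obtain T \<phi> where T: "transitive_sub e T" and \<phi>: "\<phi> \<in> iso (G Mod ?C) ((hol e)\<lparr>carrier := T\<rparr>)"
    and im: "\<phi> ` ((\<lambda>h. ?C #> h) ` H) = stab1 e T" by blast
  have T_sub: "T \<subseteq> carrier (hol e)" using T subgroup.subset by (auto simp: transitive_sub_def)
  have \<phi>_hom: "\<phi> \<in> hom (G Mod ?C) ((hol e)\<lparr>carrier := T\<rparr>)" and bij: "bij_betw \<phi> (carrier (G Mod ?C)) T"
    using \<phi> by (simp_all add: iso_def)
  have coset: "?C #> x \<in> carrier (G Mod ?C)" if "x \<in> carrier G" for x
    using that by (auto simp: FactGroup_def RCOSETS_def)
  have \<phi>T: "\<phi> (?C #> x) \<in> T" if "x \<in> carrier G" for x
    using bij coset[OF that] by (auto simp: bij_betw_def)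
  have hom: "(\<lambda>x. \<phi> (?C #> x)) \<in> hom G (hol e)"
  proof (rule homI)
    fix x assume "x \<in> carrier G"
    then show "\<phi> (?C #> x) \<in> carrier (hol e)" using \<phi>T T_sub by blast
  next
    fix x y assume xy: "x \<in> carrier G" "y \<in> carrier G"
    have "?C #> (x \<otimes> y) = (?C #> x) \<otimes>\<^bsub>G Mod ?C\<^esub> (?C #> y)"
      using xy by (simp add: FactGroup_def C.rcos_sum)
    then show "\<phi> (?C #> (x \<otimes> y)) = \<phi> (?C #> x) \<otimes>\<^bsub>hol e\<^esub> \<phi> (?C #> y)"
      using hom_mult[OF \<phi>_hom coset[OF xy(1)] coset[OF xy(2)]] by simp
  qed
  have "[fst (\<phi> (?C #> x)) = 0] (mod 2 ^ e) \<longleftrightarrow> x \<in> H" if x: "x \<in> carrier G" for x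
  proof -
    have "\<phi> (?C #> x) \<in> carrier (hol e)" using \<phi>T[OF x] T_sub by blast
    then have "[fst (\<phi> (?C #> x)) = 0] (mod 2 ^ e) \<longleftrightarrow> \<phi> (?C #> x) \<in> stab1 e T"
      using \<phi>T[OF x] by (cases "\<phi> (?C #> x)") (auto simp: stab1_def holAut_def carrier_hol_iff cong_def)
    also have "\<dots> \<longleftrightarrow> x \<in> H"
    proof
      assume "\<phi> (?C #> x) \<in> stab1 e T"
      then obtain h where h: "h \<in> H" "\<phi> (?C #> x) = \<phi> (?C #> h)" unfolding im[symmetric] by blast
      then have "?C #> x = ?C #> h"
        using bij coset[OF x] coset[OF Hc[OF h(1)]] by (auto simp: bij_betw_def dest: inj_onD)
      then have "x \<in> ?C #> h" using rcos_self[OF x C.subgroup_axioms] by simp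
      then obtain k where "k \<in> ?C" "x = k \<otimes> h" by (auto simp: r_coset_def)
      then show "x \<in> H" using h(1) core_subset[OF H] H by (auto simp: subgroup.m_closed)
    next
      assume "x \<in> H"
      then show "\<phi> (?C #> x) \<in> stab1 e T" unfolding im[symmetric] by blast
    qed
    finally show ?thesis .
  qed
  then show "has_affine_rep G e H"
    unfolding has_affine_rep_def using affine_rep_hom[OF e group_axioms hom] by blast
next
  let ?C = "core G H"
  have Hc: "h \<in> carrier G" if "h \<in> H" for h using H that by (rule subgroup.mem_carrier)
  assume "has_affine_rep G e H"
  then obtain c \<alpha> where R: "affine_rep G e c \<alpha>"
    and zero: "\<And>x. x \<in> carrier G \<Longrightarrow> [c x = 0] (mod 2 ^ e) \<longleftrightarrow> x \<in> H"
    unfolding has_affine_rep_def by blast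
  interpret R: transitive_affine_rep G e c \<alpha>
    by (rule affine_rep.affine_rep_transitive[OF R H card zero])
  have e1: "1 \<le> e" using e by simp
  interpret L: group "hol e" by (rule group_hol[OF e1])
  define F where "F x = (c x mod 2 ^ e, \<alpha> x mod 2 ^ e)" for x
  have F_hom: "F \<in> hom G (hol e)" unfolding F_def by (rule hom_of_affine_rep[OF R])
  interpret F: group_hom G "hol e" F using F_hom by unfold_locales
  define T where "T = F ` carrier G"
  have T: "subgroup T (hol e)" unfolding T_def by (rule F.img_is_subgroup)
  have trans: "transitive_sub e T"
    unfolding transitive_sub_def
  proof (intro conjI allI impI)
    show "subgroup T (hol e)" by (rule T)
    fix v w :: int assume vw: "0 \<le> v \<and> v < 2 ^ e \<and> 0 \<le> w \<and> w < 2 ^ e"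
    obtain y where y: "y \<in> carrier G" "[c y = v] (mod 2 ^ e)" using R.X_surj by blast
    obtain z where z: "z \<in> carrier G" "[c z = w] (mod 2 ^ e)" using R.X_surj by blast
    let ?x = "z \<otimes> inv y"
    have x: "?x \<in> carrier G" using y z by simp
    have "?x \<otimes> y = z" using y z by (simp add: m_assoc)
    then have "[c z = c ?x + \<alpha> ?x * c y] (mod 2 ^ e)" using R.X_mult[OF x y(1)] by simp
    then have "[c ?x + \<alpha> ?x * v = w] (mod 2 ^ e)"
      using y(2) z(2) unfolding fold_cong by Groebner_Basis.algebra
    moreover have "[c ?x mod 2 ^ e + (\<alpha> ?x mod 2 ^ e) * v = c ?x + \<alpha> ?x * v] (mod 2 ^ e)"
      by (intro cong_add cong_mult cong_refl) (simp_all add: cong_def)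
    ultimately have "hol_act e (F ?x) v = w" using vw by (simp add: hol_act_def F_def cong_def)
    then show "\<exists>g\<in>T. hol_act e g v = w" using x unfolding T_def by blast
  qed
  have "group ((hol e)\<lparr>carrier := T\<rparr>)" by (rule L.subgroup_imp_group[OF T])
  moreover have "F \<in> hom G ((hol e)\<lparr>carrier := T\<rparr>)" using F_hom by (auto simp: hom_def T_def)
  ultimately interpret FT: group_hom G "(hol e)\<lparr>carrier := T\<rparr>" F
    by (intro group_hom.intro group_hom_axioms.intro group_axioms)
  have F_one: "F x = \<one>\<^bsub>hol e\<^esub> \<longleftrightarrow> [c x = 0] (mod 2 ^ e) \<and> [\<alpha> x = 1] (mod 2 ^ e)" for x
    using e1 by (simp add: F_def one_hol cong_def)
  have kernel: "kernel G ((hol e)\<lparr>carrier := T\<rparr>) F = ?C"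
  proof (intro equalityI subsetI)
    fix x assume "x \<in> kernel G ((hol e)\<lparr>carrier := T\<rparr>) F"
    then have x: "x \<in> carrier G" "[c x = 0] (mod 2 ^ e)" "[\<alpha> x = 1] (mod 2 ^ e)"
      using F_one[of x] by (simp_all add: kernel_def)
    have "inv g \<otimes> x \<otimes> g \<in> H" if g: "g \<in> carrier G" for g
    proof -
      have "[c g = c (x \<otimes> g)] (mod 2 ^ e)"
        using R.X_mult[OF x(1) g] x(2,3) unfolding fold_cong by Groebner_Basis.algebra
      then have "[c (inv g \<otimes> (x \<otimes> g)) = 0] (mod 2 ^ e)"
        using R.X_inv_mult_0_iff[of g "x \<otimes> g"] x(1) g by simp
      then show ?thesis using zero[of "inv g \<otimes> (x \<otimes> g)"] x(1) g by (simp add: m_assoc)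
    qed
    then show "x \<in> ?C" using x(1) by (simp add: core_iff[OF H])
  next
    fix x assume "x \<in> ?C"
    then have x: "x \<in> carrier G" and conj: "\<And>g. g \<in> carrier G \<Longrightarrow> inv g \<otimes> x \<otimes> g \<in> H"
      by (auto simp: core_iff[OF H])
    \<comment> \<open>Conjugating \<open>x\<close> by \<open>g\<close> into \<open>H\<close> says
      that \<open>x\<close> fixes the point \<open>c g\<close>.\<close>
    have fixes_all: "[c g = c x + \<alpha> x * c g] (mod 2 ^ e)" if g: "g \<in> carrier G" for g
    proof -
      have "[c (inv g \<otimes> (x \<otimes> g)) = 0] (mod 2 ^ e)"
        using zero[of "inv g \<otimes> (x \<otimes> g)"] conj[OF g] x g by (simp add: m_assoc)
      then have "[c g = c (x \<otimes> g)] (mod 2 ^ e)"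
        using R.X_inv_mult_0_iff[of g "x \<otimes> g"] x g by simp
      then show ?thesis using R.X_mult[OF x g] by (rule cong_trans)
    qed
    have c0: "[c x = 0] (mod 2 ^ e)"
      using fixes_all[OF one_closed] R.X_one unfolding fold_cong by Groebner_Basis.algebra
    \<comment> \<open>An affine map that fixes both 0 and 1 has slope 1.\<close>
    obtain g where g: "g \<in> carrier G" "[c g = 1] (mod 2 ^ e)" using R.X_surj by blast
    have "[\<alpha> x = 1] (mod 2 ^ e)"
      using fixes_all[OF g(1)] g(2) c0 unfolding fold_cong by Groebner_Basis.algebra
    then show "x \<in> kernel G ((hol e)\<lparr>carrier := T\<rparr>) F"
      using x c0 F_one[of x] by (simp add: kernel_def)
  qed
  have "(\<lambda>X. the_elem (F ` X)) \<in> iso (G Mod ?C) ((hol e)\<lparr>carrier := T\<rparr>)"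
    using FT.FactGroup_iso_set unfolding kernel by (simp add: T_def)
  moreover have "(\<lambda>X. the_elem (F ` X)) ` ((\<lambda>h. ?C #> h) ` H) = stab1 e T"
  proof -
    have "the_elem (F ` (?C #> h)) = F h" if h: "h \<in> H" for h
    proof -
      have F_coset: "F (k \<otimes> h) = F h" if "k \<in> ?C" for k
        using that Hc[OF h] F.hom_mult[of k h] F.hom_closed[OF Hc[OF h]]
        unfolding kernel[symmetric] by (simp add: kernel_def)
      have "\<one> \<in> ?C" using normal_imp_subgroup[OF normal_core[OF H]] by (rule subgroup.one_closed)
      then have "(\<lambda>k. F h) ` ?C = {F h}" by (rule image_constant)
      moreover have "(\<lambda>k. F (k \<otimes> h)) ` ?C = (\<lambda>k. F h) ` ?C" using F_coset by (rule image_cong[OF refl])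
      ultimately have "(\<lambda>k. F (k \<otimes> h)) ` ?C = {F h}" by simp
      moreover have "F ` (?C #> h) = (\<lambda>k. F (k \<otimes> h)) ` ?C" unfolding r_coset_def by blast
      ultimately show ?thesis by simp
    qed
    then have "(\<lambda>X. the_elem (F ` X)) ` ((\<lambda>h. ?C #> h) ` H) = F ` H" by (force simp: image_iff)
    also have "F ` H = stab1 e T"
    proof (intro equalityI subsetI)
      fix y assume "y \<in> F ` H"
      then obtain h where h: "h \<in> H" "y = F h" by blast
      then have "c h mod 2 ^ e = 0" using zero[OF Hc[OF h(1)]] by (simp add: cong_def)
      then show "y \<in> stab1 e T"
        using h Hc[OF h(1)] F.hom_closed[OF Hc[OF h(1)]]
        by (auto simp: stab1_def holAut_def T_def F_def)
    next
      fix y assume "y \<in> stab1 e T"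
      then have "y \<in> T" "fst y = 0" by (auto simp: stab1_def holAut_def)
      then obtain x where x: "x \<in> carrier G" "y = F x" "fst (F x) = 0" unfolding T_def by blast
      then have "x \<in> H" using zero[OF x(1)] by (simp add: F_def cong_def)
      then show "y \<in> F ` H" using x by blast
    qed
    finally show ?thesis .
  qed
  ultimately show "\<exists>T \<phi>. transitive_sub e T \<and> \<phi> \<in> iso (G Mod ?C) ((hol e)\<lparr>carrier := T\<rparr>) \<and>
      \<phi> ` ((\<lambda>h. ?C #> h) ` H) = stab1 e T"
    using trans by blast
qed

lemma generate_involution:
  assumes "h \<in> carrier G" "h \<otimes> h = \<one>"
  shows "generate G {h} = {\<one>, h}"
proof
  have "inv h = h" using assms by (simp add: inv_equality)
  then have "subgroup {\<one>, h} G" using assms by unfold_locales auto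
  then show "generate G {h} \<subseteq> {\<one>, h}" by (intro generate_subgroup_incl) auto
  show "{\<one>, h} \<subseteq> generate G {h}" by (auto intro: generate.one generate.incl)
qed

end

section \<open>Transitive subgroups as faithful affine representations\<close>

lemma finite_carrier_hol: "finite (carrier (hol e))"
proof (rule finite_subset)
  show "carrier (hol e) \<subseteq> {0..<2 ^ e} \<times> {0..<2 ^ e}" by (auto simp: hol_def)
qed simp

lemma faithful_affine_rep_transitive_sub:
  assumes e: "2 \<le> e" and G: "transitive_sub e G"
  shows "faithful_affine_rep ((hol e)\<lparr>carrier := G\<rparr>) e fst snd"
proof -
  interpret L: group "hol e" using e by (intro group_hol) simp
  have sub: "subgroup G (hol e)" using G by (simp add: transitive_sub_def)
  have G_sub: "G \<subseteq> carrier (hol e)" using sub by (rule subgroup.subset)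
  interpret K: group "(hol e)\<lparr>carrier := G\<rparr>" by (rule L.subgroup_imp_group[OF sub])
  interpret affine_rep "(hol e)\<lparr>carrier := G\<rparr>" e fst snd
    using affine_rep_hom[OF e K.group_axioms, of "\<lambda>x. x"] G_sub by (auto simp: hom_def)
  show ?thesis
  proof unfold_locales
    fix w :: int
    have "\<exists>g\<in>G. hol_act e g 0 = w mod 2 ^ e" using G by (simp add: transitive_sub_def)
    then show "\<exists>x\<in>carrier ((hol e)\<lparr>carrier := G\<rparr>). [fst x = w] (mod 2 ^ e)"
      by (simp add: hol_act_def cong_def)
  next
    fix x assume "x \<in> carrier ((hol e)\<lparr>carrier := G\<rparr>)" "[fst x = 0] (mod 2 ^ e)" "[snd x = 1] (mod 2 ^ e)"
    then show "x = \<one>\<^bsub>(hol e)\<lparr>carrier := G\<rparr>\<^esub>"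
      using G_sub by (auto simp: one_hol intro!: hol_eqI[of x e "(0, 1)"] L.one_closed[unfolded one_hol])
  next
    show "finite (carrier ((hol e)\<lparr>carrier := G\<rparr>))"
      using finite_subset[OF G_sub finite_carrier_hol] by simp
  qed
qed

text \<open>Makes \<open>ord_eq_iff\<close> available in the full holomorph, where the orders in
  (ii) are taken.\<close>

lemma transitive_sub_carrier_hol:
  assumes "1 \<le> e"
  shows "transitive_sub e (carrier (hol e))"
  unfolding transitive_sub_def
proof (intro conjI allI impI)
  show "subgroup (carrier (hol e)) (hol e)" using group.subgroup_self[OF group_hol[OF assms]] .
  fix v w :: int assume "0 \<le> v \<and> v < 2 ^ e \<and> 0 \<le> w \<and> w < 2 ^ e"
  then have "hol_act e ((w - v) mod 2 ^ e, 1 mod 2 ^ e) v = w"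
    using assms by (simp add: hol_act_def mod_simps)
  moreover have "((w - v) mod 2 ^ e, 1 mod 2 ^ e) \<in> carrier (hol e)"
    using assms by (rule mod_in_carrier_hol) simp
  ultimately show "\<exists>g\<in>carrier (hol e). hol_act e g v = w" by (rule bexI)
qed

lemma ord_hol_eq_iff:
  assumes "2 \<le> e" "g \<in> carrier (hol e)"
  shows "group.ord (hol e) g = 2 ^ e \<longleftrightarrow> odd (fst g) \<and> snd g mod 4 = 1"
proof -
  interpret faithful_affine_rep "hol e" e fst snd
    using faithful_affine_rep_transitive_sub[OF assms(1) transitive_sub_carrier_hol] assms(1) by simp
  show ?thesis by (rule ord_eq_iff[OF assms(2)])
qed

lemma stab1_eq:
  assumes "G \<subseteq> carrier (hol e)"
  shows "stab1 e G = {x \<in> G. [fst x = 0] (mod 2 ^ e)}"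
proof -
  have "x \<in> holAut e \<longleftrightarrow> [fst x = 0] (mod 2 ^ e)" if "x \<in> G" for x
  proof -
    have x: "x \<in> carrier (hol e)" using that assms by blast
    then have "fst x mod 2 ^ e = fst x" by (cases x) (simp add: carrier_hol_iff)
    moreover have "x \<in> holAut e \<longleftrightarrow> fst x = 0" using x by (cases x) (simp add: holAut_def)
    ultimately show ?thesis unfolding cong_def by simp
  qed
  then show ?thesis by (auto simp: stab1_def)
qed

lemma Int_holN_eq:
  assumes "1 \<le> e" "G \<subseteq> carrier (hol e)"
  shows "G \<inter> holN e = {x \<in> G. [snd x = 1] (mod 2 ^ e)}"
proof -
  have "x \<in> holN e \<longleftrightarrow> [snd x = 1] (mod 2 ^ e)" if "x \<in> G" for x
  proof -
    have x: "x \<in> carrier (hol e)" using that assms by blast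
    then have "snd x mod 2 ^ e = snd x" by (cases x) (simp add: carrier_hol_iff)
    moreover have "x \<in> holN e \<longleftrightarrow> snd x = 1" using x by (cases x) (simp add: holN_def)
    moreover have "1 mod 2 ^ e = (1::int)" using assms(1) by simp
    ultimately show ?thesis unfolding cong_def by simp
  qed
  then show ?thesis by auto
qed

lemma generate_reflection:
  assumes e: "1 \<le> e" and u: "odd u"
  shows "generate (hol e) {(u mod 2 ^ e, (-1) mod 2 ^ e)} = {(0, 1), (u mod 2 ^ e, (-1) mod 2 ^ e)}"
proof -
  interpret L: group "hol e" by (rule group_hol[OF e])
  have "(u mod 2 ^ e, (-1) mod 2 ^ e) \<in> carrier (hol e)" using e by (rule mod_in_carrier_hol) simp
  moreover have "[u mod 2 ^ e + u mod 2 ^ e * ((-1) mod 2 ^ e) = u + u * (-1)] (mod 2 ^ e)"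
    by (intro cong_add cong_mult) (simp_all only: cong_def mod_mod_trivial)
  moreover have "[(-1) mod 2 ^ e * ((-1) mod 2 ^ e) = (-1) * (-1::int)] (mod 2 ^ e)"
    by (intro cong_mult) (simp_all only: cong_def mod_mod_trivial)
  ultimately show ?thesis
    using L.generate_involution[of "(u mod 2 ^ e, (-1) mod 2 ^ e)"] e
    by (simp add: mult_hol one_hol cong_def)
qed

lemma generate_stab:
  assumes e: "2 \<le> e"
  shows "generate (hol e) {(0, (1 + 2 ^ (e - 1)) mod 2 ^ e)} = {(0, 1), (0, (1 + 2 ^ (e - 1)) mod 2 ^ e)}"
proof -
  interpret L: group "hol e" using e by (intro group_hol) simp
  let ?a = "1 + 2 ^ (e - 1) :: int"
  have "(0 mod 2 ^ e, ?a mod 2 ^ e) \<in> carrier (hol e)" using e by (intro mod_in_carrier_hol) simp_all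
  then have "(0, ?a mod 2 ^ e) \<in> carrier (hol e)" by simp
  moreover have "[?a mod 2 ^ e * (?a mod 2 ^ e) = 1] (mod 2 ^ e)"
  proof -
    obtain d where "e = Suc (Suc d)" using e by (metis add_2_eq_Suc le_Suc_ex)
    then have "?a * ?a - 1 = 2 ^ e * (1 + 2 ^ d)" by (simp add: algebra_simps)
    then have "[?a * ?a = 1] (mod 2 ^ e)" by (simp only: cong_iff_dvd_diff dvd_triv_left)
    moreover have "[?a mod 2 ^ e * (?a mod 2 ^ e) = ?a * ?a] (mod 2 ^ e)"
      by (intro cong_mult) (simp_all only: cong_def mod_mod_trivial)
    ultimately show ?thesis using cong_trans by blast
  qed
  ultimately show ?thesis
    using L.generate_involution[of "(0, ?a mod 2 ^ e)"] e
    by (simp add: mult_hol one_hol cong_def)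
qed

theorem theorem1p6:
  fixes e :: nat and G H :: "(int \<times> int) set"
  defines "K \<equiv> (hol e)\<lparr>carrier := G\<rparr>"
  defines "C \<equiv> core K H"
  assumes e2: "e \<ge> 2"
    and Gtrans: "transitive_sub e G"
    and Hsub: "subgroup H K"
    and Hind: "card (rcosets\<^bsub>K\<^esub> H) = 2 ^ e"
  shows "(\<not> (\<exists>T \<phi>. transitive_sub e T \<and>
              \<phi> \<in> iso (K Mod C) ((hol e)\<lparr>carrier := T\<rparr>) \<and>
              \<phi> ` ((\<lambda>h. C #>\<^bsub>K\<^esub> h) ` H) = stab1 e T))
    \<longleftrightarrow>
         (card (H \<inter> holN e) \<ge> 4
        \<or> (card (H \<inter> holN e) = 2 \<and> (\<forall>g\<in>G. group.ord (hol e) g \<noteq> 2 ^ e))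
        \<or> (card (H \<inter> holN e) = 2 \<and> \<not> normal H K)
        \<or> (card (H \<inter> holN e) = 1
           \<and> (\<exists>u. odd u \<and> H = generate (hol e) {(u mod 2 ^ e, (-1) mod 2 ^ e)})
           \<and> card G = 2 ^ (e + 1)
           \<and> stab1 e G = generate (hol e) {(0, (1 + 2 ^ (e - 1)) mod 2 ^ e)}
           \<and> (card (G \<inter> holN e) \<ge> 8
              \<or> (card (G \<inter> holN e) = 4 \<and> card (derived K G) = 4))))"
proof -
  have e1: "1 \<le> e" using e2 by simp
  have G_sub: "G \<subseteq> carrier (hol e)" using Gtrans subgroup.subset by (auto simp: transitive_sub_def)
  interpret K: faithful_affine_rep K e fst snd
    unfolding K_def by (rule faithful_affine_rep_transitive_sub[OF e2 Gtrans])
  have carrier_K: "carrier K = G" and one_K: "\<one>\<^bsub>K\<^esub> = (0, 1)" by (simp_all add: K_def one_hol)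
  have H_G: "H \<subseteq> G" using subgroup.subset[OF Hsub] carrier_K by simp
  then have H_sub: "H \<subseteq> carrier (hol e)" using G_sub by simp
  have stab: "K.stab = stab1 e G" unfolding stab1_eq[OF G_sub] K.stab_def carrier_K ..
  have reg: "(\<forall>g\<in>G. \<not> (odd (fst g) \<and> snd g mod 4 = 1)) \<longleftrightarrow> (\<forall>g\<in>G. group.ord (hol e) g \<noteq> 2 ^ e)"
    using ord_hol_eq_iff[OF e2] G_sub by blast
  \<comment> \<open>Both generators are involutions, so the generated groups are explicit pairs. The
    order of \<open>G\<close> comes from the stabiliser having two elements, for which
    \<open>s\<close> must differ from the identity.\<close>
  have iv: "(\<exists>h s. H = {(0, 1), h} \<and> odd (fst h) \<and> [snd h = -1] (mod 2 ^ e)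
          \<and> stab1 e G = {(0, 1), s} \<and> [snd s = 1 + 2 ^ (e - 1)] (mod 2 ^ e)) \<longleftrightarrow>
      (\<exists>u. odd u \<and> H = generate (hol e) {(u mod 2 ^ e, (-1) mod 2 ^ e)}) \<and> card G = 2 ^ (e + 1)
        \<and> stab1 e G = generate (hol e) {(0, (1 + 2 ^ (e - 1)) mod 2 ^ e)}" (is "?l \<longleftrightarrow> ?r")
  proof
    assume ?l
    then obtain h s where h: "H = {(0, 1), h}" "odd (fst h)" "[snd h = -1] (mod 2 ^ e)"
      and s: "stab1 e G = {(0, 1), s}" "[snd s = 1 + 2 ^ (e - 1)] (mod 2 ^ e)" by blast
    have "h \<in> carrier (hol e)" using h(1) H_sub by blast
    then have "h = (fst h mod 2 ^ e, (-1) mod 2 ^ e)"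
      using h(3) by (cases h) (simp add: carrier_hol_iff cong_def)
    then have "H = generate (hol e) {(fst h mod 2 ^ e, (-1) mod 2 ^ e)}"
      unfolding generate_reflection[OF e1 h(2)] using h(1) by simp
    moreover have sG: "s \<in> stab1 e G" using s(1) by simp
    then have "fst s = 0" "s \<in> carrier (hol e)" using G_sub by (auto simp: stab1_def holAut_def)
    then have "s = (0, (1 + 2 ^ (e - 1)) mod 2 ^ e)"
      using s(2) by (cases s) (simp add: carrier_hol_iff cong_def)
    then have "stab1 e G = generate (hol e) {(0, (1 + 2 ^ (e - 1)) mod 2 ^ e)}"
      unfolding generate_stab[OF e2] using s(1) by simp
    moreover have "s \<noteq> (0, 1)"
    proof
      assume "s = (0, 1)"
      then have "2 ^ e dvd (2::int) ^ (e - 1)"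
        using s(2) by (simp add: cong_iff_dvd_diff)
      then show False using pow2_dvd_mult_half_iff[OF e1, of 1] by simp
    qed
    then have "card G = 2 ^ (e + 1)"
      using K.card_carrier[OF K.finite_carrier] unfolding stab carrier_K s(1) by simp
    ultimately show ?r using h(2) by blast
  next
    assume r: ?r
    then obtain u where u: "odd u" "H = {(0, 1), (u mod 2 ^ e, (-1) mod 2 ^ e)}"
      using generate_reflection[OF e1] by metis
    have "odd (fst (u mod 2 ^ e, (-1) mod (2::int) ^ e))" using u(1) by (simp add: odd_mod_pow2[OF e1])
    moreover have "[snd (u mod 2 ^ e, (-1) mod 2 ^ e) = -1] (mod 2 ^ e)" by (simp add: cong_def)
    moreover have "stab1 e G = {(0, 1), (0, (1 + 2 ^ (e - 1)) mod 2 ^ e)}"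
      using r generate_stab[OF e2] by simp
    moreover have "[snd (0, (1 + 2 ^ (e - 1)) mod 2 ^ e) = 1 + 2 ^ (e - 1)] (mod 2 ^ e)"
      by (simp add: cong_def)
    ultimately show ?l using u(2) by blast
  qed
  show ?thesis
    unfolding C_def K.ex_iso_transitive_sub_iff[OF e2 Hsub Hind] K.not_has_affine_rep_iff[OF Hsub Hind]
      carrier_K one_K stab Int_holN_eq[OF e1 H_sub] Int_holN_eq[OF e1 G_sub] reg iv
    by (simp only: conj_assoc)
qed

end
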